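(* Let $G$ be a finite group acting on a Frobenius cyclic poset $(\mathcal{X},\mathcal{X}_0)$, and let $R$ be a discrete valuation ring whose residue field has characteristic not dividing $n=|G|$ and which contains all $n$-th roots of unity. Let $\mathcal{F}=\mathcal{F}(\mathcal{X},\mathcal{X}_0)$. Then $\mathcal{F}^G=\mathcal{F}^G(\mathcal{X},\mathcal{X}_0)$ (with the exact structure given in the context) is a Frobenius category, and its projective-injective objects are the components (direct summands) of the objects $SP$ for $P\in\mathcal{F}_0$, where $\mathcal{F}_0=\operatorname{add}\mathcal{X}_0$ is the full subcategory of projective-injective objects of $\mathcal{F}$.
   Context: A reduced cocycle on a set $\mathcal{X}$ is a function $c:\mathcal{X}^3\to\mathbb{N}=\{0,1,2,\dots\}$ with $c(X,Y,Z)-c(W,Y,Z)+c(W,X,Z)-c(W,X,Y)=0$ and $c(X,X,Y)=0=c(X,Y,Y)$ for all $W,X,Y,Z\in\mathcal{X}$. A cyclic poset is a set with a reduced cocycle. Given a cyclic poset $(\mathcal{X},c)$ and a discrete valuation ring $R$ with uniformizer $u$, $\mathcal{P}(\mathcal{X})$ is the $R$-category with object set $\mathcal{X}$, in which each $\mathrm{Hom}(X,Y)$ is a free $R$-module of rank one on a generator $f_{XY}$ (the basic morphism), with $f_{XX}=\mathrm{id}$ and $f_{YZ}\circ f_{XY}=u^{c(X,Y,Z)}f_{XZ}$. Let $\operatorname{add}\mathcal{P}(\mathcal{X})$ be the additive category of finite (ordered) direct sums of objects of $\mathcal{X}$. Two elements $X,Y\in\mathcal{X}$ are isomorphic iff $c(X,Y,X)=0$.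 Let $\mathcal{X}_0\subseteq\mathcal{X}$ be closed under isomorphism. The pair $(\mathcal{X},\mathcal{X}_0)$ is a Frobenius cyclic poset if, for every choice of $(R,u)$, $\operatorname{add}\mathcal{P}(\mathcal{X})$ admits the structure of a Frobenius category with $\mathcal{X}_0$ the set of indecomposable projective-injective objects. This exact structure is then unique ($A\to B\to C$ is exact iff $0\to \mathrm{Hom}(P,A)\to\mathrm{Hom}(P,B)\to\mathrm{Hom}(P,C)\to0$ and $0\to\mathrm{Hom}(C,P)\to\mathrm{Hom}(B,P)\to\mathrm{Hom}(A,P)\to0$ are exact for all $P\in\operatorname{add}\mathcal{X}_0$), and the Frobenius category is denoted $\mathcal{F}(\mathcal{X},\mathcal{X}_0)$. An action of $G$ on $(\mathcal{X},\mathcal{X}_0)$ is an action of $G$ on the set $\mathcal{X}$ with $c(\gamma X,\gamma Y,\gamma Z)=c(X,Y,Z)$ and $\gamma\mathcal{X}_0=\mathcal{X}_0$ for all $\gamma\in G$. It induces an $R$-linear action of $G$ on $\mathcal{F}$ with $\gamma(\bigoplus X_i)=\bigoplus\gamma X_i$ and $\gamma f_{XY}=f_{\gamma X,\gamma Y}$. The category $\mathcal{F}^G$: objects are pairs $(X,\xi)$ with $X\in\mathcal{F}$ and $\xi$ a family of isomorphisms $\xi_\gamma:\gamma X\to X$ ($\gamma\in G$) such that $\xi_{\alpha\beta}=\xi_\alpha\circ\alpha\xi_\beta$ for all $\alpha,\beta\in G$; a morphism $(X,\xi^X)\to(Y,\xi^Y)$ is a morphism $f:X\to Y$ in $\mathcal{F}$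 with $f\circ\xi^X_\gamma=\xi^Y_\gamma\circ\gamma f$ for all $\gamma$; a sequence in $\mathcal{F}^G$ is exact if its underlying sequence in $\mathcal{F}$ is exact. For $X\in\mathcal{F}$, $SX=(\bigoplus_{\gamma\in G}\gamma X,\xi)$, where $\xi_\beta$ sends the summand $\beta(\gamma X)$ of $\beta(\bigoplus_\gamma\gamma X)$ to the summand $(\beta\gamma)X$ by the identity map. *)

theory Defs
  imports "HOL-Algebra.Exact_Sequence" "HOL-Algebra.Group_Action" "HOL-Algebra.Ring_Divisibility"
begin

section \<open>Categories enriched in abelian groups\<close>

text \<open>Morphisms carry neither source nor target, so composition takes the three objects as
  arguments: \<open>Cmp C X Y Z g f\<close> is the composite of \<open>f : X \<rightarrow> Y\<close> and \<open>g : Y \<rightarrow> Z\<close>. Of the ring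
  record \<open>Hom C X Y\<close> only the additive part (\<open>carrier\<close>, \<open>add\<close>, \<open>zero\<close>) is meaningful.\<close>

record ('o, 'm) precategory =
  Obj :: "'o set"
  Hom :: "'o \<Rightarrow> 'o \<Rightarrow> 'm ring"
  Cmp :: "'o \<Rightarrow> 'o \<Rightarrow> 'o \<Rightarrow> 'm \<Rightarrow> 'm \<Rightarrow> 'm"
  Idt :: "'o \<Rightarrow> 'm"

abbreviation mor :: "('o, 'm) precategory \<Rightarrow> 'o \<Rightarrow> 'o \<Rightarrow> 'm set" where
  "mor C X Y \<equiv> carrier (Hom C X Y)"

abbreviation zero_mor :: "('o, 'm) precategory \<Rightarrow> 'o \<Rightarrow> 'o \<Rightarrow> 'm" where
  "zero_mor C X Y \<equiv> \<zero>\<^bsub>Hom C X Y\<^esub>"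

locale preadditive_category =
  fixes C :: "('o, 'm) precategory"
  assumes Hom_abelian_group: "\<lbrakk>X \<in> Obj C; Y \<in> Obj C\<rbrakk> \<Longrightarrow> abelian_group (Hom C X Y)"
    and Idt_closed: "X \<in> Obj C \<Longrightarrow> Idt C X \<in> mor C X X"
    and Cmp_closed: "\<lbrakk>X \<in> Obj C; Y \<in> Obj C; Z \<in> Obj C; f \<in> mor C X Y; g \<in> mor C Y Z\<rbrakk>
          \<Longrightarrow> Cmp C X Y Z g f \<in> mor C X Z"
    and Cmp_Idt_left: "\<lbrakk>X \<in> Obj C; Y \<in> Obj C; f \<in> mor C X Y\<rbrakk> \<Longrightarrow> Cmp C X Y Y (Idt C Y) f = f"
    and Cmp_Idt_right: "\<lbrakk>X \<in> Obj C; Y \<in> Obj C; f \<in> mor C X Y\<rbrakk> \<Longrightarrow> Cmp C X X Y f (Idt C X) = f"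
    and Cmp_assoc: "\<lbrakk>W \<in> Obj C; X \<in> Obj C; Y \<in> Obj C; Z \<in> Obj C;
          f \<in> mor C W X; g \<in> mor C X Y; h \<in> mor C Y Z\<rbrakk>
          \<Longrightarrow> Cmp C W Y Z h (Cmp C W X Y g f) = Cmp C W X Z (Cmp C X Y Z h g) f"
    and Cmp_add_left: "\<lbrakk>X \<in> Obj C; Y \<in> Obj C; Z \<in> Obj C;
          f \<in> mor C X Y; g \<in> mor C Y Z; g' \<in> mor C Y Z\<rbrakk>
          \<Longrightarrow> Cmp C X Y Z (g \<oplus>\<^bsub>Hom C Y Z\<^esub> g') f
              = Cmp C X Y Z g f \<oplus>\<^bsub>Hom C X Z\<^esub> Cmp C X Y Z g' f"
    and Cmp_add_right: "\<lbrakk>X \<in> Obj C; Y \<in> Obj C; Z \<in> Obj C;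
          f \<in> mor C X Y; f' \<in> mor C X Y; g \<in> mor C Y Z\<rbrakk>
          \<Longrightarrow> Cmp C X Y Z g (f \<oplus>\<^bsub>Hom C X Y\<^esub> f')
              = Cmp C X Y Z g f \<oplus>\<^bsub>Hom C X Z\<^esub> Cmp C X Y Z g f'"

definition iso_mor :: "('o, 'm) precategory \<Rightarrow> 'o \<Rightarrow> 'o \<Rightarrow> 'm \<Rightarrow> bool" where
  "iso_mor C X Y f \<longleftrightarrow> f \<in> mor C X Y \<and>
     (\<exists>g \<in> mor C Y X. Cmp C X Y X g f = Idt C X \<and> Cmp C Y X Y f g = Idt C Y)"

definition isomorphic :: "('o, 'm) precategory \<Rightarrow> 'o \<Rightarrow> 'o \<Rightarrow> bool" where
  "isomorphic C X Y \<longleftrightarrow> (\<exists>f. iso_mor C X Y f)"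

definition zero_object :: "('o, 'm) precategory \<Rightarrow> 'o \<Rightarrow> bool" where
  "zero_object C Z \<longleftrightarrow> Z \<in> Obj C \<and>
     (\<forall>X \<in> Obj C. mor C X Z = {zero_mor C X Z} \<and> mor C Z X = {zero_mor C Z X})"

definition biproduct ::
  "('o, 'm) precategory \<Rightarrow> 'o \<Rightarrow> 'o \<Rightarrow> 'o \<Rightarrow> 'm \<Rightarrow> 'm \<Rightarrow> 'm \<Rightarrow> 'm \<Rightarrow> bool" where
  "biproduct C X Y S i j p q \<longleftrightarrow> S \<in> Obj C \<and>
     i \<in> mor C X S \<and> j \<in> mor C Y S \<and> p \<in> mor C S X \<and> q \<in> mor C S Y \<and>
     Cmp C X S X p i = Idt C X \<and> Cmp C Y S Y q j = Idt C Y \<and>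
     Cmp C X S Y q i = zero_mor C X Y \<and> Cmp C Y S X p j = zero_mor C Y X \<and>
     Cmp C S X S i p \<oplus>\<^bsub>Hom C S S\<^esub> Cmp C S Y S j q = Idt C S"

definition is_direct_sum :: "('o, 'm) precategory \<Rightarrow> 'o \<Rightarrow> 'o \<Rightarrow> 'o \<Rightarrow> bool" where
  "is_direct_sum C X Y S \<longleftrightarrow> (\<exists>i j p q. biproduct C X Y S i j p q)"

locale additive_category = preadditive_category +
  assumes has_zero_object: "\<exists>Z. zero_object C Z"
    and has_direct_sums: "\<lbrakk>X \<in> Obj C; Y \<in> Obj C\<rbrakk> \<Longrightarrow> \<exists>S. is_direct_sum C X Y S"

definition direct_summand :: "('o, 'm) precategory \<Rightarrow> 'o \<Rightarrow> 'o \<Rightarrow> bool" where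
  "direct_summand C X S \<longleftrightarrow> X \<in> Obj C \<and> (\<exists>Y \<in> Obj C. is_direct_sum C X Y S)"

definition indecomposable :: "('o, 'm) precategory \<Rightarrow> 'o \<Rightarrow> bool" where
  "indecomposable C S \<longleftrightarrow> S \<in> Obj C \<and> \<not> zero_object C S \<and>
     (\<forall>X \<in> Obj C. \<forall>Y \<in> Obj C. is_direct_sum C X Y S \<longrightarrow> zero_object C X \<or> zero_object C Y)"


section \<open>Exact categories and Frobenius categories\<close>

text \<open>A sequence \<open>X \<rightarrow> Y \<rightarrow> Z\<close> with maps \<open>f\<close>, \<open>g\<close> is the tuple \<open>(X, f, Y, g, Z)\<close>.\<close>

type_synonym ('o, 'm) sequence = "'o \<times> 'm \<times> 'o \<times> 'm \<times> 'o"

definition sequences :: "('o, 'm) precategory \<Rightarrow> ('o, 'm) sequence set" where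
  "sequences C = {(X, f, Y, g, Z). X \<in> Obj C \<and> Y \<in> Obj C \<and> Z \<in> Obj C \<and>
     f \<in> mor C X Y \<and> g \<in> mor C Y Z}"

definition kernel_cokernel_pair :: "('o, 'm) precategory \<Rightarrow> ('o, 'm) sequence \<Rightarrow> bool" where
  "kernel_cokernel_pair C = (\<lambda>(X, f, Y, g, Z). (X, f, Y, g, Z) \<in> sequences C \<and>
     Cmp C X Y Z g f = zero_mor C X Z \<and>
     (\<forall>T \<in> Obj C. \<forall>h \<in> mor C T Y. Cmp C T Y Z g h = zero_mor C T Z \<longrightarrow>
        (\<exists>!k. k \<in> mor C T X \<and> Cmp C T X Y f k = h)) \<and>
     (\<forall>T \<in> Obj C. \<forall>h \<in> mor C Y T. Cmp C X Y T h f = zero_mor C X T \<longrightarrow>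
        (\<exists>!k. k \<in> mor C Z T \<and> Cmp C Y Z T k g = h)))"

definition seq_isomorphic ::
  "('o, 'm) precategory \<Rightarrow> ('o, 'm) sequence \<Rightarrow> ('o, 'm) sequence \<Rightarrow> bool" where
  "seq_isomorphic C = (\<lambda>(X, f, Y, g, Z) (X', f', Y', g', Z'). \<exists>a b c.
     iso_mor C X X' a \<and> iso_mor C Y Y' b \<and> iso_mor C Z Z' c \<and>
     Cmp C X Y Y' b f = Cmp C X X' Y' f' a \<and> Cmp C Y Z Z' c g = Cmp C Y Y' Z' g' b)"

definition inflation :: "('o, 'm) sequence set \<Rightarrow> 'o \<Rightarrow> 'o \<Rightarrow> 'm \<Rightarrow> bool" where
  "inflation E X Y f \<longleftrightarrow> (\<exists>g Z. (X, f, Y, g, Z) \<in> E)"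

definition deflation :: "('o, 'm) sequence set \<Rightarrow> 'o \<Rightarrow> 'o \<Rightarrow> 'm \<Rightarrow> bool" where
  "deflation E Y Z g \<longleftrightarrow> (\<exists>X f. (X, f, Y, g, Z) \<in> E)"

text \<open>The squares below have horizontal maps \<open>f : X \<rightarrow> Y\<close>, \<open>f' : X' \<rightarrow> Y'\<close> and vertical maps
  \<open>a : X \<rightarrow> X'\<close>, \<open>b : Y \<rightarrow> Y'\<close>.\<close>

definition commutative_square ::
  "('o, 'm) precategory \<Rightarrow> 'o \<Rightarrow> 'o \<Rightarrow> 'o \<Rightarrow> 'o \<Rightarrow> 'm \<Rightarrow> 'm \<Rightarrow> 'm \<Rightarrow> 'm \<Rightarrow> bool" where
  "commutative_square C X Y X' Y' f a b f' \<longleftrightarrow>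
     X \<in> Obj C \<and> Y \<in> Obj C \<and> X' \<in> Obj C \<and> Y' \<in> Obj C \<and>
     f \<in> mor C X Y \<and> a \<in> mor C X X' \<and> b \<in> mor C Y Y' \<and> f' \<in> mor C X' Y' \<and>
     Cmp C X Y Y' b f = Cmp C X X' Y' f' a"

definition is_pushout ::
  "('o, 'm) precategory \<Rightarrow> 'o \<Rightarrow> 'o \<Rightarrow> 'o \<Rightarrow> 'o \<Rightarrow> 'm \<Rightarrow> 'm \<Rightarrow> 'm \<Rightarrow> 'm \<Rightarrow> bool" where
  "is_pushout C X Y X' Y' f a b f' \<longleftrightarrow> commutative_square C X Y X' Y' f a b f' \<and>
     (\<forall>T h k. commutative_square C X Y X' T f a h k \<longrightarrow>
        (\<exists>!t. t \<in> mor C Y' T \<and> Cmp C Y Y' T t b = h \<and> Cmp C X' Y' T t f' = k))"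

definition is_pullback ::
  "('o, 'm) precategory \<Rightarrow> 'o \<Rightarrow> 'o \<Rightarrow> 'o \<Rightarrow> 'o \<Rightarrow> 'm \<Rightarrow> 'm \<Rightarrow> 'm \<Rightarrow> 'm \<Rightarrow> bool" where
  "is_pullback C X Y X' Y' f a b f' \<longleftrightarrow> commutative_square C X Y X' Y' f a b f' \<and>
     (\<forall>T h k. commutative_square C T Y X' Y' h k b f' \<longrightarrow>
        (\<exists>!t. t \<in> mor C T X \<and> Cmp C T X Y f t = h \<and> Cmp C T X X' a t = k))"

text \<open>Quillen's axioms, in the form of Buehler's survey \<open>Exact categories\<close>.\<close>

locale exact_category = additive_category C
  for C :: "('o, 'm) precategory" +
  fixes E :: "('o, 'm) sequence set"
  assumes kernel_cokernel: "s \<in> E \<Longrightarrow> kernel_cokernel_pair C s"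
    and iso_closed: "\<lbrakk>s \<in> E; s' \<in> sequences C; seq_isomorphic C s s'\<rbrakk> \<Longrightarrow> s' \<in> E"
    and Idt_inflation: "X \<in> Obj C \<Longrightarrow> inflation E X X (Idt C X)"
    and Idt_deflation: "X \<in> Obj C \<Longrightarrow> deflation E X X (Idt C X)"
    and Cmp_inflation: "\<lbrakk>inflation E X Y f; inflation E Y Z g\<rbrakk>
          \<Longrightarrow> inflation E X Z (Cmp C X Y Z g f)"
    and Cmp_deflation: "\<lbrakk>deflation E X Y f; deflation E Y Z g\<rbrakk>
          \<Longrightarrow> deflation E X Z (Cmp C X Y Z g f)"
    and pushout_inflation: "\<lbrakk>inflation E X Y f; X' \<in> Obj C; a \<in> mor C X X'\<rbrakk>
          \<Longrightarrow> \<exists>Y' b f'. is_pushout C X Y X' Y' f a b f' \<and> inflation E X' Y' f'"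
    and pullback_deflation: "\<lbrakk>deflation E X' Y' f'; Y \<in> Obj C; b \<in> mor C Y Y'\<rbrakk>
          \<Longrightarrow> \<exists>X f a. is_pullback C X Y X' Y' f a b f' \<and> deflation E X Y f"

definition projective_object ::
  "('o, 'm) precategory \<Rightarrow> ('o, 'm) sequence set \<Rightarrow> 'o \<Rightarrow> bool" where
  "projective_object C E P \<longleftrightarrow> P \<in> Obj C \<and>
     (\<forall>Y Z g. deflation E Y Z g \<longrightarrow>
        (\<forall>h \<in> mor C P Z. \<exists>k \<in> mor C P Y. Cmp C P Y Z g k = h))"

definition injective_object ::
  "('o, 'm) precategory \<Rightarrow> ('o, 'm) sequence set \<Rightarrow> 'o \<Rightarrow> bool" where
  "injective_object C E I \<longleftrightarrow> I \<in> Obj C \<and>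
     (\<forall>X Y f. inflation E X Y f \<longrightarrow>
        (\<forall>h \<in> mor C X I. \<exists>k \<in> mor C Y I. Cmp C X Y I k f = h))"

locale frobenius_category = exact_category +
  assumes enough_projectives:
      "X \<in> Obj C \<Longrightarrow> \<exists>P g. projective_object C E P \<and> deflation E P X g"
    and enough_injectives:
      "X \<in> Obj C \<Longrightarrow> \<exists>I f. injective_object C E I \<and> inflation E X I f"
    and projective_iff_injective: "projective_object C E X \<longleftrightarrow> injective_object C E X"

definition projective_injective ::
  "('o, 'm) precategory \<Rightarrow> ('o, 'm) sequence set \<Rightarrow> 'o \<Rightarrow> bool" where
  "projective_injective C E X \<longleftrightarrow> projective_object C E X \<and> injective_object C E X"


section \<open>The category of finite ordered direct sums\<close>

text \<open>A finite ordered direct sum is a list of objects. A morphism \<open>Xs \<rightarrow> Ys\<close> is a matrix whose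
  entry \<open>(j, i)\<close> is a morphism \<open>Xs ! i \<rightarrow> Ys ! j\<close>; outside the index range it is \<open>undefined\<close>.\<close>

abbreviation matrix_indices :: "'a list \<Rightarrow> 'b list \<Rightarrow> (nat \<times> nat) set" where
  "matrix_indices Xs Ys \<equiv> {..<length Ys} \<times> {..<length Xs}"

definition additive_hull ::
  "('o, 'm) precategory \<Rightarrow> ('o list, nat \<times> nat \<Rightarrow> 'm) precategory" where
  "additive_hull C =
    \<lparr> Obj = lists (Obj C),
      Hom = (\<lambda>Xs Ys.
        \<lparr> carrier = (\<Pi>\<^sub>E (j, i) \<in> matrix_indices Xs Ys. mor C (Xs ! i) (Ys ! j)),
          monoid.mult = undefined,
          one = undefined,
          zero = (\<lambda>(j, i) \<in> matrix_indices Xs Ys. zero_mor C (Xs ! i) (Ys ! j)),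
          add = (\<lambda>M N. \<lambda>(j, i) \<in> matrix_indices Xs Ys.
                   M (j, i) \<oplus>\<^bsub>Hom C (Xs ! i) (Ys ! j)\<^esub> N (j, i)) \<rparr>),
      Cmp = (\<lambda>Xs Ys Zs N M. \<lambda>(k, i) \<in> matrix_indices Xs Zs.
        \<Oplus>\<^bsub>Hom C (Xs ! i) (Zs ! k)\<^esub> j \<in> {..<length Ys}.
           Cmp C (Xs ! i) (Ys ! j) (Zs ! k) (N (k, j)) (M (j, i))),
      Idt = (\<lambda>Xs. \<lambda>(j, i) \<in> matrix_indices Xs Xs.
        if j = i then Idt C (Xs ! i) else zero_mor C (Xs ! i) (Xs ! j)) \<rparr>"


section \<open>Discrete valuation rings\<close>

locale discrete_valuation_ring = principal_domain +
  assumes unique_maximalideal: "\<exists>!M. maximalideal M R"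
    and not_field: "\<not> field R"

definition uniformizer :: "('r, 'e) ring_scheme \<Rightarrow> 'r \<Rightarrow> bool" where
  "uniformizer R u \<longleftrightarrow> u \<in> carrier R \<and> maximalideal (PIdl\<^bsub>R\<^esub> u) R"

text \<open>\<open>group.ord\<close> is 0 for elements of infinite order, so this is 0 in characteristic 0.\<close>

definition ring_characteristic :: "('r, 'e) ring_scheme \<Rightarrow> nat" where
  "ring_characteristic R = group.ord (add_monoid R) \<one>\<^bsub>R\<^esub>"

text \<open>For a domain in which \<open>n\<close> is nonzero, the polynomial \<open>X^n - 1\<close> is separable, so it has
  exactly \<open>n\<close> roots in an algebraic closure of the fraction field.\<close>

definition contains_all_roots_of_unity :: "('r, 'e) ring_scheme \<Rightarrow> nat \<Rightarrow> bool" where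
  "contains_all_roots_of_unity R n \<longleftrightarrow> card {x \<in> carrier R. x [^]\<^bsub>R\<^esub> n = \<one>\<^bsub>R\<^esub>} = n"


section \<open>Cyclic posets\<close>

locale cyclic_poset =
  fixes XX :: "'x set" and c :: "'x \<Rightarrow> 'x \<Rightarrow> 'x \<Rightarrow> nat"
  assumes cocycle: "\<lbrakk>W \<in> XX; X \<in> XX; Y \<in> XX; Z \<in> XX\<rbrakk>
      \<Longrightarrow> int (c X Y Z) - int (c W Y Z) + int (c W X Z) - int (c W X Y) = 0"
    and reduced_left: "\<lbrakk>X \<in> XX; Y \<in> XX\<rbrakk> \<Longrightarrow> c X X Y = 0"
    and reduced_right: "\<lbrakk>X \<in> XX; Y \<in> XX\<rbrakk> \<Longrightarrow> c X Y Y = 0"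

text \<open>The category \<open>\<P>(XX)\<close>: the ring element \<open>r\<close> regarded as a morphism \<open>X \<rightarrow> Y\<close> stands for
  \<open>r f\<^sub>X\<^sub>Y\<close>, so the basic morphism is \<open>\<one>\<close>.\<close>

definition cyclic_poset_category ::
  "'r ring \<Rightarrow> 'r \<Rightarrow> 'x set \<Rightarrow> ('x \<Rightarrow> 'x \<Rightarrow> 'x \<Rightarrow> nat) \<Rightarrow> ('x, 'r) precategory" where
  "cyclic_poset_category R u XX c =
    \<lparr> Obj = XX,
      Hom = (\<lambda>X Y. R),
      Cmp = (\<lambda>X Y Z s r. u [^]\<^bsub>R\<^esub> c X Y Z \<otimes>\<^bsub>R\<^esub> (s \<otimes>\<^bsub>R\<^esub> r)),
      Idt = (\<lambda>X. \<one>\<^bsub>R\<^esub>) \<rparr>"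

definition add_P ::
  "'r ring \<Rightarrow> 'r \<Rightarrow> 'x set \<Rightarrow> ('x \<Rightarrow> 'x \<Rightarrow> 'x \<Rightarrow> nat) \<Rightarrow>
     ('x list, nat \<times> nat \<Rightarrow> 'r) precategory" where
  "add_P R u XX c = additive_hull (cyclic_poset_category R u XX c)"

text \<open>The rings range over those with elements in the type \<open>'r\<close>, which plays the role of a
  universe. Closure under isomorphism is expressed by \<open>c\<close>: elements \<open>X\<close> and \<open>Y\<close> are isomorphic
  in \<open>\<P>(XX)\<close> iff \<open>c X Y X = 0\<close>. The indecomposable projective-injective objects are
  determined only up to isomorphism; \<open>[X]\<close> is \<open>X\<close> as a direct sum of length one.\<close>

definition frobenius_cyclic_poset ::
  "'r itself \<Rightarrow> 'x set \<Rightarrow> ('x \<Rightarrow> 'x \<Rightarrow> 'x \<Rightarrow> nat) \<Rightarrow> 'x set \<Rightarrow> bool" where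
  "frobenius_cyclic_poset _ XX c XX\<^sub>0 \<longleftrightarrow>
     cyclic_poset XX c \<and> XX\<^sub>0 \<subseteq> XX \<and>
     (\<forall>X \<in> XX\<^sub>0. \<forall>Y \<in> XX. c X Y X = 0 \<longrightarrow> Y \<in> XX\<^sub>0) \<and>
     (\<forall>(R :: 'r ring) u. discrete_valuation_ring R \<and> uniformizer R u \<longrightarrow>
        (\<exists>E. frobenius_category (add_P R u XX c) E \<and>
           (\<forall>A \<in> Obj (add_P R u XX c).
              indecomposable (add_P R u XX c) A \<and> projective_injective (add_P R u XX c) E A \<longleftrightarrow>
              (\<exists>X \<in> XX\<^sub>0. isomorphic (add_P R u XX c) A [X]))))"

text \<open>The exact structure of \<open>\<F>(XX, XX\<^sub>0)\<close>. In \<open>short_exact_sequence\<close> the groups and maps are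
  listed from right to left.\<close>

definition frobenius_sequences ::
  "'r ring \<Rightarrow> 'r \<Rightarrow> 'x set \<Rightarrow> ('x \<Rightarrow> 'x \<Rightarrow> 'x \<Rightarrow> nat) \<Rightarrow> 'x set \<Rightarrow>
     ('x list, nat \<times> nat \<Rightarrow> 'r) sequence set" where
  "frobenius_sequences R u XX c XX\<^sub>0 = (let F = add_P R u XX c in
     {(X, f, Y, g, Z) \<in> sequences F. \<forall>P \<in> lists XX\<^sub>0.
        short_exact_sequence
          (add_monoid (Hom F P Z)) (add_monoid (Hom F P Y)) (add_monoid (Hom F P X))
          (Cmp F P Y Z g) (Cmp F P X Y f) \<and>
        short_exact_sequence
          (add_monoid (Hom F X P)) (add_monoid (Hom F Y P)) (add_monoid (Hom F Z P))
          (\<lambda>h. Cmp F X Y P h f) (\<lambda>h. Cmp F Y Z P h g)})"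


section \<open>Group actions and equivariant objects\<close>

definition acts_on_frobenius_cyclic_poset ::
  "('g, 'e) monoid_scheme \<Rightarrow> 'x set \<Rightarrow> ('x \<Rightarrow> 'x \<Rightarrow> 'x \<Rightarrow> nat) \<Rightarrow> 'x set \<Rightarrow>
     ('g \<Rightarrow> 'x \<Rightarrow> 'x) \<Rightarrow> bool" where
  "acts_on_frobenius_cyclic_poset G XX c XX\<^sub>0 \<phi> \<longleftrightarrow> group_action G XX \<phi> \<and>
     (\<forall>\<gamma> \<in> carrier G. \<forall>X \<in> XX. \<forall>Y \<in> XX. \<forall>Z \<in> XX. c (\<phi> \<gamma> X) (\<phi> \<gamma> Y) (\<phi> \<gamma> Z) = c X Y Z) \<and>
     (\<forall>\<gamma> \<in> carrier G. \<phi> \<gamma> ` XX\<^sub>0 = XX\<^sub>0)"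

text \<open>Here \<open>aO \<gamma> X\<close> is \<open>\<gamma> X\<close> and \<open>aM \<gamma> X Y f : \<gamma> X \<rightarrow> \<gamma> Y\<close> is \<open>\<gamma> f\<close> for \<open>f : X \<rightarrow> Y\<close>.\<close>

definition equivariant_category ::
  "('g, 'e) monoid_scheme \<Rightarrow> ('g \<Rightarrow> 'o \<Rightarrow> 'o) \<Rightarrow> ('g \<Rightarrow> 'o \<Rightarrow> 'o \<Rightarrow> 'm \<Rightarrow> 'm) \<Rightarrow>
     ('o, 'm) precategory \<Rightarrow> ('o \<times> ('g \<Rightarrow> 'm), 'm) precategory" where
  "equivariant_category G aO aM C =
    \<lparr> Obj = {(X, \<xi>). X \<in> Obj C \<and> \<xi> \<in> extensional (carrier G) \<and>
        (\<forall>\<gamma> \<in> carrier G. iso_mor C (aO \<gamma> X) X (\<xi> \<gamma>)) \<and>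
        (\<forall>\<alpha> \<in> carrier G. \<forall>\<beta> \<in> carrier G. \<xi> (\<alpha> \<otimes>\<^bsub>G\<^esub> \<beta>) =
           Cmp C (aO (\<alpha> \<otimes>\<^bsub>G\<^esub> \<beta>) X) (aO \<alpha> X) X (\<xi> \<alpha>) (aM \<alpha> (aO \<beta> X) X (\<xi> \<beta>)))},
      Hom = (\<lambda>(X, \<xi>) (Y, \<eta>). (Hom C X Y)
        \<lparr> carrier := {f \<in> mor C X Y. \<forall>\<gamma> \<in> carrier G.
            Cmp C (aO \<gamma> X) X Y f (\<xi> \<gamma>) = Cmp C (aO \<gamma> X) (aO \<gamma> Y) Y (\<eta> \<gamma>) (aM \<gamma> X Y f)} \<rparr>),
      Cmp = (\<lambda>(X, _) (Y, _) (Z, _). Cmp C X Y Z),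
      Idt = (\<lambda>(X, _). Idt C X) \<rparr>"

definition equivariant_sequences ::
  "('g, 'e) monoid_scheme \<Rightarrow> ('g \<Rightarrow> 'o \<Rightarrow> 'o) \<Rightarrow> ('g \<Rightarrow> 'o \<Rightarrow> 'o \<Rightarrow> 'm \<Rightarrow> 'm) \<Rightarrow>
     ('o, 'm) precategory \<Rightarrow> ('o, 'm) sequence set \<Rightarrow> ('o \<times> ('g \<Rightarrow> 'm), 'm) sequence set" where
  "equivariant_sequences G aO aM C E =
     {(X, f, Y, g, Z) \<in> sequences (equivariant_category G aO aM C).
        (fst X, f, fst Y, g, fst Z) \<in> E}"

text \<open>The induced action on \<open>\<F>(XX, XX\<^sub>0)\<close>: since \<open>\<gamma>\<close> is \<open>R\<close>-linear and takes \<open>f\<^sub>X\<^sub>Y\<close> to the basic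
  morphism \<open>\<gamma> X \<rightarrow> \<gamma> Y\<close>, it does not change the matrix of coefficients.\<close>

definition hull_action_obj :: "('g \<Rightarrow> 'x \<Rightarrow> 'x) \<Rightarrow> 'g \<Rightarrow> 'x list \<Rightarrow> 'x list" where
  "hull_action_obj \<phi> \<gamma> Xs = map (\<phi> \<gamma>) Xs"

definition hull_action_mor :: "'g \<Rightarrow> 'x list \<Rightarrow> 'x list \<Rightarrow> (nat \<times> nat \<Rightarrow> 'r) \<Rightarrow> (nat \<times> nat \<Rightarrow> 'r)"
  where "hull_action_mor \<gamma> Xs Ys M = M"

definition F_G ::
  "('g, 'e) monoid_scheme \<Rightarrow> ('g \<Rightarrow> 'x \<Rightarrow> 'x) \<Rightarrow> 'r ring \<Rightarrow> 'r \<Rightarrow> 'x set \<Rightarrow>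
     ('x \<Rightarrow> 'x \<Rightarrow> 'x \<Rightarrow> nat) \<Rightarrow>
     ('x list \<times> ('g \<Rightarrow> nat \<times> nat \<Rightarrow> 'r), nat \<times> nat \<Rightarrow> 'r) precategory" where
  "F_G G \<phi> R u XX c =
     equivariant_category G (hull_action_obj \<phi>) hull_action_mor (add_P R u XX c)"

definition F_G_sequences ::
  "('g, 'e) monoid_scheme \<Rightarrow> ('g \<Rightarrow> 'x \<Rightarrow> 'x) \<Rightarrow> 'r ring \<Rightarrow> 'r \<Rightarrow> 'x set \<Rightarrow>
     ('x \<Rightarrow> 'x \<Rightarrow> 'x \<Rightarrow> nat) \<Rightarrow> 'x set \<Rightarrow>
     ('x list \<times> ('g \<Rightarrow> nat \<times> nat \<Rightarrow> 'r), nat \<times> nat \<Rightarrow> 'r) sequence set" where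
  "F_G_sequences G \<phi> R u XX c XX\<^sub>0 =
     equivariant_sequences G (hull_action_obj \<phi>) hull_action_mor (add_P R u XX c)
       (frobenius_sequences R u XX c XX\<^sub>0)"

text \<open>The list \<open>gs\<close> enumerates \<open>G\<close> and fixes the order of the direct sum over \<open>\<gamma> \<in> G\<close>. With
  \<open>m = length Xs\<close>, position \<open>a * m + k\<close> (\<open>k < m\<close>) of the sum is component \<open>k\<close> of the summand
  indexed by \<open>gs ! a\<close>; so entry \<open>(r, s)\<close> of \<open>\<xi>\<^sub>\<beta>\<close> is the identity if \<open>r\<close> and \<open>s\<close> are the same
  component of the summands indexed by \<open>\<beta>\<gamma>\<close> and \<open>\<gamma>\<close> for some \<open>\<gamma>\<close>, and 0 otherwise.\<close>

definition S_obj ::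
  "('g, 'e) monoid_scheme \<Rightarrow> 'g list \<Rightarrow> ('g \<Rightarrow> 'x \<Rightarrow> 'x) \<Rightarrow> 'r ring \<Rightarrow> 'x list \<Rightarrow>
     'x list \<times> ('g \<Rightarrow> nat \<times> nat \<Rightarrow> 'r)" where
  "S_obj G gs \<phi> R Xs =
    (let m = length Xs; SX = concat (map (\<lambda>\<gamma>. hull_action_obj \<phi> \<gamma> Xs) gs) in
     (SX, \<lambda>\<beta> \<in> carrier G. \<lambda>(r, s) \<in> matrix_indices SX SX.
        if r mod m = s mod m \<and> gs ! (r div m) = \<beta> \<otimes>\<^bsub>G\<^esub> gs ! (s div m) then \<one>\<^bsub>R\<^esub> else \<zero>\<^bsub>R\<^esub>))"

end

theory Submission
  imports Defs
begin

text \<open>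
The category \<open>\<F>\<^sup>G\<close> inherits its exact structure from \<open>\<F>\<close>, and induction \<open>S\<close> supplies it with
enough projective and injective objects. Both facts hold for strict actions of finite groups on
Frobenius categories; the last part applies them to cyclic posets.

\<^bold>\<open>Equivariant objects.\<close> The structure maps of two equivariant objects let \<open>G\<close> act on the morphisms
between the underlying objects (\<open>conj_mor\<close>), and the equivariant morphisms are the fixed points.
If \<open>K\<close> has a universal property with respect to equivariant objects, as a kernel, cokernel,
pullback, pushout or direct sum, then uniqueness of factorizations gives \<open>K\<close> an equivariant
structure and makes all factorizations equivariant (\<open>EC_structure_monic\<close>, \<open>EC_structure_epic\<close>).
Hence an equivariant map is an inflation or deflation in \<open>\<F>\<^sup>G\<close> iff it is one in \<open>\<F>\<close>, and the axioms
of an exact category carry over (\<open>EC_exact\<close>).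

\<^bold>\<open>Traces.\<close> The sum \<open>tr h\<close> of the conjugates of a morphism \<open>h\<close> is equivariant, and
\<open>k \<circ> tr h = tr (k \<circ> h)\<close> for equivariant \<open>k\<close>. By Higman's criterion (\<open>projective_if_trace\<close>,
\<open>injective_if_trace\<close>), an equivariant object whose identity is the trace of a map factoring through
a projective-injective object of \<open>\<F>\<close> is projective and injective. In \<open>S P\<close> the identity is the
trace of the projector onto the summand \<open>\<one> P\<close>, so \<open>S P\<close> is projective and injective for \<open>P\<close> in
\<open>\<F>\<^sub>0\<close>. A deflation \<open>P \<rightarrow> X\<close> in \<open>\<F>\<close> induces an equivariant deflation \<open>S P \<rightarrow> X\<close>, which splits if \<open>X\<close>
is projective in \<open>\<F>\<^sup>G\<close>; dually for inflations. So projective and injective objects of \<open>\<F>\<^sup>G\<close> are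
the direct summands of the \<open>S P\<close> (\<open>EC_frobenius\<close>).

\<^bold>\<open>Cyclic posets.\<close> A Frobenius cyclic poset provides some Frobenius structure \<open>E\<close> on \<open>add \<P>(XX)\<close>. The
endomorphism ring of an element of \<open>XX\<close> is the domain \<open>R\<close>, so elements are indecomposable, and the
projective objects are exactly the lists over \<open>XX\<^sub>0\<close> (\<open>projective_object_iff\<close>). In a Frobenius
category exactness is detected by \<open>Hom(P, -)\<close> for projective \<open>P\<close> (\<open>in_E_iff_short_exact\<close>), so \<open>E\<close> is
the structure of \<open>\<F>(XX, XX\<^sub>0)\<close>. The remaining task is to verify the properties of \<open>S P\<close> used above
for matrices, which is bookkeeping with permutations of positions (\<open>S_obj_induced\<close>).
\<close>

section \<open>Calculus in preadditive categories\<close>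

lemma additive_map_finsum:
  assumes "abelian_group A" "abelian_group B" "h \<in> carrier A \<rightarrow> carrier B"
    and add: "\<And>x y. \<lbrakk>x \<in> carrier A; y \<in> carrier A\<rbrakk> \<Longrightarrow> h (x \<oplus>\<^bsub>A\<^esub> y) = h x \<oplus>\<^bsub>B\<^esub> h y"
    and "finite I" "f \<in> I \<rightarrow> carrier A"
  shows "h (finsum A f I) = finsum B (\<lambda>i. h (f i)) I"
proof -
  interpret A: abelian_group A by fact
  interpret B: abelian_group B by fact
  have "h \<zero>\<^bsub>A\<^esub> \<oplus>\<^bsub>B\<^esub> h \<zero>\<^bsub>A\<^esub> = h \<zero>\<^bsub>A\<^esub>"
    using add[of "\<zero>\<^bsub>A\<^esub>" "\<zero>\<^bsub>A\<^esub>"] by simp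
  moreover have "h \<zero>\<^bsub>A\<^esub> \<in> carrier B" using assms(3) by auto
  ultimately have zero: "h \<zero>\<^bsub>A\<^esub> = \<zero>\<^bsub>B\<^esub>"
    using B.add.l_cancel_one' by metis
  show ?thesis using \<open>finite I\<close> \<open>f \<in> I \<rightarrow> carrier A\<close>
  proof (induction I rule: finite_induct)
    case empty
    then show ?case by (simp add: zero)
  next
    case (insert x F)
    then have "(\<lambda>i. h (f i)) \<in> F \<rightarrow> carrier B" "h (f x) \<in> carrier B"
      using assms(3) by auto
    with insert show ?case by (simp add: add)
  qed
qed

context preadditive_category
begin

declare Idt_closed [simp] Cmp_closed [simp] Cmp_Idt_left [simp] Cmp_Idt_right [simp]

lemma zero_mor_closed [simp]: "\<lbrakk>X \<in> Obj C; Y \<in> Obj C\<rbrakk> \<Longrightarrow> zero_mor C X Y \<in> mor C X Y"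
  by (simp add: Hom_abelian_group abelian_group.axioms(1) abelian_monoid.zero_closed)

lemma add_mor_closed [simp]:
  "\<lbrakk>X \<in> Obj C; Y \<in> Obj C; f \<in> mor C X Y; g \<in> mor C X Y\<rbrakk> \<Longrightarrow> f \<oplus>\<^bsub>Hom C X Y\<^esub> g \<in> mor C X Y"
  by (simp add: Hom_abelian_group abelian_group.axioms(1) abelian_monoid.a_closed)

lemma uminus_mor_closed [simp]:
  "\<lbrakk>X \<in> Obj C; Y \<in> Obj C; f \<in> mor C X Y\<rbrakk> \<Longrightarrow> \<ominus>\<^bsub>Hom C X Y\<^esub> f \<in> mor C X Y"
  by (simp add: Hom_abelian_group abelian_group.a_inv_closed)

lemma add_zero_mor [simp]:
  assumes "X \<in> Obj C" "Y \<in> Obj C" "f \<in> mor C X Y"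
  shows "zero_mor C X Y \<oplus>\<^bsub>Hom C X Y\<^esub> f = f" "f \<oplus>\<^bsub>Hom C X Y\<^esub> zero_mor C X Y = f"
  using assms Hom_abelian_group[of X Y]
  by (simp_all add: abelian_group.axioms(1) abelian_monoid.l_zero abelian_monoid.r_zero)

lemma Cmp_zero_right [simp]:
  assumes "X \<in> Obj C" "Y \<in> Obj C" "Z \<in> Obj C" "g \<in> mor C Y Z"
  shows "Cmp C X Y Z g (zero_mor C X Y) = zero_mor C X Z"
proof -
  interpret A: abelian_group "Hom C X Y" by (rule Hom_abelian_group) fact+
  interpret B: abelian_group "Hom C X Z" by (rule Hom_abelian_group) fact+
  show ?thesis
    using additive_map_finsum[OF A.abelian_group_axioms B.abelian_group_axioms,
        of "Cmp C X Y Z g" "{}"] assms by (simp add: Cmp_add_right)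
qed

lemma Cmp_zero_left [simp]:
  assumes "X \<in> Obj C" "Y \<in> Obj C" "Z \<in> Obj C" "f \<in> mor C X Y"
  shows "Cmp C X Y Z (zero_mor C Y Z) f = zero_mor C X Z"
proof -
  interpret A: abelian_group "Hom C Y Z" by (rule Hom_abelian_group) fact+
  interpret B: abelian_group "Hom C X Z" by (rule Hom_abelian_group) fact+
  show ?thesis
    using additive_map_finsum[OF A.abelian_group_axioms B.abelian_group_axioms,
        of "\<lambda>g. Cmp C X Y Z g f" "{}"] assms by (simp add: Cmp_add_left)
qed

lemma Cmp_uminus_right:
  assumes "X \<in> Obj C" "Y \<in> Obj C" "Z \<in> Obj C" "g \<in> mor C Y Z" "f \<in> mor C X Y"
  shows "Cmp C X Y Z g (\<ominus>\<^bsub>Hom C X Y\<^esub> f) = \<ominus>\<^bsub>Hom C X Z\<^esub> Cmp C X Y Z g f"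
proof -
  interpret A: abelian_group "Hom C X Y" by (rule Hom_abelian_group) fact+
  interpret B: abelian_group "Hom C X Z" by (rule Hom_abelian_group) fact+
  have "Cmp C X Y Z g (\<ominus>\<^bsub>Hom C X Y\<^esub> f) \<oplus>\<^bsub>Hom C X Z\<^esub> Cmp C X Y Z g f = zero_mor C X Z"
    using assms by (simp add: Cmp_add_right[symmetric] A.l_neg)
  then show ?thesis
    using assms by (intro B.add.inv_equality[symmetric, folded a_inv_def]) auto
qed

lemma Cmp_uminus_left:
  assumes "X \<in> Obj C" "Y \<in> Obj C" "Z \<in> Obj C" "g \<in> mor C Y Z" "f \<in> mor C X Y"
  shows "Cmp C X Y Z (\<ominus>\<^bsub>Hom C Y Z\<^esub> g) f = \<ominus>\<^bsub>Hom C X Z\<^esub> Cmp C X Y Z g f"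
proof -
  interpret A: abelian_group "Hom C Y Z" by (rule Hom_abelian_group) fact+
  interpret B: abelian_group "Hom C X Z" by (rule Hom_abelian_group) fact+
  have "Cmp C X Y Z (\<ominus>\<^bsub>Hom C Y Z\<^esub> g) f \<oplus>\<^bsub>Hom C X Z\<^esub> Cmp C X Y Z g f = zero_mor C X Z"
    using assms by (simp add: Cmp_add_left[symmetric] A.l_neg)
  then show ?thesis
    using assms by (intro B.add.inv_equality[symmetric, folded a_inv_def]) auto
qed

lemma Cmp_minus_right:
  assumes "X \<in> Obj C" "Y \<in> Obj C" "Z \<in> Obj C" "g \<in> mor C Y Z" "f \<in> mor C X Y" "f' \<in> mor C X Y"
  shows "Cmp C X Y Z g (f \<ominus>\<^bsub>Hom C X Y\<^esub> f') = Cmp C X Y Z g f \<ominus>\<^bsub>Hom C X Z\<^esub> Cmp C X Y Z g f'"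
  using assms by (simp add: a_minus_def Cmp_add_right Cmp_uminus_right)

lemma Cmp_minus_left:
  assumes "X \<in> Obj C" "Y \<in> Obj C" "Z \<in> Obj C" "g \<in> mor C Y Z" "g' \<in> mor C Y Z" "f \<in> mor C X Y"
  shows "Cmp C X Y Z (g \<ominus>\<^bsub>Hom C Y Z\<^esub> g') f = Cmp C X Y Z g f \<ominus>\<^bsub>Hom C X Z\<^esub> Cmp C X Y Z g' f"
  using assms by (simp add: a_minus_def Cmp_add_left Cmp_uminus_left)

lemma minus_mor_closed [simp]:
  "\<lbrakk>X \<in> Obj C; Y \<in> Obj C; f \<in> mor C X Y; g \<in> mor C X Y\<rbrakk> \<Longrightarrow> f \<ominus>\<^bsub>Hom C X Y\<^esub> g \<in> mor C X Y"
  by (simp add: a_minus_def)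

lemma minus_mor_eq_zero_iff:
  assumes "X \<in> Obj C" "Y \<in> Obj C" "f \<in> mor C X Y" "g \<in> mor C X Y"
  shows "f \<ominus>\<^bsub>Hom C X Y\<^esub> g = zero_mor C X Y \<longleftrightarrow> f = g"
proof -
  interpret A: abelian_group "Hom C X Y" by (rule Hom_abelian_group) fact+
  show ?thesis using assms by (metis A.minus_equality A.minus_minus A.r_neg a_minus_def A.a_inv_closed A.a_comm)
qed

lemma minus_add_cancel_mor:
  assumes "X \<in> Obj C" "Y \<in> Obj C" "f \<in> mor C X Y" "g \<in> mor C X Y"
  shows "g \<oplus>\<^bsub>Hom C X Y\<^esub> (f \<ominus>\<^bsub>Hom C X Y\<^esub> g) = f" "(f \<ominus>\<^bsub>Hom C X Y\<^esub> g) \<oplus>\<^bsub>Hom C X Y\<^esub> g = f"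
proof -
  interpret A: abelian_group "Hom C X Y" by (rule Hom_abelian_group) fact+
  show "(f \<ominus>\<^bsub>Hom C X Y\<^esub> g) \<oplus>\<^bsub>Hom C X Y\<^esub> g = f"
    using assms by (simp add: a_minus_def A.a_assoc A.l_neg)
  then show "g \<oplus>\<^bsub>Hom C X Y\<^esub> (f \<ominus>\<^bsub>Hom C X Y\<^esub> g) = f"
    using assms by (simp add: A.a_comm)
qed

lemma Cmp_finsum_right:
  assumes "X \<in> Obj C" "Y \<in> Obj C" "Z \<in> Obj C" "g \<in> mor C Y Z" "finite I" "f \<in> I \<rightarrow> mor C X Y"
  shows "Cmp C X Y Z g (finsum (Hom C X Y) f I) = finsum (Hom C X Z) (\<lambda>i. Cmp C X Y Z g (f i)) I"
  using assms by (intro additive_map_finsum Hom_abelian_group Cmp_add_right) auto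

lemma Cmp_finsum_left:
  assumes "X \<in> Obj C" "Y \<in> Obj C" "Z \<in> Obj C" "f \<in> mor C X Y" "finite I" "g \<in> I \<rightarrow> mor C Y Z"
  shows "Cmp C X Y Z (finsum (Hom C Y Z) g I) f = finsum (Hom C X Z) (\<lambda>i. Cmp C X Y Z (g i) f) I"
  using assms
  by (intro additive_map_finsum[where h = "\<lambda>g. Cmp C X Y Z g f"] Hom_abelian_group Cmp_add_left) auto

lemma iso_mor_Idt: "X \<in> Obj C \<Longrightarrow> iso_mor C X X (Idt C X)"
  unfolding iso_mor_def by auto

lemma zero_objectI:
  assumes "Z \<in> Obj C" "Idt C Z = zero_mor C Z Z"
  shows "zero_object C Z"
  unfolding zero_object_def
proof (intro conjI ballI)
  fix X assume X: "X \<in> Obj C"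
  show "mor C X Z = {zero_mor C X Z}"
    using assms X Cmp_Idt_left[of X Z] by (auto simp del: Cmp_Idt_left)
  show "mor C Z X = {zero_mor C Z X}"
    using assms X Cmp_Idt_right[of Z X] by (auto simp del: Cmp_Idt_right)
qed fact

lemma kernel_cokernel_pairD:
  assumes "kernel_cokernel_pair C (X, f, Y, g, Z)"
  shows "X \<in> Obj C" "Y \<in> Obj C" "Z \<in> Obj C" "f \<in> mor C X Y" "g \<in> mor C Y Z"
    and "Cmp C X Y Z g f = zero_mor C X Z"
    and "\<lbrakk>T \<in> Obj C; h \<in> mor C T Y; Cmp C T Y Z g h = zero_mor C T Z\<rbrakk>
      \<Longrightarrow> \<exists>k \<in> mor C T X. Cmp C T X Y f k = h"
    and "\<lbrakk>T \<in> Obj C; h \<in> mor C Y T; Cmp C X Y T h f = zero_mor C X T\<rbrakk>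
      \<Longrightarrow> \<exists>k \<in> mor C Z T. Cmp C Y Z T k g = h"
  using assms unfolding kernel_cokernel_pair_def sequences_def by blast+

lemma kernel_cancel:
  assumes "kernel_cokernel_pair C (X, f, Y, g, Z)"
    and "T \<in> Obj C" "k \<in> mor C T X" "k' \<in> mor C T X" "Cmp C T X Y f k = Cmp C T X Y f k'"
  shows "k = k'"
proof -
  note D = kernel_cokernel_pairD[OF assms(1)]
  have "Cmp C T Y Z g (Cmp C T X Y f k) = zero_mor C T Z"
    using D(1-6) assms(2-4) by (simp add: Cmp_assoc)
  moreover have "Cmp C T X Y f k \<in> mor C T Y" using D(1-6) assms by simp
  ultimately have "\<exists>!l. l \<in> mor C T X \<and> Cmp C T X Y f l = Cmp C T X Y f k"
    using assms(1,2) unfolding kernel_cokernel_pair_def by blast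
  then show ?thesis using assms(3-5) by auto
qed

lemma cokernel_cancel:
  assumes "kernel_cokernel_pair C (X, f, Y, g, Z)"
    and "T \<in> Obj C" "k \<in> mor C Z T" "k' \<in> mor C Z T" "Cmp C Y Z T k g = Cmp C Y Z T k' g"
  shows "k = k'"
proof -
  note D = kernel_cokernel_pairD[OF assms(1)]
  have "Cmp C X Y T (Cmp C Y Z T k g) f = zero_mor C X T"
    using D(1-6) assms(2-4) by (simp add: Cmp_assoc[symmetric])
  moreover have "Cmp C Y Z T k g \<in> mor C Y T" using D(1-6) assms by simp
  ultimately have "\<exists>!l. l \<in> mor C Z T \<and> Cmp C Y Z T l g = Cmp C Y Z T k g"
    using assms(1,2) unfolding kernel_cokernel_pair_def by blast
  then show ?thesis using assms(3-5) by auto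
qed

lemma kernel_cokernel_pairI:
  assumes "X \<in> Obj C" "Y \<in> Obj C" "Z \<in> Obj C" "f \<in> mor C X Y" "g \<in> mor C Y Z"
    and "Cmp C X Y Z g f = zero_mor C X Z"
    and "\<And>T h. \<lbrakk>T \<in> Obj C; h \<in> mor C T Y; Cmp C T Y Z g h = zero_mor C T Z\<rbrakk>
      \<Longrightarrow> \<exists>k \<in> mor C T X. Cmp C T X Y f k = h"
    and "\<And>T k k'. \<lbrakk>T \<in> Obj C; k \<in> mor C T X; k' \<in> mor C T X; Cmp C T X Y f k = Cmp C T X Y f k'\<rbrakk>
      \<Longrightarrow> k = k'"
    and "\<And>T h. \<lbrakk>T \<in> Obj C; h \<in> mor C Y T; Cmp C X Y T h f = zero_mor C X T\<rbrakk>
      \<Longrightarrow> \<exists>k \<in> mor C Z T. Cmp C Y Z T k g = h"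
    and "\<And>T k k'. \<lbrakk>T \<in> Obj C; k \<in> mor C Z T; k' \<in> mor C Z T; Cmp C Y Z T k g = Cmp C Y Z T k' g\<rbrakk>
      \<Longrightarrow> k = k'"
  shows "kernel_cokernel_pair C (X, f, Y, g, Z)"
  unfolding kernel_cokernel_pair_def sequences_def using assms(1-6)
  by (auto intro!: ex_ex1I dest: assms(7,9) intro: assms(8,10) simp flip: Bex_def)

lemma biproductD:
  assumes "biproduct C X Y S i j p q"
  shows "S \<in> Obj C" "i \<in> mor C X S" "j \<in> mor C Y S" "p \<in> mor C S X" "q \<in> mor C S Y"
    "Cmp C X S X p i = Idt C X" "Cmp C Y S Y q j = Idt C Y"
    "Cmp C X S Y q i = zero_mor C X Y" "Cmp C Y S X p j = zero_mor C Y X"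
    "Cmp C S X S i p \<oplus>\<^bsub>Hom C S S\<^esub> Cmp C S Y S j q = Idt C S"
  using assms unfolding biproduct_def by auto

lemma biproduct_decompose_right:
  assumes "biproduct C X Y S i j p q" "X \<in> Obj C" "Y \<in> Obj C" "T \<in> Obj C" "h \<in> mor C S T"
  shows "h = Cmp C S X T (Cmp C X S T h i) p \<oplus>\<^bsub>Hom C S T\<^esub> Cmp C S Y T (Cmp C Y S T h j) q"
proof -
  note D = biproductD[OF assms(1)]
  have "h = Cmp C S S T h (Cmp C S X S i p \<oplus>\<^bsub>Hom C S S\<^esub> Cmp C S Y S j q)"
    using D assms by simp
  also have "\<dots> = Cmp C S X T (Cmp C X S T h i) p \<oplus>\<^bsub>Hom C S T\<^esub> Cmp C S Y T (Cmp C Y S T h j) q"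
    using D(1-5) assms(2-5) by (simp add: Cmp_add_right Cmp_assoc)
  finally show ?thesis .
qed

lemma biproduct_decompose_left:
  assumes "biproduct C X Y S i j p q" "X \<in> Obj C" "Y \<in> Obj C" "T \<in> Obj C" "h \<in> mor C T S"
  shows "h = Cmp C T X S i (Cmp C T S X p h) \<oplus>\<^bsub>Hom C T S\<^esub> Cmp C T Y S j (Cmp C T S Y q h)"
proof -
  note D = biproductD[OF assms(1)]
  have "h = Cmp C T S S (Cmp C S X S i p \<oplus>\<^bsub>Hom C S S\<^esub> Cmp C S Y S j q) h"
    using D assms by simp
  also have "\<dots> = Cmp C T X S i (Cmp C T S X p h) \<oplus>\<^bsub>Hom C T S\<^esub> Cmp C T Y S j (Cmp C T S Y q h)"
    using D(1-5) assms(2-5) by (simp add: Cmp_add_left Cmp_assoc)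
  finally show ?thesis .
qed

lemma kernel_cokernel_pair_biproduct:
  assumes B: "biproduct C X Y S i j p q" and X: "X \<in> Obj C" and Y: "Y \<in> Obj C"
  shows "kernel_cokernel_pair C (X, i, S, q, Y)"
proof -
  note D = biproductD[OF B]
  show ?thesis
  proof (rule kernel_cokernel_pairI[OF X D(1) Y D(2,5,8)])
    fix T h assume T: "T \<in> Obj C" "h \<in> mor C T S" "Cmp C T S Y q h = zero_mor C T Y"
    have "h = Cmp C T X S i (Cmp C T S X p h)"
      using biproduct_decompose_left[OF B X Y T(1,2)] T X Y D(1-5) by simp
    then show "\<exists>k \<in> mor C T X. Cmp C T X S i k = h"
      using T X D(1-5) by (intro bexI[of _ "Cmp C T S X p h"]) auto
  next
    fix T k k' assume T: "T \<in> Obj C" "k \<in> mor C T X" "k' \<in> mor C T X"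
      "Cmp C T X S i k = Cmp C T X S i k'"
    then have "Cmp C T S X p (Cmp C T X S i k) = Cmp C T S X p (Cmp C T X S i k')" by simp
    then show "k = k'" using T(1-3) D(1-6) X by (simp add: Cmp_assoc)
  next
    fix T h assume T: "T \<in> Obj C" "h \<in> mor C S T" "Cmp C X S T h i = zero_mor C X T"
    have "h = Cmp C S Y T (Cmp C Y S T h j) q"
      using biproduct_decompose_right[OF B X Y T(1,2)] T X Y D(1-5) by simp
    then show "\<exists>k \<in> mor C Y T. Cmp C S Y T k q = h"
      using T Y D(1-5) by (intro bexI[of _ "Cmp C Y S T h j"]) auto
  next
    fix T k k' assume T: "T \<in> Obj C" "k \<in> mor C Y T" "k' \<in> mor C Y T"
      "Cmp C S Y T k q = Cmp C S Y T k' q"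
    then have "Cmp C Y S T (Cmp C S Y T k q) j = Cmp C Y S T (Cmp C S Y T k' q) j" by simp
    then show "k = k'" using T(1-3) D(1-7) Y by (simp add: Cmp_assoc[symmetric])
  qed
qed

lemma biproduct_commute:
  assumes B: "biproduct C X Y S i j p q" and X: "X \<in> Obj C" and Y: "Y \<in> Obj C"
  shows "biproduct C Y X S j i q p"
proof -
  note D = biproductD[OF B]
  interpret A: abelian_group "Hom C S S" by (rule Hom_abelian_group) (use D in auto)
  show ?thesis unfolding biproduct_def using D X Y by (simp add: A.a_comm)
qed

text \<open>If \<open>s\<close> is a section of \<open>g\<close>, then \<open>id - s g\<close> is killed by \<open>g\<close> and factors through the kernel
  \<open>f\<close>; the factor is the projection onto the complement of \<open>Z\<close>.\<close>

lemma direct_summand_of_section: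
  assumes K: "kernel_cokernel_pair C (X, f, Y, g, Z)"
    and s: "s \<in> mor C Z Y" "Cmp C Z Y Z g s = Idt C Z"
  shows "direct_summand C Z Y"
proof -
  note D = kernel_cokernel_pairD[OF K]
  note c = D(1-5) s(1)
  let ?e = "Idt C Y \<ominus>\<^bsub>Hom C Y Y\<^esub> Cmp C Y Z Y s g"
  have e: "?e \<in> mor C Y Y" using c by simp
  have "Cmp C Y Y Z g ?e = zero_mor C Y Z"
    using c s by (simp add: Cmp_minus_right Cmp_assoc minus_mor_eq_zero_iff)
  then obtain r where r: "r \<in> mor C Y X" "Cmp C Y X Y f r = ?e"
    using D(7)[OF D(2) e] by auto
  have "Cmp C Z X Y f (Cmp C Z Y X r s) = Cmp C Z X Y f (zero_mor C Z X)"
    using c r s by (simp add: Cmp_assoc Cmp_minus_left minus_mor_eq_zero_iff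
        Cmp_assoc[symmetric, of Z Y Z Y s g s])
  then have rs: "Cmp C Z Y X r s = zero_mor C Z X"
    using kernel_cancel[OF K] c r by simp
  have "Cmp C X X Y f (Cmp C X Y X r f) = Cmp C X Y Y ?e f"
    using c r by (simp add: Cmp_assoc)
  also have "\<dots> = f \<ominus>\<^bsub>Hom C X Y\<^esub> Cmp C X Z Y s (Cmp C X Y Z g f)"
    using c by (simp add: Cmp_minus_left Cmp_assoc)
  also have "\<dots> = Cmp C X X Y f (Idt C X)"
    using c D(6) minus_add_cancel_mor(2)[of X Y f "zero_mor C X Y"] by simp
  finally have rf: "Cmp C X Y X r f = Idt C X"
    using kernel_cancel[OF K] c r by simp
  have "Cmp C Y Z Y s g \<oplus>\<^bsub>Hom C Y Y\<^esub> Cmp C Y X Y f r = Idt C Y"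
    using c r by (simp add: minus_add_cancel_mor)
  then have "biproduct C Z X Y s f g r"
    unfolding biproduct_def using D s r rs rf by simp
  then show ?thesis unfolding direct_summand_def is_direct_sum_def using D by blast
qed

lemma direct_summandE:
  assumes "direct_summand C X S"
  obtains i p where "X \<in> Obj C" "i \<in> mor C X S" "p \<in> mor C S X" "Cmp C X S X p i = Idt C X"
  using assms biproductD unfolding direct_summand_def is_direct_sum_def by meson

end

lemma is_pushout_ex:
  assumes "is_pushout C X Y X' Y' f a b f'" "commutative_square C X Y X' T f a h k"
  shows "\<exists>t \<in> mor C Y' T. Cmp C Y Y' T t b = h \<and> Cmp C X' Y' T t f' = k"
proof -
  have "\<exists>!t. t \<in> mor C Y' T \<and> Cmp C Y Y' T t b = h \<and> Cmp C X' Y' T t f' = k"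
    using assms unfolding is_pushout_def by fast
  then show ?thesis by (auto elim!: ex1E)
qed

lemma (in preadditive_category) is_pushout_cancel:
  assumes po: "is_pushout C X Y X' Y' f a b f'"
    and T: "T \<in> Obj C" "t \<in> mor C Y' T" "t' \<in> mor C Y' T"
    and eq: "Cmp C Y Y' T t b = Cmp C Y Y' T t' b" "Cmp C X' Y' T t f' = Cmp C X' Y' T t' f'"
  shows "t = t'"
proof -
  have "commutative_square C X Y X' T f a (Cmp C Y Y' T t b) (Cmp C X' Y' T t f')"
    using po T unfolding is_pushout_def commutative_square_def by (simp flip: Cmp_assoc)
  then have "\<exists>!s. s \<in> mor C Y' T \<and> Cmp C Y Y' T s b = Cmp C Y Y' T t b \<and>
      Cmp C X' Y' T s f' = Cmp C X' Y' T t f'"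
    using po unfolding is_pushout_def by fast
  then show ?thesis using T eq by (auto elim!: ex1E)
qed

lemma is_pullback_ex:
  assumes "is_pullback C X Y X' Y' f a b f'" "commutative_square C T Y X' Y' h k b f'"
  shows "\<exists>t \<in> mor C T X. Cmp C T X Y f t = h \<and> Cmp C T X X' a t = k"
proof -
  have "\<exists>!t. t \<in> mor C T X \<and> Cmp C T X Y f t = h \<and> Cmp C T X X' a t = k"
    using assms unfolding is_pullback_def by fast
  then show ?thesis by (auto elim!: ex1E)
qed

lemma (in preadditive_category) is_pullback_cancel:
  assumes pb: "is_pullback C X Y X' Y' f a b f'"
    and T: "T \<in> Obj C" "t \<in> mor C T X" "t' \<in> mor C T X"
    and eq: "Cmp C T X Y f t = Cmp C T X Y f t'" "Cmp C T X X' a t = Cmp C T X X' a t'"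
  shows "t = t'"
proof -
  have "commutative_square C T Y X' Y' (Cmp C T X Y f t) (Cmp C T X X' a t) b f'"
    using pb T unfolding is_pullback_def commutative_square_def by (simp add: Cmp_assoc)
  then have "\<exists>!s. s \<in> mor C T X \<and> Cmp C T X Y f s = Cmp C T X Y f t \<and>
      Cmp C T X X' a s = Cmp C T X X' a t"
    using pb unfolding is_pullback_def by fast
  then show ?thesis using T eq by (auto elim!: ex1E)
qed

section \<open>Exact structures determined by projective objects\<close>

lemma short_exact_sequence_add_monoid_iff:
  assumes A: "abelian_group A" and B: "abelian_group B" and D: "abelian_group D"
    and g: "g \<in> carrier B \<rightarrow> carrier A" "\<And>x y. \<lbrakk>x \<in> carrier B; y \<in> carrier B\<rbrakk> \<Longrightarrow> g (x \<oplus>\<^bsub>B\<^esub> y) = g x \<oplus>\<^bsub>A\<^esub> g y"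
    and f: "f \<in> carrier D \<rightarrow> carrier B" "\<And>x y. \<lbrakk>x \<in> carrier D; y \<in> carrier D\<rbrakk> \<Longrightarrow> f (x \<oplus>\<^bsub>D\<^esub> y) = f x \<oplus>\<^bsub>B\<^esub> f y"
  shows "short_exact_sequence (add_monoid A) (add_monoid B) (add_monoid D) g f \<longleftrightarrow>
    inj_on f (carrier D) \<and> f ` carrier D = {b \<in> carrier B. g b = \<zero>\<^bsub>A\<^esub>} \<and> g ` carrier B = carrier A"
proof -
  have grp: "group (add_monoid A)" "group (add_monoid B)" "group (add_monoid D)"
    using A B D abelian_group.a_group by blast+
  have hom: "g \<in> hom (add_monoid B) (add_monoid A)" "f \<in> hom (add_monoid D) (add_monoid B)"
    using f g by (auto simp: hom_def)
  have "group_hom (add_monoid D) (add_monoid B) f"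
    using grp hom by (simp add: group_hom_def group_hom_axioms_def)
  then show ?thesis
    unfolding short_exact_sequence_iff using grp hom
    by (auto simp: epi_def mon_def kernel_def)
qed

context exact_category
begin

lemma inflationD:
  assumes "inflation E X Y f" shows "X \<in> Obj C" "Y \<in> Obj C" "f \<in> mor C X Y"
  using assms kernel_cokernel kernel_cokernel_pairD(1,2,4) unfolding inflation_def by blast+

lemma deflationD:
  assumes "deflation E Y Z g" shows "Y \<in> Obj C" "Z \<in> Obj C" "g \<in> mor C Y Z"
  using assms kernel_cokernel kernel_cokernel_pairD(2,3,5) unfolding deflation_def by blast+

lemma deflation_epi:
  assumes "deflation E Y Z g"
    and "T \<in> Obj C" "k \<in> mor C Z T" "k' \<in> mor C Z T" "Cmp C Y Z T k g = Cmp C Y Z T k' g"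
  shows "k = k'"
  using assms kernel_cokernel cokernel_cancel unfolding deflation_def by blast

lemma sequence_iso_middle_in_E:
  assumes "(X, f, Y, g, Z) \<in> E" "iso_mor C Y Y' \<phi>" "Y' \<in> Obj C" "g' \<in> mor C Y' Z"
    and "f' = Cmp C X Y Y' \<phi> f" "g = Cmp C Y Y' Z g' \<phi>"
  shows "(X, f', Y', g', Z) \<in> E"
proof -
  note D = kernel_cokernel_pairD[OF kernel_cokernel[OF assms(1)]]
  have phi: "\<phi> \<in> mor C Y Y'" using assms(2) unfolding iso_mor_def by simp
  have "iso_mor C X X (Idt C X) \<and> iso_mor C Y Y' \<phi> \<and> iso_mor C Z Z (Idt C Z) \<and>
      Cmp C X Y Y' \<phi> f = Cmp C X X Y' f' (Idt C X) \<and>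
      Cmp C Y Z Z (Idt C Z) g = Cmp C Y Y' Z g' \<phi>"
    using assms phi D(1-5) by (auto simp: iso_mor_Idt)
  then have "seq_isomorphic C (X, f, Y, g, Z) (X, f', Y', g', Z)"
    unfolding seq_isomorphic_def prod.case by blast
  moreover have "(X, f', Y', g', Z) \<in> sequences C"
    unfolding sequences_def using D assms phi by simp
  ultimately show ?thesis using iso_closed assms(1) by blast
qed

lemma projective_lift:
  assumes "projective_object C E P" "deflation E Y Z g" "h \<in> mor C P Z"
  shows "\<exists>k \<in> mor C P Y. Cmp C P Y Z g k = h"
  using assms unfolding projective_object_def by blast

lemma injective_extend:
  assumes "injective_object C E I" "inflation E X Y f" "h \<in> mor C X I"
  shows "\<exists>k \<in> mor C Y I. Cmp C X Y I k f = h"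
  using assms unfolding injective_object_def by blast

lemma projective_object_biproduct:
  assumes B: "biproduct C X Y S i j p q"
    and X: "projective_object C E X" and Y: "projective_object C E Y"
  shows "projective_object C E S"
  unfolding projective_object_def
proof (intro conjI allI impI ballI)
  have XO: "X \<in> Obj C" and YO: "Y \<in> Obj C" using X Y unfolding projective_object_def by auto
  note D = biproductD[OF B]
  show "S \<in> Obj C" by (rule D)
  fix A Z g h assume g: "deflation E A Z g" and h: "h \<in> mor C S Z"
  note G = deflationD[OF g]
  obtain k where k: "k \<in> mor C X A" "Cmp C X A Z g k = Cmp C X S Z h i"
    using projective_lift[OF X g, of "Cmp C X S Z h i"] XO D G h by auto
  obtain l where l: "l \<in> mor C Y A" "Cmp C Y A Z g l = Cmp C Y S Z h j"
    using projective_lift[OF Y g, of "Cmp C Y S Z h j"] YO D G h by auto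
  let ?m = "Cmp C S X A k p \<oplus>\<^bsub>Hom C S A\<^esub> Cmp C S Y A l q"
  have "Cmp C S A Z g ?m = h"
    using k l D(1-5) G XO YO h biproduct_decompose_right[OF B XO YO G(2) h]
    by (simp add: Cmp_add_right Cmp_assoc)
  moreover have "?m \<in> mor C S A" using k l D(1-5) G XO YO by simp
  ultimately show "\<exists>k \<in> mor C S A. Cmp C S A Z g k = h" by blast
qed

lemma projective_object_retract:
  assumes S: "projective_object C E S" and X: "X \<in> Obj C"
    and i: "i \<in> mor C X S" and p: "p \<in> mor C S X" and pi: "Cmp C X S X p i = Idt C X"
  shows "projective_object C E X"
  unfolding projective_object_def
proof (intro conjI allI impI ballI)
  have SO: "S \<in> Obj C" using S unfolding projective_object_def by simp
  fix A Z g h assume g: "deflation E A Z g" and h: "h \<in> mor C X Z"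
  note G = deflationD[OF g]
  obtain k where k: "k \<in> mor C S A" "Cmp C S A Z g k = Cmp C S X Z h p"
    using projective_lift[OF S g, of "Cmp C S X Z h p"] X SO p G h by auto
  have "Cmp C X A Z g (Cmp C X S A k i) = h"
    using k i p pi G X SO h by (simp add: Cmp_assoc) (simp flip: Cmp_assoc)
  then show "\<exists>k \<in> mor C X A. Cmp C X A Z g k = h"
    using k i G X SO by (intro bexI[of _ "Cmp C X S A k i"]) auto
qed fact

lemma injective_object_retract:
  assumes S: "injective_object C E S" and X: "X \<in> Obj C"
    and i: "i \<in> mor C X S" and p: "p \<in> mor C S X" and pi: "Cmp C X S X p i = Idt C X"
  shows "injective_object C E X"
  unfolding injective_object_def
proof (intro conjI allI impI ballI)
  have SO: "S \<in> Obj C" using S unfolding injective_object_def by simp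
  fix A Z f h assume f: "inflation E A Z f" and h: "h \<in> mor C A X"
  note G = inflationD[OF f]
  obtain k where k: "k \<in> mor C Z S" "Cmp C A Z S k f = Cmp C A X S i h"
    using injective_extend[OF S f, of "Cmp C A X S i h"] X SO i G h by auto
  have "Cmp C A Z X (Cmp C Z S X p k) f = h"
    using k i p pi G X SO h by (simp flip: Cmp_assoc) (simp add: Cmp_assoc)
  then show "\<exists>k \<in> mor C Z X. Cmp C A Z X k f = h"
    using k p G X SO by (intro bexI[of _ "Cmp C Z S X p k"]) auto
qed fact

end

context frobenius_category
begin

text \<open>Exactness is detected by \<open>Hom(P, -)\<close> for projective \<open>P\<close>, so the exact structure is unique.
  Since there are enough projectives, such a sequence has \<open>f\<close> as a kernel of \<open>g\<close>. A deflation
  \<open>p : P \<rightarrow> Z\<close> from a projective object factors as \<open>g h\<close>; with \<open>k : K \<rightarrow> P\<close> its kernel, \<open>h k\<close>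
  factors through some \<open>l : K \<rightarrow> X\<close>. The pushout of \<open>k\<close> along \<open>l\<close> is an exact sequence
  \<open>X \<rightarrow> Y'' \<rightarrow> Z\<close> with a comparison map \<open>Y'' \<rightarrow> Y\<close>, which is invertible as in the five lemma.\<close>

lemma in_E_if_projectively_exact:
  assumes obj: "X \<in> Obj C" "Y \<in> Obj C" "Z \<in> Obj C" and fg: "f \<in> mor C X Y" "g \<in> mor C Y Z"
    and inj: "\<And>P k. \<lbrakk>projective_object C E P; k \<in> mor C P X; Cmp C P X Y f k = zero_mor C P Y\<rbrakk>
      \<Longrightarrow> k = zero_mor C P X"
    and zero: "\<And>P k. \<lbrakk>projective_object C E P; k \<in> mor C P X\<rbrakk>
      \<Longrightarrow> Cmp C P Y Z g (Cmp C P X Y f k) = zero_mor C P Z"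
    and ker: "\<And>P h. \<lbrakk>projective_object C E P; h \<in> mor C P Y; Cmp C P Y Z g h = zero_mor C P Z\<rbrakk>
      \<Longrightarrow> \<exists>k \<in> mor C P X. Cmp C P X Y f k = h"
    and surj: "\<And>P h. \<lbrakk>projective_object C E P; h \<in> mor C P Z\<rbrakk> \<Longrightarrow> \<exists>k \<in> mor C P Y. Cmp C P Y Z g k = h"
  shows "(X, f, Y, g, Z) \<in> E"
proof -
  note [simp] = obj fg
  have gf: "Cmp C X Y Z g f = zero_mor C X Z"
  proof -
    obtain P p where P: "projective_object C E P" "deflation E P X p"
      using enough_projectives obj by blast
    have "Cmp C P X Z (Cmp C X Y Z g f) p = Cmp C P X Z (zero_mor C X Z) p"
      using zero[OF P(1)] deflationD[OF P(2)] by (simp add: Cmp_assoc)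
    from deflation_epi[OF P(2) _ _ _ this] show ?thesis by simp
  qed
  have f_mono: "k = zero_mor C T X"
    if T: "T \<in> Obj C" "k \<in> mor C T X" "Cmp C T X Y f k = zero_mor C T Y" for T k
  proof -
    obtain P p where P: "projective_object C E P" "deflation E P T p"
      using enough_projectives T by blast
    note Pd = deflationD[OF P(2)]
    have "Cmp C P X Y f (Cmp C P T X k p) = zero_mor C P Y"
      using Pd T by (simp add: Cmp_assoc)
    then have "Cmp C P T X k p = Cmp C P T X (zero_mor C T X) p"
      using inj[OF P(1), of "Cmp C P T X k p"] Pd T by simp
    from deflation_epi[OF P(2) _ _ _ this] T show ?thesis by simp
  qed
  have f_cancel: "k = k'"
    if T: "T \<in> Obj C" "k \<in> mor C T X" "k' \<in> mor C T X" "Cmp C T X Y f k = Cmp C T X Y f k'" for T k k'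
  proof -
    have "Cmp C T X Y f (k \<ominus>\<^bsub>Hom C T X\<^esub> k') = zero_mor C T Y"
      using T by (simp add: Cmp_minus_right minus_mor_eq_zero_iff)
    then show ?thesis using f_mono[of T "k \<ominus>\<^bsub>Hom C T X\<^esub> k'"] T by (simp add: minus_mor_eq_zero_iff)
  qed
  have f_ker: "\<exists>k \<in> mor C T X. Cmp C T X Y f k = h"
    if T: "T \<in> Obj C" "h \<in> mor C T Y" "Cmp C T Y Z g h = zero_mor C T Z" for T h
  proof -
    obtain P p where P: "projective_object C E P" "deflation E P T p"
      using enough_projectives T by blast
    obtain K m where K: "(K, m, P, p, T) \<in> E" using P(2) unfolding deflation_def by blast
    note KK = kernel_cokernel[OF K]
    note D = kernel_cokernel_pairD[OF KK]
    have "Cmp C P Y Z g (Cmp C P T Y h p) = zero_mor C P Z"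
      using D(1-5) T by (simp add: Cmp_assoc)
    then obtain l where l: "l \<in> mor C P X" "Cmp C P X Y f l = Cmp C P T Y h p"
      using ker[OF P(1), of "Cmp C P T Y h p"] D(1-5) T by auto
    have "Cmp C K X Y f (Cmp C K P X l m) = zero_mor C K Y"
      using l D(1-6) T by (simp add: Cmp_assoc) (simp flip: Cmp_assoc)
    then have "Cmp C K P X l m = zero_mor C K X"
      using f_mono D(1-5) l by simp
    then obtain k where k: "k \<in> mor C T X" "Cmp C P T X k p = l"
      using D(8)[of X l] l by auto
    have "Cmp C P T Y (Cmp C T X Y f k) p = Cmp C P T Y h p"
      using k l D(1-5) T by (simp flip: Cmp_assoc)
    from deflation_epi[OF P(2) _ _ _ this] k T have "Cmp C T X Y f k = h" by simp
    then show ?thesis using k by blast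
  qed
  obtain P p where P: "projective_object C E P" "deflation E P Z p"
    using enough_projectives obj by blast
  obtain K k where K: "(K, k, P, p, Z) \<in> E" using P(2) unfolding deflation_def by blast
  then have kinf: "inflation E K P k" unfolding inflation_def by blast
  note KK = kernel_cokernel[OF K]
  note D = kernel_cokernel_pairD[OF KK]
  note [simp] = D(1-5)
  obtain h where h [simp]: "h \<in> mor C P Y" and gh: "Cmp C P Y Z g h = p"
    using surj[OF P(1) D(5)] by blast
  have "Cmp C K Y Z g (Cmp C K P Y h k) = zero_mor C K Z"
    using gh D(6) by (simp add: Cmp_assoc)
  then obtain l where l [simp]: "l \<in> mor C K X" and fl: "Cmp C K X Y f l = Cmp C K P Y h k"
    using f_ker[of K "Cmp C K P Y h k"] by auto
  obtain Y'' b k' where po: "is_pushout C K P X Y'' k l b k'" and k'inf: "inflation E X Y'' k'"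
    using pushout_inflation[OF kinf obj(1) l] by blast
  have sq: "Y'' \<in> Obj C" "b \<in> mor C P Y''" "k' \<in> mor C X Y''"
      "Cmp C K P Y'' b k = Cmp C K X Y'' k' l"
    using po unfolding is_pushout_def commutative_square_def by auto
  note [simp] = sq(1-3)
  have "commutative_square C K P X Y k l h f"
    unfolding commutative_square_def using fl by simp
  then obtain \<phi> where phi [simp]: "\<phi> \<in> mor C Y'' Y" and
    phib: "Cmp C P Y'' Y \<phi> b = h" and phik: "Cmp C X Y'' Y \<phi> k' = f"
    using is_pushout_ex[OF po] by blast
  let ?g = "Cmp C Y'' Y Z g \<phi>"
  have gb: "Cmp C P Y'' Z ?g b = p" using phib gh by (simp flip: Cmp_assoc)
  have gk: "Cmp C X Y'' Z ?g k' = zero_mor C X Z" using phik gf by (simp flip: Cmp_assoc)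
  obtain d Dd where dE: "(X, k', Y'', d, Dd) \<in> E" using k'inf unfolding inflation_def by blast
  note DE = kernel_cokernel_pairD[OF kernel_cokernel[OF dE]]
  note [simp] = DE(3,5)
  \<comment> \<open>The pushout inflation \<open>k'\<close> has the same cokernel \<open>Z\<close> as \<open>k\<close>.\<close>
  obtain c where c [simp]: "c \<in> mor C Dd Z" and cd: "Cmp C Y'' Dd Z c d = ?g"
    using DE(8)[of Z ?g] gk by auto
  have "Cmp C K P Dd (Cmp C P Y'' Dd d b) k = zero_mor C K Dd"
    using sq(4) DE(6) by (simp flip: Cmp_assoc) (simp add: Cmp_assoc)
  then obtain e where e [simp]: "e \<in> mor C Z Dd" and ep: "Cmp C P Z Dd e p = Cmp C P Y'' Dd d b"
    using D(8)[of Dd "Cmp C P Y'' Dd d b"] by auto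
  have eg: "Cmp C Y'' Z Dd e ?g = d"
  proof (rule is_pushout_cancel[OF po])
    show "Cmp C P Y'' Dd (Cmp C Y'' Z Dd e ?g) b = Cmp C P Y'' Dd d b"
      using gb ep by (simp flip: Cmp_assoc[of P Y'' Z Dd])
    show "Cmp C X Y'' Dd (Cmp C Y'' Z Dd e ?g) k' = Cmp C X Y'' Dd d k'"
      using gk DE(6) by (simp flip: Cmp_assoc[of X Y'' Z Dd])
  qed auto
  have "Cmp C Y'' Dd Dd (Cmp C Dd Z Dd e c) d = Cmp C Y'' Dd Dd (Idt C Dd) d"
    using cd eg by (simp flip: Cmp_assoc[of Y'' Dd Z Dd])
  from cokernel_cancel[OF kernel_cokernel[OF dE] _ _ _ this] have ec: "Cmp C Dd Z Dd e c = Idt C Dd" by simp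
  have "Cmp C P Z Z (Cmp C Z Dd Z c e) p = Cmp C P Z Z (Idt C Z) p"
    using ep cd gb by (simp flip: Cmp_assoc[of P Z Dd Z]) (simp add: Cmp_assoc[of P Y'' Dd Z])
  from cokernel_cancel[OF KK _ _ _ this] have ce: "Cmp C Z Dd Z c e = Idt C Z" by simp
  have "iso_mor C Dd Z c" unfolding iso_mor_def using ec ce by auto
  then have "iso_mor C X X (Idt C X) \<and> iso_mor C Y'' Y'' (Idt C Y'') \<and> iso_mor C Dd Z c \<and>
      Cmp C X Y'' Y'' (Idt C Y'') k' = Cmp C X X Y'' k' (Idt C X) \<and>
      Cmp C Y'' Dd Z c d = Cmp C Y'' Y'' Z ?g (Idt C Y'')"
    using cd by (simp add: iso_mor_Idt)
  then have "seq_isomorphic C (X, k', Y'', d, Dd) (X, k', Y'', ?g, Z)"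
    unfolding seq_isomorphic_def prod.case by blast
  moreover have "(X, k', Y'', ?g, Z) \<in> sequences C" unfolding sequences_def by simp
  ultimately have E'': "(X, k', Y'', ?g, Z) \<in> E" using iso_closed dE by blast
  then have gdef: "deflation E Y'' Z ?g" unfolding deflation_def by blast
  note KE = kernel_cokernel_pairD[OF kernel_cokernel[OF E'']]
  \<comment> \<open>The comparison map \<open>\<phi>\<close> is a monomorphism and a split epimorphism.\<close>
  have phi_cancel: "x = x'"
    if T: "T \<in> Obj C" "x \<in> mor C T Y''" "x' \<in> mor C T Y''" "Cmp C T Y'' Y \<phi> x = Cmp C T Y'' Y \<phi> x'"
    for T x x'
  proof -
    let ?x = "x \<ominus>\<^bsub>Hom C T Y''\<^esub> x'"
    have 1: "Cmp C T Y'' Y \<phi> ?x = zero_mor C T Y"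
      using T by (simp add: Cmp_minus_right minus_mor_eq_zero_iff)
    then have "Cmp C T Y'' Z ?g ?x = zero_mor C T Z"
      using T by (simp flip: Cmp_assoc)
    then obtain y where y: "y \<in> mor C T X" "Cmp C T X Y'' k' y = ?x"
      using KE(7)[of T ?x] T by auto
    then have "Cmp C T X Y f y = zero_mor C T Y"
      using 1 phik T by (simp add: Cmp_assoc flip: y(2))
    then have "y = zero_mor C T X" using f_mono T y by simp
    then have "?x = zero_mor C T Y''" using y T by simp
    then show ?thesis using T by (simp add: minus_mor_eq_zero_iff)
  qed
  obtain Q q where Q: "projective_object C E Q" "deflation E Q Y q"
    using enough_projectives obj by blast
  obtain L m where L: "(L, m, Q, q, Y) \<in> E" using Q(2) unfolding deflation_def by blast
  note LK = kernel_cokernel[OF L]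
  note LD = kernel_cokernel_pairD[OF LK]
  note [simp] = LD(1-5)
  obtain r where r [simp]: "r \<in> mor C Q Y''" and gr: "Cmp C Q Y'' Z ?g r = Cmp C Q Y Z g q"
    using projective_lift[OF Q(1) gdef, of "Cmp C Q Y Z g q"] by auto
  let ?w = "q \<ominus>\<^bsub>Hom C Q Y\<^esub> Cmp C Q Y'' Y \<phi> r"
  have "Cmp C Q Y Z g ?w = zero_mor C Q Z"
    using gr by (simp add: Cmp_minus_right Cmp_assoc minus_mor_eq_zero_iff)
  then obtain y where y [simp]: "y \<in> mor C Q X" and fy: "Cmp C Q X Y f y = ?w"
    using f_ker[of Q ?w] by auto
  let ?r = "r \<oplus>\<^bsub>Hom C Q Y''\<^esub> Cmp C Q X Y'' k' y"
  have phir: "Cmp C Q Y'' Y \<phi> ?r = q"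
    using phik fy by (simp add: Cmp_add_right Cmp_assoc minus_add_cancel_mor)
  have "Cmp C L Y'' Y \<phi> (Cmp C L Q Y'' ?r m) = Cmp C L Y'' Y \<phi> (zero_mor C L Y'')"
    using phir LD(6) by (simp add: Cmp_assoc)
  from phi_cancel[OF _ _ _ this] have  "Cmp C L Q Y'' ?r m = zero_mor C L Y''" by simp
  then obtain \<psi> where psi [simp]: "\<psi> \<in> mor C Y Y''" and psiq: "Cmp C Q Y Y'' \<psi> q = ?r"
    using LD(8)[of Y'' ?r] by auto
  have "Cmp C Q Y Y (Cmp C Y Y'' Y \<phi> \<psi>) q = Cmp C Q Y Y (Idt C Y) q"
    using psiq phir by (simp flip: Cmp_assoc)
  from cokernel_cancel[OF LK _ _ _ this] have phipsi: "Cmp C Y Y'' Y \<phi> \<psi> = Idt C Y" by simp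
  have "Cmp C Y'' Y'' Y \<phi> (Cmp C Y'' Y Y'' \<psi> \<phi>) = Cmp C Y'' Y'' Y \<phi> (Idt C Y'')"
    using phipsi by (simp add: Cmp_assoc)
  from phi_cancel[OF _ _ _ this] have psiphi: "Cmp C Y'' Y Y'' \<psi> \<phi> = Idt C Y''" by simp
  have "iso_mor C Y'' Y \<phi>" unfolding iso_mor_def using phipsi psiphi by auto
  then show ?thesis
    using sequence_iso_middle_in_E[OF E'', of Y \<phi> g f] phik by simp
qed

lemma biproduct_in_E:
  assumes B: "biproduct C X Y S i j p q" and X: "X \<in> Obj C" and Y: "Y \<in> Obj C"
  shows "(X, i, S, q, Y) \<in> E"
proof (rule in_E_if_projectively_exact)
  note K = kernel_cokernel_pair_biproduct[OF B X Y]
  note D = kernel_cokernel_pairD[OF K]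
  note B' = biproductD[OF B]
  show "X \<in> Obj C" "S \<in> Obj C" "Y \<in> Obj C" "i \<in> mor C X S" "q \<in> mor C S Y" by fact+
  fix P assume "projective_object C E P"
  then have P: "P \<in> Obj C" unfolding projective_object_def by simp
  { fix k assume k: "k \<in> mor C P X" "Cmp C P X S i k = zero_mor C P S"
    then show "k = zero_mor C P X"
      using kernel_cancel[OF K P, of k "zero_mor C P X"] D(1-5) P by simp }
  { fix k assume k: "k \<in> mor C P X"
    show "Cmp C P S Y q (Cmp C P X S i k) = zero_mor C P Y"
      using k D(1-6) P by (simp add: Cmp_assoc) }
  { fix h assume h: "h \<in> mor C P S" "Cmp C P S Y q h = zero_mor C P Y"
    show "\<exists>k \<in> mor C P X. Cmp C P X S i k = h" by (rule D(7)[OF P h]) }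
  { fix h assume h: "h \<in> mor C P Y"
    show "\<exists>k \<in> mor C P S. Cmp C P S Y q k = h"
      using B' P Y h by (intro bexI[of _ "Cmp C P Y S j h"]) (simp_all add: Cmp_assoc) }
qed

lemma biproduct_deflation:
  "\<lbrakk>biproduct C X Y S i j p q; X \<in> Obj C; Y \<in> Obj C\<rbrakk> \<Longrightarrow> deflation E S X p"
  using biproduct_in_E biproduct_commute unfolding deflation_def by blast

lemma biproduct_inflation:
  "\<lbrakk>biproduct C X Y S i j p q; X \<in> Obj C; Y \<in> Obj C\<rbrakk> \<Longrightarrow> inflation E X S i"
  using biproduct_in_E unfolding inflation_def by blast

text \<open>If one component of a map \<open>g : P \<oplus> Q \<rightarrow> X\<close> is a deflation \<open>g i\<close> and \<open>Q\<close> is projective, the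
  other component factors as \<open>g i t\<close>, and \<open>g\<close> is the composite of the projection \<open>p + t q\<close>
  with \<open>g i\<close>; so \<open>g\<close> is a deflation. Dually for inflations.\<close>

lemma deflation_from_component:
  assumes B: "biproduct C P Q S i j p q" and P: "P \<in> Obj C" and Q: "projective_object C E Q"
    and X: "X \<in> Obj C" and g: "g \<in> mor C S X" and gi: "deflation E P X (Cmp C P S X g i)"
  shows "deflation E S X g"
proof -
  have QO: "Q \<in> Obj C" using Q unfolding projective_object_def by auto
  note D = biproductD[OF B]
  note [simp] = P QO X g D(1-5)
  obtain t where t [simp]: "t \<in> mor C Q P" and gt: "Cmp C Q P X (Cmp C P S X g i) t = Cmp C Q S X g j"
    using projective_lift[OF Q gi, of "Cmp C Q S X g j"] by auto
  let ?p = "p \<oplus>\<^bsub>Hom C S P\<^esub> Cmp C S Q P t q"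
  let ?j = "j \<ominus>\<^bsub>Hom C Q S\<^esub> Cmp C Q P S i t"
  have 1: "Cmp C P S P ?p i = Idt C P"
    using D(6,8) by (simp add: Cmp_add_left flip: Cmp_assoc[of P S Q P])
  have 2: "Cmp C Q S Q q ?j = Idt C Q"
    using D(7,8) minus_add_cancel_mor(2)[of Q Q "Idt C Q" "zero_mor C Q Q"]
    by (simp add: Cmp_minus_right Cmp_assoc)
  have "Cmp C Q S P ?p ?j = Cmp C Q S P ?p j \<ominus>\<^bsub>Hom C Q P\<^esub> Cmp C Q P P (Cmp C P S P ?p i) t"
    by (simp add: Cmp_minus_right Cmp_assoc)
  then have 3: "Cmp C Q S P ?p ?j = zero_mor C Q P"
    using 1 D(7,9) by (simp add: Cmp_add_left minus_mor_eq_zero_iff flip: Cmp_assoc[of Q S Q P])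
  have 4: "Cmp C S P S i ?p \<oplus>\<^bsub>Hom C S S\<^esub> Cmp C S Q S ?j q = Idt C S"
  proof -
    interpret A: abelian_group "Hom C S S" by (rule Hom_abelian_group) simp_all
    have "Cmp C S P S i ?p \<oplus>\<^bsub>Hom C S S\<^esub> Cmp C S Q S ?j q
      = Cmp C S P S i p \<oplus>\<^bsub>Hom C S S\<^esub> (Cmp C S P S i (Cmp C S Q P t q) \<oplus>\<^bsub>Hom C S S\<^esub>
         (Cmp C S Q S j q \<ominus>\<^bsub>Hom C S S\<^esub> Cmp C S P S i (Cmp C S Q P t q)))"
      by (simp add: Cmp_add_right Cmp_minus_left A.a_assoc Cmp_assoc)
    also have "\<dots> = Idt C S" using D(10) by (simp add: minus_add_cancel_mor)
    finally show ?thesis .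
  qed
  have B': "biproduct C P Q S i ?j ?p q"
    unfolding biproduct_def using D(8) 1 2 3 4 by simp
  have "g = Cmp C S P X (Cmp C P S X g i) ?p"
    using gt biproduct_decompose_right[OF B P QO X g] by (simp add: Cmp_add_right Cmp_assoc)
  then show ?thesis
    using Cmp_deflation[OF biproduct_deflation[OF B' P QO] gi] by simp
qed

lemma inflation_from_component:
  assumes B: "biproduct C P Q S i j p q" and P: "P \<in> Obj C" and Q: "injective_object C E Q"
    and X: "X \<in> Obj C" and f: "f \<in> mor C X S" and pf: "inflation E X P (Cmp C X S P p f)"
  shows "inflation E X S f"
proof -
  have QO: "Q \<in> Obj C" using Q unfolding injective_object_def by auto
  note D = biproductD[OF B]
  note [simp] = P QO X f D(1-5)
  obtain t where t [simp]: "t \<in> mor C P Q" and tf: "Cmp C X P Q t (Cmp C X S P p f) = Cmp C X S Q q f"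
    using injective_extend[OF Q pf, of "Cmp C X S Q q f"] by auto
  let ?i = "i \<oplus>\<^bsub>Hom C P S\<^esub> Cmp C P Q S j t"
  let ?q = "q \<ominus>\<^bsub>Hom C S Q\<^esub> Cmp C S P Q t p"
  have 1: "Cmp C P S P p ?i = Idt C P"
    using D(6,9) by (simp add: Cmp_add_right Cmp_assoc)
  have 2: "Cmp C Q S Q ?q j = Idt C Q"
    using D(7,9) minus_add_cancel_mor(2)[of Q Q "Idt C Q" "zero_mor C Q Q"]
    by (simp add: Cmp_minus_left flip: Cmp_assoc)
  have "Cmp C P S Q ?q ?i = Cmp C P S Q q ?i \<ominus>\<^bsub>Hom C P Q\<^esub> Cmp C P P Q t (Cmp C P S P p ?i)"
    by (simp add: Cmp_minus_left flip: Cmp_assoc)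
  then have 3: "Cmp C P S Q ?q ?i = zero_mor C P Q"
    using 1 D(7,8) by (simp add: Cmp_add_right minus_mor_eq_zero_iff Cmp_assoc)
  have 4: "Cmp C S P S ?i p \<oplus>\<^bsub>Hom C S S\<^esub> Cmp C S Q S j ?q = Idt C S"
  proof -
    interpret A: abelian_group "Hom C S S" by (rule Hom_abelian_group) simp_all
    have "Cmp C S P S ?i p \<oplus>\<^bsub>Hom C S S\<^esub> Cmp C S Q S j ?q
      = Cmp C S P S i p \<oplus>\<^bsub>Hom C S S\<^esub> (Cmp C S Q S j (Cmp C S P Q t p) \<oplus>\<^bsub>Hom C S S\<^esub>
         (Cmp C S Q S j q \<ominus>\<^bsub>Hom C S S\<^esub> Cmp C S Q S j (Cmp C S P Q t p)))"
      by (simp add: Cmp_add_left Cmp_minus_right A.a_assoc Cmp_assoc)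
    also have "\<dots> = Idt C S" using D(10) by (simp add: minus_add_cancel_mor)
    finally show ?thesis .
  qed
  have B': "biproduct C P Q S ?i j p ?q"
    unfolding biproduct_def using D(9) 1 2 3 4 by simp
  have "f = Cmp C X P S ?i (Cmp C X S P p f)"
    using tf biproduct_decompose_left[OF B P QO X f] by (simp add: Cmp_add_left flip: Cmp_assoc)
  then show ?thesis
    using Cmp_inflation[OF pf biproduct_inflation[OF B' P QO]] by simp
qed

text \<open>Membership follows from the covariant half by \<open>in_E_if_projectively_exact\<close>; for members, the
  contravariant half holds because projective objects are injective.\<close>

theorem in_E_iff_short_exact:
  "(X, f, Y, g, Z) \<in> E \<longleftrightarrow> (X, f, Y, g, Z) \<in> sequences C \<and>
    (\<forall>P. projective_object C E P \<longrightarrow>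
        short_exact_sequence
          (add_monoid (Hom C P Z)) (add_monoid (Hom C P Y)) (add_monoid (Hom C P X))
          (Cmp C P Y Z g) (Cmp C P X Y f) \<and>
        short_exact_sequence
          (add_monoid (Hom C X P)) (add_monoid (Hom C Y P)) (add_monoid (Hom C Z P))
          (\<lambda>h. Cmp C X Y P h f) (\<lambda>h. Cmp C Y Z P h g))"
proof -
  have 1: "short_exact_sequence
      (add_monoid (Hom C P Z)) (add_monoid (Hom C P Y)) (add_monoid (Hom C P X))
      (Cmp C P Y Z g) (Cmp C P X Y f) \<longleftrightarrow>
    inj_on (Cmp C P X Y f) (mor C P X) \<and>
    Cmp C P X Y f ` mor C P X = {h \<in> mor C P Y. Cmp C P Y Z g h = zero_mor C P Z} \<and>
    Cmp C P Y Z g ` mor C P Y = mor C P Z"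
    if "(X, f, Y, g, Z) \<in> sequences C" "projective_object C E P" for P
    using that unfolding sequences_def projective_object_def
    by (intro short_exact_sequence_add_monoid_iff) (auto simp: Hom_abelian_group Cmp_add_right)
  have 2: "short_exact_sequence
      (add_monoid (Hom C X P)) (add_monoid (Hom C Y P)) (add_monoid (Hom C Z P))
      (\<lambda>h. Cmp C X Y P h f) (\<lambda>h. Cmp C Y Z P h g) \<longleftrightarrow>
    inj_on (\<lambda>h. Cmp C Y Z P h g) (mor C Z P) \<and>
    (\<lambda>h. Cmp C Y Z P h g) ` mor C Z P = {h \<in> mor C Y P. Cmp C X Y P h f = zero_mor C X P} \<and>
    (\<lambda>h. Cmp C X Y P h f) ` mor C Y P = mor C X P"
    if "(X, f, Y, g, Z) \<in> sequences C" "projective_object C E P" for P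
    using that unfolding sequences_def projective_object_def
    by (intro short_exact_sequence_add_monoid_iff) (auto simp: Hom_abelian_group Cmp_add_left)
  show ?thesis (is "?E \<longleftrightarrow> ?s \<and> (\<forall>P. _ \<longrightarrow> ?S P)")
  proof
    assume E: ?E
    note K = kernel_cokernel[OF E]
    note KD = kernel_cokernel_pairD[OF K]
    have s: ?s using KD unfolding sequences_def by simp
    have inf: "inflation E X Y f" and defl: "deflation E Y Z g"
      using E unfolding inflation_def deflation_def by blast+
    have "?S P" if P: "projective_object C E P" for P
    proof -
      have I: "injective_object C E P" using P projective_iff_injective by blast
      have PO: "P \<in> Obj C" using P unfolding projective_object_def by simp
      have "inj_on (Cmp C P X Y f) (mor C P X)" "inj_on (\<lambda>h. Cmp C Y Z P h g) (mor C Z P)"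
        using kernel_cancel[OF K PO] cokernel_cancel[OF K PO] by (blast intro: inj_onI)+
      moreover have "Cmp C P X Y f ` mor C P X = {h \<in> mor C P Y. Cmp C P Y Z g h = zero_mor C P Z}"
        using KD(1-6) KD(7)[OF PO] PO by (auto simp: Cmp_assoc; blast)
      moreover have "(\<lambda>h. Cmp C Y Z P h g) ` mor C Z P = {h \<in> mor C Y P. Cmp C X Y P h f = zero_mor C X P}"
        using KD(1-6) KD(8)[OF PO] PO by (auto simp flip: Cmp_assoc; blast)
      moreover have "Cmp C P Y Z g ` mor C P Y = mor C P Z"
        using KD(1-5) PO projective_lift[OF P defl] by (auto; blast)
      moreover have "(\<lambda>h. Cmp C X Y P h f) ` mor C Y P = mor C X P"
        using KD(1-5) PO injective_extend[OF I inf] by (auto; blast)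
      ultimately show ?thesis
        unfolding 1[OF s P] 2[OF s P] by blast
    qed
    then show "?s \<and> (\<forall>P. projective_object C E P \<longrightarrow> ?S P)" using s by blast
  next
    assume H: "?s \<and> (\<forall>P. projective_object C E P \<longrightarrow> ?S P)"
    then have s: ?s by blast
    have [simp]: "X \<in> Obj C" "Y \<in> Obj C" "Z \<in> Obj C" "f \<in> mor C X Y" "g \<in> mor C Y Z"
      using s unfolding sequences_def by auto
    have *: "P \<in> Obj C" "inj_on (Cmp C P X Y f) (mor C P X)"
      "Cmp C P X Y f ` mor C P X = {h \<in> mor C P Y. Cmp C P Y Z g h = zero_mor C P Z}"
      "Cmp C P Y Z g ` mor C P Y = mor C P Z" if P: "projective_object C E P" for P
      using H 1[OF s P] P unfolding projective_object_def by blast+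
    show ?E
    proof (rule in_E_if_projectively_exact)
      fix P assume P: "projective_object C E P"
      note PP = *[OF P]
      { fix k assume k: "k \<in> mor C P X" "Cmp C P X Y f k = zero_mor C P Y"
        then have "Cmp C P X Y f k = Cmp C P X Y f (zero_mor C P X)" using PP(1) by simp
        from inj_onD[OF PP(2) this] show "k = zero_mor C P X" using k PP(1) by simp }
      { fix k assume "k \<in> mor C P X"
        then show "Cmp C P Y Z g (Cmp C P X Y f k) = zero_mor C P Z" using PP(3) by blast }
      { fix h assume "h \<in> mor C P Y" "Cmp C P Y Z g h = zero_mor C P Z"
        then have "h \<in> Cmp C P X Y f ` mor C P X" using PP(3) by blast
        then show "\<exists>k \<in> mor C P X. Cmp C P X Y f k = h" by blast }
      { fix h assume "h \<in> mor C P Z"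
        then have "h \<in> Cmp C P Y Z g ` mor C P Y" using PP(4) by blast
        then show "\<exists>k \<in> mor C P Y. Cmp C P Y Z g k = h" by blast }
    qed simp_all
  qed
qed

end

section \<open>Equivariant objects\<close>

locale strict_action = preadditive_category C + group G
  for C :: "('o, 'm) precategory" and G :: "('g, 'e) monoid_scheme" (structure) +
  fixes aO :: "'g \<Rightarrow> 'o \<Rightarrow> 'o" and aM :: "'g \<Rightarrow> 'o \<Rightarrow> 'o \<Rightarrow> 'm \<Rightarrow> 'm"
  assumes aO_closed [simp]: "\<lbrakk>\<gamma> \<in> carrier G; X \<in> Obj C\<rbrakk> \<Longrightarrow> aO \<gamma> X \<in> Obj C"
    and aO_mult [simp]: "\<lbrakk>\<alpha> \<in> carrier G; \<beta> \<in> carrier G; X \<in> Obj C\<rbrakk> \<Longrightarrow> aO \<alpha> (aO \<beta> X) = aO (\<alpha> \<otimes> \<beta>) X"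
    and aO_one [simp]: "X \<in> Obj C \<Longrightarrow> aO \<one> X = X"
    and aM_closed [simp]: "\<lbrakk>\<gamma> \<in> carrier G; X \<in> Obj C; Y \<in> Obj C; f \<in> mor C X Y\<rbrakk>
      \<Longrightarrow> aM \<gamma> X Y f \<in> mor C (aO \<gamma> X) (aO \<gamma> Y)"
    and aM_mult [simp]: "\<lbrakk>\<alpha> \<in> carrier G; \<beta> \<in> carrier G; X \<in> Obj C; Y \<in> Obj C; f \<in> mor C X Y\<rbrakk>
      \<Longrightarrow> aM \<alpha> (aO \<beta> X) (aO \<beta> Y) (aM \<beta> X Y f) = aM (\<alpha> \<otimes> \<beta>) X Y f"
    and aM_one [simp]: "\<lbrakk>X \<in> Obj C; Y \<in> Obj C; f \<in> mor C X Y\<rbrakk> \<Longrightarrow> aM \<one> X Y f = f"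
    and aM_Idt [simp]: "\<lbrakk>\<gamma> \<in> carrier G; X \<in> Obj C\<rbrakk> \<Longrightarrow> aM \<gamma> X X (Idt C X) = Idt C (aO \<gamma> X)"
    and aM_Cmp: "\<lbrakk>\<gamma> \<in> carrier G; X \<in> Obj C; Y \<in> Obj C; Z \<in> Obj C; f \<in> mor C X Y; g \<in> mor C Y Z\<rbrakk>
      \<Longrightarrow> aM \<gamma> X Z (Cmp C X Y Z g f) = Cmp C (aO \<gamma> X) (aO \<gamma> Y) (aO \<gamma> Z) (aM \<gamma> Y Z g) (aM \<gamma> X Y f)"
    and aM_add: "\<lbrakk>\<gamma> \<in> carrier G; X \<in> Obj C; Y \<in> Obj C; f \<in> mor C X Y; g \<in> mor C X Y\<rbrakk>
      \<Longrightarrow> aM \<gamma> X Y (f \<oplus>\<^bsub>Hom C X Y\<^esub> g) = aM \<gamma> X Y f \<oplus>\<^bsub>Hom C (aO \<gamma> X) (aO \<gamma> Y)\<^esub> aM \<gamma> X Y g"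
begin

abbreviation EC where "EC \<equiv> equivariant_category G aO aM C"

lemma aM_zero [simp]:
  assumes "\<gamma> \<in> carrier G" "X \<in> Obj C" "Y \<in> Obj C"
  shows "aM \<gamma> X Y (zero_mor C X Y) = zero_mor C (aO \<gamma> X) (aO \<gamma> Y)"
proof -
  interpret A: abelian_group "Hom C X Y" by (rule Hom_abelian_group) fact+
  interpret B: abelian_group "Hom C (aO \<gamma> X) (aO \<gamma> Y)" by (rule Hom_abelian_group) (use assms in auto)
  show ?thesis
    using additive_map_finsum[OF A.abelian_group_axioms B.abelian_group_axioms, of "aM \<gamma> X Y" "{}"]
      assms by (simp add: aM_add)
qed

text \<open>The cocycle condition together with \<open>\<xi>\<^sub>\<one> = id\<close> makes every \<open>\<xi>\<^sub>\<gamma>\<close> invertible, with inverse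
  \<open>\<gamma> (\<xi>\<^bsub>\<gamma>\<inverse>\<^esub>)\<close>.\<close>

lemma EC_objI:
  assumes X: "X \<in> Obj C" and ext: "\<xi> \<in> extensional (carrier G)"
    and cl: "\<And>\<gamma>. \<gamma> \<in> carrier G \<Longrightarrow> \<xi> \<gamma> \<in> mor C (aO \<gamma> X) X"
    and one: "\<xi> \<one> = Idt C X"
    and cocycle: "\<And>\<alpha> \<beta>. \<lbrakk>\<alpha> \<in> carrier G; \<beta> \<in> carrier G\<rbrakk> \<Longrightarrow> \<xi> (\<alpha> \<otimes> \<beta>) =
      Cmp C (aO (\<alpha> \<otimes> \<beta>) X) (aO \<alpha> X) X (\<xi> \<alpha>) (aM \<alpha> (aO \<beta> X) X (\<xi> \<beta>))"
  shows "(X, \<xi>) \<in> Obj EC"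
proof -
  have "iso_mor C (aO \<gamma> X) X (\<xi> \<gamma>)" if g: "\<gamma> \<in> carrier G" for \<gamma>
  proof -
    let ?k = "aM \<gamma> (aO (inv \<gamma>) X) X (\<xi> (inv \<gamma>))"
    have k: "?k \<in> mor C X (aO \<gamma> X)"
      using aM_closed[OF g _ X cl[of "inv \<gamma>"]] g X by simp
    have "Cmp C X (aO \<gamma> X) X (\<xi> \<gamma>) ?k = Idt C X"
      using cocycle[of \<gamma> "inv \<gamma>"] g X one by simp
    moreover have "Cmp C (aO \<gamma> X) X (aO \<gamma> X) ?k (\<xi> \<gamma>) = Idt C (aO \<gamma> X)"
    proof -
      have c: "aM (inv \<gamma>) (aO \<gamma> X) X (\<xi> \<gamma>) \<in> mor C X (aO (inv \<gamma>) X)"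
        using aM_closed[of "inv \<gamma>", OF _ _ X cl[OF g]] g X by simp
      have "aM \<gamma> X (aO (inv \<gamma>) X) (aM (inv \<gamma>) (aO \<gamma> X) X (\<xi> \<gamma>)) = \<xi> \<gamma>"
        using aM_mult[OF g inv_closed[OF g] _ X cl[OF g]] g X cl[OF g] by simp
      then have "Cmp C (aO \<gamma> X) X (aO \<gamma> X) ?k (\<xi> \<gamma>) =
          aM \<gamma> X X (Cmp C X (aO (inv \<gamma>) X) X (\<xi> (inv \<gamma>)) (aM (inv \<gamma>) (aO \<gamma> X) X (\<xi> \<gamma>)))"
        using aM_Cmp[OF g X aO_closed X c cl] g X by simp
      also have "Cmp C X (aO (inv \<gamma>) X) X (\<xi> (inv \<gamma>)) (aM (inv \<gamma>) (aO \<gamma> X) X (\<xi> \<gamma>)) = Idt C X"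
        using cocycle[of "inv \<gamma>" \<gamma>] g X one by simp
      also have "aM \<gamma> X X (Idt C X) = Idt C (aO \<gamma> X)" using g X by simp
      finally show ?thesis .
    qed
    ultimately show ?thesis unfolding iso_mor_def using k cl[OF g] by blast
  qed
  then show ?thesis unfolding equivariant_category_def using assms by auto
qed

lemma EC_objD:
  assumes "A \<in> Obj EC"
  shows "fst A \<in> Obj C" "snd A \<in> extensional (carrier G)"
    and "\<And>\<gamma>. \<gamma> \<in> carrier G \<Longrightarrow> snd A \<gamma> \<in> mor C (aO \<gamma> (fst A)) (fst A)"
    and "snd A \<one> = Idt C (fst A)"
    and "\<And>\<alpha> \<beta>. \<lbrakk>\<alpha> \<in> carrier G; \<beta> \<in> carrier G\<rbrakk> \<Longrightarrow>
      Cmp C (aO (\<alpha> \<otimes> \<beta>) (fst A)) (aO \<alpha> (fst A)) (fst A) (snd A \<alpha>) (aM \<alpha> (aO \<beta> (fst A)) (fst A) (snd A \<beta>))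
       = snd A (\<alpha> \<otimes> \<beta>)"
proof -
  obtain X \<xi> where A: "A = (X, \<xi>)" by (cases A)
  show X: "fst A \<in> Obj C" and "snd A \<in> extensional (carrier G)"
    using assms unfolding equivariant_category_def A by auto
  show cl: "snd A \<gamma> \<in> mor C (aO \<gamma> (fst A)) (fst A)" if "\<gamma> \<in> carrier G" for \<gamma>
    using assms that unfolding equivariant_category_def A iso_mor_def by auto
  show cocycle: "Cmp C (aO (\<alpha> \<otimes> \<beta>) (fst A)) (aO \<alpha> (fst A)) (fst A) (snd A \<alpha>)
      (aM \<alpha> (aO \<beta> (fst A)) (fst A) (snd A \<beta>)) = snd A (\<alpha> \<otimes> \<beta>)"
    if "\<alpha> \<in> carrier G" "\<beta> \<in> carrier G" for \<alpha> \<beta>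
    using assms that unfolding equivariant_category_def A by auto
  have "\<forall>\<gamma> \<in> carrier G. iso_mor C (aO \<gamma> X) X (\<xi> \<gamma>)"
    using assms unfolding equivariant_category_def A by auto
  then have "iso_mor C (aO \<one> X) X (\<xi> \<one>)" by blast
  then obtain h where h: "h \<in> mor C X X" "Cmp C X X X h (\<xi> \<one>) = Idt C X"
    using X A unfolding iso_mor_def by auto
  have x1: "\<xi> \<one> \<in> mor C X X" using cl[of \<one>] X A by simp
  have "Cmp C X X X (\<xi> \<one>) (\<xi> \<one>) = \<xi> \<one>" using cocycle[of \<one> \<one>] x1 X A by simp
  then have "Cmp C X X X h (Cmp C X X X (\<xi> \<one>) (\<xi> \<one>)) = Cmp C X X X h (\<xi> \<one>)" by simp
  then show "snd A \<one> = Idt C (fst A)" using h x1 X A by (simp add: Cmp_assoc)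
qed

text \<open>The two sides of the square that defines equivariance: \<open>f : A \<rightarrow> B\<close> is equivariant iff
  \<open>twist_from A \<gamma> (fst B) f = twist_to B \<gamma> (fst A) f\<close> for all \<open>\<gamma>\<close>.\<close>

abbreviation twist_to :: "'o \<times> ('g \<Rightarrow> 'm) \<Rightarrow> 'g \<Rightarrow> 'o \<Rightarrow> 'm \<Rightarrow> 'm" where
  "twist_to B \<gamma> K f \<equiv> Cmp C (aO \<gamma> K) (aO \<gamma> (fst B)) (fst B) (snd B \<gamma>) (aM \<gamma> K (fst B) f)"

abbreviation twist_from :: "'o \<times> ('g \<Rightarrow> 'm) \<Rightarrow> 'g \<Rightarrow> 'o \<Rightarrow> 'm \<Rightarrow> 'm" where
  "twist_from B \<gamma> K b \<equiv> Cmp C (aO \<gamma> (fst B)) (fst B) K b (snd B \<gamma>)"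

text \<open>The inverse of \<open>\<xi>\<^sub>\<gamma>\<close>, which by the cocycle condition is \<open>\<gamma> (\<xi>\<^bsub>\<gamma>\<inverse>\<^esub>)\<close>.\<close>

definition inv_str :: "'o \<times> ('g \<Rightarrow> 'm) \<Rightarrow> 'g \<Rightarrow> 'm" where
  "inv_str A \<gamma> = aM \<gamma> (aO (inv \<gamma>) (fst A)) (fst A) (snd A (inv \<gamma>))"

text \<open>For equivariant objects \<open>(X, \<xi>)\<close> and \<open>(Y, \<eta>)\<close> the maps \<open>f \<mapsto> \<eta>\<^sub>\<gamma> \<circ> \<gamma> f \<circ> \<xi>\<^sub>\<gamma>\<inverse>\<close> form an action of \<open>G\<close>
  on the morphisms \<open>X \<rightarrow> Y\<close>, compatible with composition and addition, and
  the equivariant morphisms are its fixed points.\<close>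

definition conj_mor :: "'g \<Rightarrow> 'o \<times> ('g \<Rightarrow> 'm) \<Rightarrow> 'o \<times> ('g \<Rightarrow> 'm) \<Rightarrow> 'm \<Rightarrow> 'm" where
  "conj_mor \<gamma> A B h = Cmp C (fst A) (aO \<gamma> (fst A)) (fst B)
     (twist_to B \<gamma> (fst A) h) (inv_str A \<gamma>)"

lemma inv_str:
  assumes A: "A \<in> Obj EC" and g: "\<gamma> \<in> carrier G"
  shows "inv_str A \<gamma> \<in> mor C (fst A) (aO \<gamma> (fst A))"
    and "Cmp C (fst A) (aO \<gamma> (fst A)) (fst A) (snd A \<gamma>) (inv_str A \<gamma>) = Idt C (fst A)"
    and "Cmp C (aO \<gamma> (fst A)) (fst A) (aO \<gamma> (fst A)) (inv_str A \<gamma>) (snd A \<gamma>) = Idt C (aO \<gamma> (fst A))"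
proof -
  note D = EC_objD[OF A]
  note X = D(1)
  show 1: "inv_str A \<gamma> \<in> mor C (fst A) (aO \<gamma> (fst A))"
    unfolding inv_str_def using aM_closed[OF g _ X D(3)[of "inv \<gamma>"]] g X by simp
  show 2: "Cmp C (fst A) (aO \<gamma> (fst A)) (fst A) (snd A \<gamma>) (inv_str A \<gamma>) = Idt C (fst A)"
    unfolding inv_str_def using D(5)[OF g inv_closed[OF g]] D(4) g X by simp
  have "iso_mor C (aO \<gamma> (fst A)) (fst A) (snd A \<gamma>)"
    using A g unfolding equivariant_category_def by auto
  then obtain h where h: "h \<in> mor C (fst A) (aO \<gamma> (fst A))"
    "Cmp C (aO \<gamma> (fst A)) (fst A) (aO \<gamma> (fst A)) h (snd A \<gamma>) = Idt C (aO \<gamma> (fst A))"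
    unfolding iso_mor_def by auto
  have "Cmp C (fst A) (fst A) (aO \<gamma> (fst A)) h
      (Cmp C (fst A) (aO \<gamma> (fst A)) (fst A) (snd A \<gamma>) (inv_str A \<gamma>)) = inv_str A \<gamma>"
    using h 1 D(3)[OF g] X g by (simp add: Cmp_assoc)
  then have "h = inv_str A \<gamma>" using 2 h X g by simp
  then show "Cmp C (aO \<gamma> (fst A)) (fst A) (aO \<gamma> (fst A)) (inv_str A \<gamma>) (snd A \<gamma>) = Idt C (aO \<gamma> (fst A))"
    using h by simp
qed

lemma conj_closed [simp]:
  "\<lbrakk>A \<in> Obj EC; B \<in> Obj EC; \<gamma> \<in> carrier G; h \<in> mor C (fst A) (fst B)\<rbrakk>
    \<Longrightarrow> conj_mor \<gamma> A B h \<in> mor C (fst A) (fst B)"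
  unfolding conj_mor_def using inv_str(1)[of A \<gamma>] EC_objD(1)[of A] EC_objD(1,3)[of B] by simp

lemma conj_eq_iff:
  assumes A: "A \<in> Obj EC" and B: "B \<in> Obj EC" and g: "\<gamma> \<in> carrier G"
    and h: "h \<in> mor C (fst A) (fst B)" and k: "k \<in> mor C (fst A) (fst B)"
  shows "conj_mor \<gamma> A B h = k \<longleftrightarrow>
    twist_from A \<gamma> (fst B) k = twist_to B \<gamma> (fst A) h"
    (is "_ \<longleftrightarrow> ?l = ?r")
proof
  note X = EC_objD(1)[OF A] and Y = EC_objD(1)[OF B] and x = EC_objD(3)[OF A g] and y = EC_objD(3)[OF B g]
  note I = inv_str[OF A g]
  note [simp] = X Y x y g h k I(1)
  { assume "conj_mor \<gamma> A B h = k"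
    then have "?l = twist_from A \<gamma> (fst B) (conj_mor \<gamma> A B h)" by simp
    also have "\<dots> = ?r" unfolding conj_mor_def using I(3) by (simp flip: Cmp_assoc[of "aO \<gamma> (fst A)" "fst A"])
    finally show "?l = ?r" . }
  { assume eq: "?l = ?r"
    show "conj_mor \<gamma> A B h = k"
      unfolding conj_mor_def eq[symmetric] using I(2) by (simp flip: Cmp_assoc) }
qed


lemma conj_square:
  assumes "A \<in> Obj EC" "B \<in> Obj EC" "\<gamma> \<in> carrier G" "h \<in> mor C (fst A) (fst B)"
  shows "twist_from A \<gamma> (fst B) (conj_mor \<gamma> A B h) = twist_to B \<gamma> (fst A) h"
  using conj_eq_iff[OF assms conj_closed[OF assms]] by simp

lemma Cmp_EC [simp]: "Cmp EC A B D = Cmp C (fst A) (fst B) (fst D)"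
  unfolding equivariant_category_def by (simp add: case_prod_beta)

lemma Idt_EC [simp]: "Idt EC A = Idt C (fst A)"
  unfolding equivariant_category_def by (simp add: case_prod_beta)

lemma zero_EC [simp]: "zero_mor EC A B = zero_mor C (fst A) (fst B)"
  unfolding equivariant_category_def by (simp add: case_prod_beta)

lemma add_EC [simp]: "f \<oplus>\<^bsub>Hom EC A B\<^esub> g = f \<oplus>\<^bsub>Hom C (fst A) (fst B)\<^esub> g"
  unfolding equivariant_category_def by (simp add: case_prod_beta)

lemma mor_EC_square:
  "f \<in> mor EC A B \<longleftrightarrow> f \<in> mor C (fst A) (fst B) \<and> (\<forall>\<gamma> \<in> carrier G.
     twist_from A \<gamma> (fst B) f = twist_to B \<gamma> (fst A) f)"
  unfolding equivariant_category_def by (simp add: case_prod_beta)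

lemma mor_EC_iff:
  assumes "A \<in> Obj EC" "B \<in> Obj EC"
  shows "f \<in> mor EC A B \<longleftrightarrow> f \<in> mor C (fst A) (fst B) \<and> (\<forall>\<gamma> \<in> carrier G. conj_mor \<gamma> A B f = f)"
  unfolding mor_EC_square using conj_eq_iff[OF assms] by blast

lemma EC_mor: "f \<in> mor EC A B \<Longrightarrow> f \<in> mor C (fst A) (fst B)"
  unfolding mor_EC_square by simp

lemma conj_fixed: "\<lbrakk>A \<in> Obj EC; B \<in> Obj EC; f \<in> mor EC A B; \<gamma> \<in> carrier G\<rbrakk> \<Longrightarrow> conj_mor \<gamma> A B f = f"
  by (simp add: mor_EC_iff)

lemma conj_Cmp:
  assumes A: "A \<in> Obj EC" and B: "B \<in> Obj EC" and D: "D \<in> Obj EC" and g: "\<gamma> \<in> carrier G"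
    and h: "h \<in> mor C (fst A) (fst B)" and k: "k \<in> mor C (fst B) (fst D)"
  shows "conj_mor \<gamma> A D (Cmp C (fst A) (fst B) (fst D) k h) =
    Cmp C (fst A) (fst B) (fst D) (conj_mor \<gamma> B D k) (conj_mor \<gamma> A B h)"
proof -
  note [simp] = EC_objD(1)[OF A] EC_objD(1)[OF B] EC_objD(1)[OF D]
    EC_objD(3)[OF A g] EC_objD(3)[OF B g] EC_objD(3)[OF D g] g h k
    inv_str(1)[OF A g] inv_str(1)[OF B g]
  note 1 = conj_square[OF B D g k] and 2 = conj_square[OF A B g h]
  have "twist_from A \<gamma> (fst D) (Cmp C (fst A) (fst B) (fst D) (conj_mor \<gamma> B D k) (conj_mor \<gamma> A B h)) =
     Cmp C (aO \<gamma> (fst A)) (aO \<gamma> (fst B)) (fst D)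
       (twist_from B \<gamma> (fst D) (conj_mor \<gamma> B D k)) (aM \<gamma> (fst A) (fst B) h)"
    using 2 A B D by (simp flip: Cmp_assoc)
  also have "\<dots> = twist_to D \<gamma> (fst A) (Cmp C (fst A) (fst B) (fst D) k h)"
    unfolding 1 by (simp add: aM_Cmp Cmp_assoc)
  finally show ?thesis
    using conj_eq_iff[OF A D g] A B D by simp
qed

lemma conj_Idt: "\<lbrakk>A \<in> Obj EC; \<gamma> \<in> carrier G\<rbrakk> \<Longrightarrow> conj_mor \<gamma> A A (Idt C (fst A)) = Idt C (fst A)"
  using conj_eq_iff[of A A \<gamma> "Idt C (fst A)" "Idt C (fst A)"] EC_objD(1,3)[of A] by simp

lemma conj_one: "\<lbrakk>A \<in> Obj EC; B \<in> Obj EC; h \<in> mor C (fst A) (fst B)\<rbrakk> \<Longrightarrow> conj_mor \<one> A B h = h"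
  using conj_eq_iff[of A B \<one> h h] EC_objD(1,4)[of A] EC_objD(1,4)[of B] by simp

lemma conj_mult:
  assumes A: "A \<in> Obj EC" and B: "B \<in> Obj EC" and g: "\<alpha> \<in> carrier G" "\<beta> \<in> carrier G"
    and h: "h \<in> mor C (fst A) (fst B)"
  shows "conj_mor (\<alpha> \<otimes> \<beta>) A B h = conj_mor \<alpha> A B (conj_mor \<beta> A B h)"
proof -
  let ?h = "conj_mor \<beta> A B h" let ?k = "conj_mor \<alpha> A B ?h"
  have h': "?h \<in> mor C (fst A) (fst B)" using A B g h by simp
  have k: "?k \<in> mor C (fst A) (fst B)" using A B g h by simp
  note X = EC_objD(1)[OF A] and Y = EC_objD(1)[OF B]
  have cl: "aM \<alpha> (aO \<beta> (fst A)) (fst A) (snd A \<beta>) \<in> mor C (aO (\<alpha> \<otimes> \<beta>) (fst A)) (aO \<alpha> (fst A))"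
    "aM \<alpha> (aO \<beta> (fst B)) (fst B) (snd B \<beta>) \<in> mor C (aO (\<alpha> \<otimes> \<beta>) (fst B)) (aO \<alpha> (fst B))"
    using aM_closed[OF g(1) _ X EC_objD(3)[OF A g(2)]] aM_closed[OF g(1) _ Y EC_objD(3)[OF B g(2)]] X Y g
    by simp_all
  note [simp] = X Y g h h' k cl EC_objD(3)[OF A] EC_objD(3)[OF B]
  note 1 = conj_square[OF A B g(2) h] and 2 = conj_square[OF A B g(1) h']
  let ?ab = "\<alpha> \<otimes> \<beta>"
  have "twist_from A ?ab (fst B) ?k =
      Cmp C (aO ?ab (fst A)) (aO \<alpha> (fst A)) (fst B) (twist_from A \<alpha> (fst B) ?k)
        (aM \<alpha> (aO \<beta> (fst A)) (fst A) (snd A \<beta>))"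
    by (simp add: EC_objD(5)[OF A g, symmetric] Cmp_assoc)
  also have "\<dots> = Cmp C (aO ?ab (fst A)) (aO \<alpha> (fst B)) (fst B) (snd B \<alpha>)
      (Cmp C (aO ?ab (fst A)) (aO \<alpha> (fst A)) (aO \<alpha> (fst B))
        (aM \<alpha> (fst A) (fst B) ?h) (aM \<alpha> (aO \<beta> (fst A)) (fst A) (snd A \<beta>)))"
    unfolding 2 by (simp add: Cmp_assoc)
  also have "Cmp C (aO ?ab (fst A)) (aO \<alpha> (fst A)) (aO \<alpha> (fst B))
        (aM \<alpha> (fst A) (fst B) ?h) (aM \<alpha> (aO \<beta> (fst A)) (fst A) (snd A \<beta>)) =
      aM \<alpha> (aO \<beta> (fst A)) (fst B) (twist_from A \<beta> (fst B) ?h)"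
    by (simp add: aM_Cmp)
  also have "\<dots> = Cmp C (aO ?ab (fst A)) (aO ?ab (fst B)) (aO \<alpha> (fst B))
      (aM \<alpha> (aO \<beta> (fst B)) (fst B) (snd B \<beta>)) (aM ?ab (fst A) (fst B) h)"
    unfolding 1 by (simp add: aM_Cmp)
  also have "Cmp C (aO ?ab (fst A)) (aO \<alpha> (fst B)) (fst B) (snd B \<alpha>) \<dots> = twist_to B ?ab (fst A) h"
    by (simp add: EC_objD(5)[OF B g, symmetric] Cmp_assoc)
  finally show ?thesis using conj_eq_iff[OF A B _ h k, of ?ab] by simp
qed

lemma conj_add:
  assumes A: "A \<in> Obj EC" and B: "B \<in> Obj EC" and g: "\<gamma> \<in> carrier G"
    and h: "h \<in> mor C (fst A) (fst B)" "k \<in> mor C (fst A) (fst B)"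
  shows "conj_mor \<gamma> A B (h \<oplus>\<^bsub>Hom C (fst A) (fst B)\<^esub> k) =
    conj_mor \<gamma> A B h \<oplus>\<^bsub>Hom C (fst A) (fst B)\<^esub> conj_mor \<gamma> A B k"
  unfolding conj_mor_def
  using assms EC_objD(1)[OF A] EC_objD(1)[OF B] EC_objD(3)[OF B g] inv_str(1)[OF A g]
  by (simp add: aM_add Cmp_add_left Cmp_add_right)

lemma conj_zero:
  assumes A: "A \<in> Obj EC" and B: "B \<in> Obj EC" and g: "\<gamma> \<in> carrier G"
  shows "conj_mor \<gamma> A B (zero_mor C (fst A) (fst B)) = zero_mor C (fst A) (fst B)"
  unfolding conj_mor_def
  using assms EC_objD(1)[OF A] EC_objD(1)[OF B] EC_objD(3)[OF B g] inv_str(1)[OF A g] by simp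

end

lemma abelian_group_restrict_carrier:
  fixes A :: "'m ring"
  assumes "abelian_group A" and S: "S \<subseteq> carrier A" "\<zero>\<^bsub>A\<^esub> \<in> S"
    "\<And>x y. \<lbrakk>x \<in> S; y \<in> S\<rbrakk> \<Longrightarrow> x \<oplus>\<^bsub>A\<^esub> y \<in> S" "\<And>x. x \<in> S \<Longrightarrow> \<ominus>\<^bsub>A\<^esub> x \<in> S"
  shows "abelian_group (A\<lparr>carrier := S\<rparr>)"
proof -
  interpret A: abelian_group A by fact
  show ?thesis
  proof (rule abelian_groupI)
    fix x assume "x \<in> carrier (A\<lparr>carrier := S\<rparr>)"
    then show "\<exists>y \<in> carrier (A\<lparr>carrier := S\<rparr>). y \<oplus>\<^bsub>A\<lparr>carrier := S\<rparr>\<^esub> x = \<zero>\<^bsub>A\<lparr>carrier := S\<rparr>\<^esub>"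
      using S by (intro bexI[of _ "\<ominus>\<^bsub>A\<^esub> x"]) (auto simp: A.l_neg)
  qed (use S A.a_assoc A.a_comm in \<open>auto simp: subset_eq\<close>)
qed

context strict_action
begin

lemma EC_preadditive: "preadditive_category EC"
proof (rule preadditive_category.intro)
  fix A B assume A: "A \<in> Obj EC" and B: "B \<in> Obj EC"
  note X = EC_objD(1)[OF A] and Y = EC_objD(1)[OF B]
  interpret H: abelian_group "Hom C (fst A) (fst B)" by (rule Hom_abelian_group[OF X Y])
  have "\<ominus>\<^bsub>Hom C (fst A) (fst B)\<^esub> f \<in> mor EC A B" if f: "f \<in> mor EC A B" for f
  proof -
    let ?f = "\<ominus>\<^bsub>Hom C (fst A) (fst B)\<^esub> f"
    have fC: "f \<in> mor C (fst A) (fst B)" using f by (rule EC_mor)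
    have "conj_mor \<gamma> A B ?f = ?f" if g: "\<gamma> \<in> carrier G" for \<gamma>
    proof -
      have "conj_mor \<gamma> A B (?f \<oplus>\<^bsub>Hom C (fst A) (fst B)\<^esub> f) = conj_mor \<gamma> A B ?f \<oplus>\<^bsub>Hom C (fst A) (fst B)\<^esub> f"
        using conj_add[OF A B g _ fC, of ?f] conj_fixed[OF A B f g] fC X Y by simp
      then have "conj_mor \<gamma> A B ?f \<oplus>\<^bsub>Hom C (fst A) (fst B)\<^esub> f = zero_mor C (fst A) (fst B)"
        using conj_zero[OF A B g] H.l_neg[OF fC] by simp
      then show ?thesis
        using H.minus_equality[of "conj_mor \<gamma> A B ?f" f] fC A B X Y g by simp
    qed
    then show ?thesis using fC X Y by (simp add: mor_EC_iff[OF A B])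
  qed
  then have "abelian_group ((Hom C (fst A) (fst B))\<lparr>carrier := mor EC A B\<rparr>)"
    using conj_zero[OF A B] conj_add[OF A B] X Y
    by (intro abelian_group_restrict_carrier H.abelian_group_axioms) (auto simp: mor_EC_iff[OF A B])
  moreover have "(Hom C (fst A) (fst B))\<lparr>carrier := mor EC A B\<rparr> = Hom EC A B"
    unfolding equivariant_category_def by (simp add: case_prod_beta)
  ultimately show "abelian_group (Hom EC A B)" by simp
next
  fix A assume A: "A \<in> Obj EC"
  then show "Idt EC A \<in> mor EC A A"
    using EC_objD(1)[OF A] by (simp add: mor_EC_iff conj_Idt)
next
  fix A B D f g assume *: "A \<in> Obj EC" "B \<in> Obj EC" "D \<in> Obj EC" "f \<in> mor EC A B" "g \<in> mor EC B D"
  then show "Cmp EC A B D g f \<in> mor EC A D"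
    using EC_objD(1)[of A] EC_objD(1)[of B] EC_objD(1)[of D] by (simp add: mor_EC_iff conj_Cmp)
qed (use EC_objD(1) EC_mor in \<open>auto simp: Cmp_assoc Cmp_add_left Cmp_add_right\<close>)

sublocale EC: preadditive_category EC
  by (rule EC_preadditive)

text \<open>Conjugation fixes the maps \<open>f\<close> in \<open>M\<close> and the composites \<open>f \<circ> k\<close>. So \<open>k\<close> and its conjugates
  have the same composites with all \<open>f\<close>, and they agree as the \<open>f\<close> are jointly monic. This makes
  the factorizations given by universal properties of \<open>C\<close> equivariant; the next lemma is the dual
  for jointly epic families.\<close>

lemma EC_mor_into:
  assumes T: "T \<in> Obj EC" and K: "K \<in> Obj EC" and k: "k \<in> mor C (fst T) (fst K)"
    and M: "\<And>B f. (B, f) \<in> M \<Longrightarrow> B \<in> Obj EC \<and> f \<in> mor EC K B \<and>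
      Cmp C (fst T) (fst K) (fst B) f k \<in> mor EC T B"
    and cancel: "\<And>k k'. \<lbrakk>k \<in> mor C (fst T) (fst K); k' \<in> mor C (fst T) (fst K);
       \<And>B f. (B, f) \<in> M \<Longrightarrow> Cmp C (fst T) (fst K) (fst B) f k = Cmp C (fst T) (fst K) (fst B) f k'\<rbrakk>
       \<Longrightarrow> k = k'"
  shows "k \<in> mor EC T K"
proof -
  have "conj_mor \<gamma> T K k = k" if g: "\<gamma> \<in> carrier G" for \<gamma>
  proof (rule cancel)
    fix B f assume "(B, f) \<in> M"
    from M[OF this] have B: "B \<in> Obj EC" "f \<in> mor EC K B" "Cmp C (fst T) (fst K) (fst B) f k \<in> mor EC T B"
      by auto
    show "Cmp C (fst T) (fst K) (fst B) f (conj_mor \<gamma> T K k) = Cmp C (fst T) (fst K) (fst B) f k"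
      using conj_Cmp[OF T K B(1) g k EC_mor[OF B(2)]] conj_fixed[OF T B(1,3) g] conj_fixed[OF K B(1,2) g]
      by simp
  qed (use T K k g in auto)
  then show ?thesis using k by (simp add: mor_EC_iff[OF T K])
qed

lemma EC_mor_from:
  assumes T: "T \<in> Obj EC" and K: "K \<in> Obj EC" and k: "k \<in> mor C (fst K) (fst T)"
    and M: "\<And>B f. (B, f) \<in> M \<Longrightarrow> B \<in> Obj EC \<and> f \<in> mor EC B K \<and>
      Cmp C (fst B) (fst K) (fst T) k f \<in> mor EC B T"
    and cancel: "\<And>k k'. \<lbrakk>k \<in> mor C (fst K) (fst T); k' \<in> mor C (fst K) (fst T);
       \<And>B f. (B, f) \<in> M \<Longrightarrow> Cmp C (fst B) (fst K) (fst T) k f = Cmp C (fst B) (fst K) (fst T) k' f\<rbrakk>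
       \<Longrightarrow> k = k'"
  shows "k \<in> mor EC K T"
proof -
  have "conj_mor \<gamma> K T k = k" if g: "\<gamma> \<in> carrier G" for \<gamma>
  proof (rule cancel)
    fix B f assume "(B, f) \<in> M"
    from M[OF this] have B: "B \<in> Obj EC" "f \<in> mor EC B K" "Cmp C (fst B) (fst K) (fst T) k f \<in> mor EC B T"
      by auto
    show "Cmp C (fst B) (fst K) (fst T) (conj_mor \<gamma> K T k) f = Cmp C (fst B) (fst K) (fst T) k f"
      using conj_Cmp[OF B(1) K T g EC_mor[OF B(2)] k] conj_fixed[OF B(1) T B(3) g] conj_fixed[OF B(1) K B(2) g]
      by simp
  qed (use T K k g in auto)
  then show ?thesis using k by (simp add: mor_EC_iff[OF K T])
qed

text \<open>Maps \<open>\<kappa>\<^sub>\<gamma>\<close> that are compatible with a jointly monic family into equivariant objects satisfy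
  the cocycle condition automatically: both sides have the same composites with every member
  of the family, as the condition holds in the targets.\<close>

lemma EC_obj_of_jointly_monic:
  assumes K: "K \<in> Obj C"
    and cl: "\<And>\<gamma>. \<gamma> \<in> carrier G \<Longrightarrow> \<kappa> \<gamma> \<in> mor C (aO \<gamma> K) K"
    and M: "\<And>B f. (B, f) \<in> M \<Longrightarrow> B \<in> Obj EC \<and> f \<in> mor C K (fst B)"
    and eq: "\<And>B f \<gamma>. \<lbrakk>(B, f) \<in> M; \<gamma> \<in> carrier G\<rbrakk> \<Longrightarrow> Cmp C (aO \<gamma> K) K (fst B) f (\<kappa> \<gamma>) =
       twist_to B \<gamma> K f"
    and cancel: "\<And>T k k'. \<lbrakk>T \<in> Obj C; k \<in> mor C T K; k' \<in> mor C T K;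
       \<And>B f. (B, f) \<in> M \<Longrightarrow> Cmp C T K (fst B) f k = Cmp C T K (fst B) f k'\<rbrakk> \<Longrightarrow> k = k'"
  shows "(K, restrict \<kappa> (carrier G)) \<in> Obj EC"
    and "(B, f) \<in> M \<Longrightarrow> f \<in> mor EC (K, restrict \<kappa> (carrier G)) B"
proof -
  show "(K, restrict \<kappa> (carrier G)) \<in> Obj EC"
  proof (rule EC_objI)
    show "restrict \<kappa> (carrier G) \<one> = Idt C K"
    proof (rule cancel[of K])
      fix B f assume B: "(B, f) \<in> M"
      then show "Cmp C K K (fst B) f (restrict \<kappa> (carrier G) \<one>) = Cmp C K K (fst B) f (Idt C K)"
        using eq[OF B, of \<one>] M[OF B] EC_objD(1,4)[of B] K by simp
    qed (use K cl[of \<one>] in auto)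
  next
    fix \<alpha> \<beta> assume g: "\<alpha> \<in> carrier G" "\<beta> \<in> carrier G"
    have c: "aM \<alpha> (aO \<beta> K) K (\<kappa> \<beta>) \<in> mor C (aO (\<alpha> \<otimes> \<beta>) K) (aO \<alpha> K)"
      using aM_closed[OF g(1) _ K cl[OF g(2)]] g K by simp
    have "\<kappa> (\<alpha> \<otimes> \<beta>) = Cmp C (aO (\<alpha> \<otimes> \<beta>) K) (aO \<alpha> K) K (\<kappa> \<alpha>) (aM \<alpha> (aO \<beta> K) K (\<kappa> \<beta>))"
    proof (rule cancel[of "aO (\<alpha> \<otimes> \<beta>) K"])
      fix B f assume B: "(B, f) \<in> M"
      from M[OF B] have B': "B \<in> Obj EC" and f: "f \<in> mor C K (fst B)" by auto
      note D = EC_objD[OF B']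
      have c': "aM \<alpha> (aO \<beta> (fst B)) (fst B) (snd B \<beta>) \<in> mor C (aO (\<alpha> \<otimes> \<beta>) (fst B)) (aO \<alpha> (fst B))"
        using aM_closed[OF g(1) _ D(1) D(3)[OF g(2)]] g D(1) by simp
      note [simp] = g K c c' f D(1,3) cl
      let ?ab = "\<alpha> \<otimes> \<beta>"
      have "Cmp C (aO ?ab K) K (fst B) f (\<kappa> ?ab) = twist_to B ?ab K f"
        using eq[OF B] by simp
      also have "\<dots> = Cmp C (aO ?ab K) (aO \<alpha> (fst B)) (fst B) (snd B \<alpha>)
         (Cmp C (aO ?ab K) (aO ?ab (fst B)) (aO \<alpha> (fst B))
           (aM \<alpha> (aO \<beta> (fst B)) (fst B) (snd B \<beta>)) (aM ?ab K (fst B) f))"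
        by (simp add: D(5)[OF g, symmetric] Cmp_assoc)
      also have "Cmp C (aO ?ab K) (aO ?ab (fst B)) (aO \<alpha> (fst B))
           (aM \<alpha> (aO \<beta> (fst B)) (fst B) (snd B \<beta>)) (aM ?ab K (fst B) f) =
         aM \<alpha> (aO \<beta> K) (fst B) (twist_to B \<beta> K f)"
        by (simp add: aM_Cmp)
      also have "\<dots> = Cmp C (aO ?ab K) (aO \<alpha> K) (aO \<alpha> (fst B)) (aM \<alpha> K (fst B) f) (aM \<alpha> (aO \<beta> K) K (\<kappa> \<beta>))"
        by (simp flip: eq[OF B g(2)]) (simp add: aM_Cmp)
      also have "Cmp C (aO ?ab K) (aO \<alpha> (fst B)) (fst B) (snd B \<alpha>) \<dots> =
         Cmp C (aO ?ab K) (aO \<alpha> K) (fst B) (Cmp C (aO \<alpha> K) K (fst B) f (\<kappa> \<alpha>)) (aM \<alpha> (aO \<beta> K) K (\<kappa> \<beta>))"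
        using eq[OF B g(1)] by (simp add: Cmp_assoc)
      finally show "Cmp C (aO ?ab K) K (fst B) f (\<kappa> ?ab) = Cmp C (aO ?ab K) K (fst B) f
          (Cmp C (aO ?ab K) (aO \<alpha> K) K (\<kappa> \<alpha>) (aM \<alpha> (aO \<beta> K) K (\<kappa> \<beta>)))"
        by (simp add: Cmp_assoc)
    qed (use g K cl c in auto)
    then show "restrict \<kappa> (carrier G) (\<alpha> \<otimes> \<beta>) = Cmp C (aO (\<alpha> \<otimes> \<beta>) K) (aO \<alpha> K) K
        (restrict \<kappa> (carrier G) \<alpha>) (aM \<alpha> (aO \<beta> K) K (restrict \<kappa> (carrier G) \<beta>))"
      using g by simp
  qed (use K cl in auto)
  show "(B, f) \<in> M \<Longrightarrow> f \<in> mor EC (K, restrict \<kappa> (carrier G)) B"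
    using M eq unfolding mor_EC_square by auto
qed

lemma aM_mult_inv:
  assumes g: "\<gamma> \<in> carrier G" and X: "X \<in> Obj C" and Y: "Y \<in> Obj C" and f: "f \<in> mor C (aO \<gamma> X) Y"
  shows "aM (inv \<gamma>) (aO \<gamma> X) Y f \<in> mor C X (aO (inv \<gamma>) Y)" (is ?P)
    and "aM \<gamma> X (aO (inv \<gamma>) Y) (aM (inv \<gamma>) (aO \<gamma> X) Y f) = f" (is ?Q)
proof -
  show ?P
    using aM_closed[OF inv_closed[OF g] aO_closed[OF g X] Y f] g X by simp
  show ?Q
    using aM_mult[OF g inv_closed[OF g] aO_closed[OF g X] Y f] g X Y f by simp
qed

text \<open>The dual statement needs that the maps \<open>\<gamma> f\<close> are jointly epic too, which holds because
  \<open>\<gamma>\<close> acts by an automorphism of \<open>C\<close>.\<close>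

lemma EC_obj_of_jointly_epic:
  assumes K: "K \<in> Obj C"
    and cl: "\<And>\<gamma>. \<gamma> \<in> carrier G \<Longrightarrow> \<kappa> \<gamma> \<in> mor C (aO \<gamma> K) K"
    and M: "\<And>B f. (B, f) \<in> M \<Longrightarrow> B \<in> Obj EC \<and> f \<in> mor C (fst B) K"
    and eq: "\<And>B f \<gamma>. \<lbrakk>(B, f) \<in> M; \<gamma> \<in> carrier G\<rbrakk> \<Longrightarrow>
       Cmp C (aO \<gamma> (fst B)) (aO \<gamma> K) K (\<kappa> \<gamma>) (aM \<gamma> (fst B) K f) = twist_from B \<gamma> K f"
    and cancel: "\<And>T k k'. \<lbrakk>T \<in> Obj C; k \<in> mor C K T; k' \<in> mor C K T;
       \<And>B f. (B, f) \<in> M \<Longrightarrow> Cmp C (fst B) K T k f = Cmp C (fst B) K T k' f\<rbrakk> \<Longrightarrow> k = k'"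
  shows "(K, restrict \<kappa> (carrier G)) \<in> Obj EC"
    and "(B, f) \<in> M \<Longrightarrow> f \<in> mor EC B (K, restrict \<kappa> (carrier G))"
proof -
  have cancel': "k = k'" if T: "\<gamma> \<in> carrier G" "T \<in> Obj C" "k \<in> mor C (aO \<gamma> K) T" "k' \<in> mor C (aO \<gamma> K) T"
    and e: "\<And>B f. (B, f) \<in> M \<Longrightarrow> Cmp C (aO \<gamma> (fst B)) (aO \<gamma> K) T k (aM \<gamma> (fst B) K f) =
       Cmp C (aO \<gamma> (fst B)) (aO \<gamma> K) T k' (aM \<gamma> (fst B) K f)" for \<gamma> T k k'
  proof -
    note a = aM_mult_inv[OF T(1) K T(2) T(3)] and a' = aM_mult_inv[OF T(1) K T(2) T(4)]
    have "aM (inv \<gamma>) (aO \<gamma> K) T k = aM (inv \<gamma>) (aO \<gamma> K) T k'"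
    proof (rule cancel[of "aO (inv \<gamma>) T"])
      fix B f assume B: "(B, f) \<in> M"
      from M[OF B] have B': "fst B \<in> Obj C" and f: "f \<in> mor C (fst B) K" using EC_objD(1) by auto
      have *: "aM (inv \<gamma>) (aO \<gamma> (fst B)) T (Cmp C (aO \<gamma> (fst B)) (aO \<gamma> K) T h (aM \<gamma> (fst B) K f)) =
         Cmp C (fst B) K (aO (inv \<gamma>) T) (aM (inv \<gamma>) (aO \<gamma> K) T h) f"
        if "h \<in> mor C (aO \<gamma> K) T" for h
      proof -
        have "aM (inv \<gamma>) (aO \<gamma> (fst B)) (aO \<gamma> K) (aM \<gamma> (fst B) K f) = f"
          using T(1) B' f K by simp
        then show ?thesis using that T(1,2) B' f K
          aM_Cmp[of "inv \<gamma>" "aO \<gamma> (fst B)" "aO \<gamma> K" T "aM \<gamma> (fst B) K f" h] by simp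
      qed
      show "Cmp C (fst B) K (aO (inv \<gamma>) T) (aM (inv \<gamma>) (aO \<gamma> K) T k) f =
          Cmp C (fst B) K (aO (inv \<gamma>) T) (aM (inv \<gamma>) (aO \<gamma> K) T k') f"
        using *[OF T(3)] *[OF T(4)] e[OF B] by simp
    qed (use a(1) a'(1) T in auto)
    then show ?thesis using a(2) a'(2) by metis
  qed
  show "(K, restrict \<kappa> (carrier G)) \<in> Obj EC"
  proof (rule EC_objI)
    show "restrict \<kappa> (carrier G) \<one> = Idt C K"
    proof (rule cancel[of K])
      fix B f assume B: "(B, f) \<in> M"
      then show "Cmp C (fst B) K K (restrict \<kappa> (carrier G) \<one>) f = Cmp C (fst B) K K (Idt C K) f"
        using eq[OF B, of \<one>] M[OF B] EC_objD(1,4)[of B] K by simp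
    qed (use K cl[of \<one>] in auto)
  next
    fix \<alpha> \<beta> assume g: "\<alpha> \<in> carrier G" "\<beta> \<in> carrier G"
    have c: "aM \<alpha> (aO \<beta> K) K (\<kappa> \<beta>) \<in> mor C (aO (\<alpha> \<otimes> \<beta>) K) (aO \<alpha> K)"
      using aM_closed[OF g(1) _ K cl[OF g(2)]] g K by simp
    have "\<kappa> (\<alpha> \<otimes> \<beta>) = Cmp C (aO (\<alpha> \<otimes> \<beta>) K) (aO \<alpha> K) K (\<kappa> \<alpha>) (aM \<alpha> (aO \<beta> K) K (\<kappa> \<beta>))"
    proof (rule cancel'[of "\<alpha> \<otimes> \<beta>" K])
      fix B f assume B: "(B, f) \<in> M"
      from M[OF B] have B': "B \<in> Obj EC" and f: "f \<in> mor C (fst B) K" by auto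
      note D = EC_objD[OF B']
      have c': "aM \<alpha> (aO \<beta> (fst B)) (fst B) (snd B \<beta>) \<in> mor C (aO (\<alpha> \<otimes> \<beta>) (fst B)) (aO \<alpha> (fst B))"
        using aM_closed[OF g(1) _ D(1) D(3)[OF g(2)]] g D(1) by simp
      note [simp] = g K c c' f D(1,3) cl
      let ?ab = "\<alpha> \<otimes> \<beta>"
      have "Cmp C (aO ?ab (fst B)) (aO ?ab K) K (\<kappa> ?ab) (aM ?ab (fst B) K f) =
          twist_from B ?ab K f"
        using eq[OF B] by simp
      also have "\<dots> = Cmp C (aO ?ab (fst B)) (aO \<alpha> (fst B)) K
          (twist_from B \<alpha> K f) (aM \<alpha> (aO \<beta> (fst B)) (fst B) (snd B \<beta>))"
        by (simp add: D(5)[OF g, symmetric] Cmp_assoc)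
      also have "\<dots> = Cmp C (aO ?ab (fst B)) (aO \<alpha> K) K (\<kappa> \<alpha>)
          (Cmp C (aO ?ab (fst B)) (aO \<alpha> (fst B)) (aO \<alpha> K) (aM \<alpha> (fst B) K f)
            (aM \<alpha> (aO \<beta> (fst B)) (fst B) (snd B \<beta>)))"
        by (simp add: Cmp_assoc flip: eq[OF B g(1)])
      also have "Cmp C (aO ?ab (fst B)) (aO \<alpha> (fst B)) (aO \<alpha> K) (aM \<alpha> (fst B) K f)
            (aM \<alpha> (aO \<beta> (fst B)) (fst B) (snd B \<beta>)) =
          aM \<alpha> (aO \<beta> (fst B)) K (twist_from B \<beta> K f)"
        by (simp add: aM_Cmp)
      also have "\<dots> = Cmp C (aO ?ab (fst B)) (aO ?ab K) (aO \<alpha> K) (aM \<alpha> (aO \<beta> K) K (\<kappa> \<beta>)) (aM ?ab (fst B) K f)"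
        by (simp flip: eq[OF B g(2)]) (simp add: aM_Cmp)
      finally show "Cmp C (aO ?ab (fst B)) (aO ?ab K) K (\<kappa> ?ab) (aM ?ab (fst B) K f) =
        Cmp C (aO ?ab (fst B)) (aO ?ab K) K
          (Cmp C (aO ?ab K) (aO \<alpha> K) K (\<kappa> \<alpha>) (aM \<alpha> (aO \<beta> K) K (\<kappa> \<beta>))) (aM ?ab (fst B) K f)"
        by (simp add: Cmp_assoc)
    qed (use g K cl c in auto)
    then show "restrict \<kappa> (carrier G) (\<alpha> \<otimes> \<beta>) = Cmp C (aO (\<alpha> \<otimes> \<beta>) K) (aO \<alpha> K) K
        (restrict \<kappa> (carrier G) \<alpha>) (aM \<alpha> (aO \<beta> K) K (restrict \<kappa> (carrier G) \<beta>))"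
      using g by simp
  qed (use K cl in auto)
  show "(B, f) \<in> M \<Longrightarrow> f \<in> mor EC B (K, restrict \<kappa> (carrier G))"
    using M eq unfolding mor_EC_square by auto
qed

lemma EC_structure_monic:
  assumes K: "K \<in> Obj C"
    and M: "\<And>B f. (B, f) \<in> M \<Longrightarrow> B \<in> Obj EC \<and> f \<in> mor C K (fst B)"
    and cancel: "\<And>T k k'. \<lbrakk>T \<in> Obj C; k \<in> mor C T K; k' \<in> mor C T K;
       \<And>B f. (B, f) \<in> M \<Longrightarrow> Cmp C T K (fst B) f k = Cmp C T K (fst B) f k'\<rbrakk> \<Longrightarrow> k = k'"
    and ex: "\<And>\<gamma>. \<gamma> \<in> carrier G \<Longrightarrow> \<exists>k \<in> mor C (aO \<gamma> K) K. \<forall>(B, f) \<in> M. Cmp C (aO \<gamma> K) K (fst B) f k =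
       twist_to B \<gamma> K f"
  shows "\<exists>\<kappa>. (K, \<kappa>) \<in> Obj EC \<and> (\<forall>(B, f) \<in> M. f \<in> mor EC (K, \<kappa>) B)"
proof -
  have "\<exists>\<kappa>. \<forall>\<gamma> \<in> carrier G. \<kappa> \<gamma> \<in> mor C (aO \<gamma> K) K \<and>
      (\<forall>(B, f) \<in> M. Cmp C (aO \<gamma> K) K (fst B) f (\<kappa> \<gamma>) = twist_to B \<gamma> K f)"
    by (rule bchoice) (use ex in \<open>simp add: Bex_def\<close>)
  then obtain \<kappa> where k: "\<And>\<gamma>. \<gamma> \<in> carrier G \<Longrightarrow> \<kappa> \<gamma> \<in> mor C (aO \<gamma> K) K"
    and eq: "\<And>\<gamma>. \<gamma> \<in> carrier G \<Longrightarrow> \<forall>(B, f) \<in> M. Cmp C (aO \<gamma> K) K (fst B) f (\<kappa> \<gamma>) = twist_to B \<gamma> K f"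
    by blast
  have sq: "Cmp C (aO \<gamma> K) K (fst B) f (\<kappa> \<gamma>) = twist_to B \<gamma> K f"
    if "(B, f) \<in> M" "\<gamma> \<in> carrier G" for B f \<gamma>
    using bspec[OF eq[OF that(2)] that(1)] by simp
  note J = EC_obj_of_jointly_monic[where M = M and \<kappa> = \<kappa>, OF K k M sq cancel]
  show ?thesis
    by (intro exI[of _ "restrict \<kappa> (carrier G)"] conjI J(1)) (auto intro: J(2))
qed

text \<open>A universal property of \<open>K\<close> yields maps out of \<open>K\<close>, whereas a structure map starts at \<open>\<gamma> K\<close>.
  So the hypothesis asks for \<open>v : K \<rightarrow> \<gamma>\<inverse> K\<close>, and the structure map is \<open>\<gamma> v\<close>.\<close>

lemma EC_structure_epic:
  assumes K: "K \<in> Obj C"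
    and M: "\<And>B f. (B, f) \<in> M \<Longrightarrow> B \<in> Obj EC \<and> f \<in> mor C (fst B) K"
    and cancel: "\<And>T k k'. \<lbrakk>T \<in> Obj C; k \<in> mor C K T; k' \<in> mor C K T;
       \<And>B f. (B, f) \<in> M \<Longrightarrow> Cmp C (fst B) K T k f = Cmp C (fst B) K T k' f\<rbrakk> \<Longrightarrow> k = k'"
    and ex: "\<And>\<gamma>. \<gamma> \<in> carrier G \<Longrightarrow> \<exists>v \<in> mor C K (aO (inv \<gamma>) K). \<forall>(B, f) \<in> M.
       Cmp C (fst B) K (aO (inv \<gamma>) K) v f =
       aM (inv \<gamma>) (aO \<gamma> (fst B)) K (twist_from B \<gamma> K f)"
  shows "\<exists>\<kappa>. (K, \<kappa>) \<in> Obj EC \<and> (\<forall>(B, f) \<in> M. f \<in> mor EC B (K, \<kappa>))"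
proof -
  have "\<exists>v. \<forall>\<gamma> \<in> carrier G. v \<gamma> \<in> mor C K (aO (inv \<gamma>) K) \<and>
      (\<forall>(B, f) \<in> M. Cmp C (fst B) K (aO (inv \<gamma>) K) (v \<gamma>) f =
       aM (inv \<gamma>) (aO \<gamma> (fst B)) K (twist_from B \<gamma> K f))"
    by (rule bchoice) (use ex in \<open>simp add: Bex_def\<close>)
  then obtain v where v: "\<And>\<gamma>. \<gamma> \<in> carrier G \<Longrightarrow> v \<gamma> \<in> mor C K (aO (inv \<gamma>) K)"
    and eq: "\<And>\<gamma>. \<gamma> \<in> carrier G \<Longrightarrow> \<forall>(B, f) \<in> M. Cmp C (fst B) K (aO (inv \<gamma>) K) (v \<gamma>) f =
       aM (inv \<gamma>) (aO \<gamma> (fst B)) K (twist_from B \<gamma> K f)"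
    by blast
  define \<kappa> where "\<kappa> \<gamma> = aM \<gamma> K (aO (inv \<gamma>) K) (v \<gamma>)" for \<gamma>
  have k: "\<kappa> \<gamma> \<in> mor C (aO \<gamma> K) K" if g: "\<gamma> \<in> carrier G" for \<gamma>
    unfolding \<kappa>_def using aM_closed[OF g _ _ v[OF g]] g K by simp
  have sq: "Cmp C (aO \<gamma> (fst B)) (aO \<gamma> K) K (\<kappa> \<gamma>) (aM \<gamma> (fst B) K f) =
       twist_from B \<gamma> K f" if B: "(B, f) \<in> M" and g: "\<gamma> \<in> carrier G" for B f \<gamma>
  proof -
    have BO: "B \<in> Obj EC" and f: "f \<in> mor C (fst B) K" using M[OF B] by auto
    note D = EC_objD(1)[OF BO] EC_objD(3)[OF BO g]
    have l: "twist_from B \<gamma> K f \<in> mor C (aO \<gamma> (fst B)) K"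
      using D f g K by simp
    have "Cmp C (fst B) K (aO (inv \<gamma>) K) (v \<gamma>) f =
       aM (inv \<gamma>) (aO \<gamma> (fst B)) K (twist_from B \<gamma> K f)"
      using bspec[OF eq[OF g] B] by simp
    then show ?thesis
      unfolding \<kappa>_def using aM_Cmp[OF g D(1) K _ f v[OF g]] aM_mult_inv(2)[OF g D(1) K l] g K by simp
  qed
  note J = EC_obj_of_jointly_epic[where M = M and \<kappa> = \<kappa>, OF K k M sq cancel]
  show ?thesis
    by (intro exI[of _ "restrict \<kappa> (carrier G)"] conjI J(1)) (auto intro: J(2))
qed

lemma EC_mor_Cmp_structure:
  assumes B: "B \<in> Obj EC" and D: "D \<in> Obj EC" and g: "g \<in> mor EC B D" and gm: "\<gamma> \<in> carrier G"
    and K: "K \<in> Obj C" and f: "f \<in> mor C K (fst B)"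
  shows "twist_to B \<gamma> K f \<in> mor C (aO \<gamma> K) (fst B)" (is ?P)
    and "Cmp C (aO \<gamma> K) (fst B) (fst D) g
        (twist_to B \<gamma> K f) = twist_to D \<gamma> K (Cmp C K (fst B) (fst D) g f)" (is ?Q)
proof -
  note [simp] = gm K f EC_objD(1)[OF B] EC_objD(1)[OF D] EC_objD(3)[OF B gm] EC_objD(3)[OF D gm] EC_mor[OF g]
  show ?P
    by simp
  have "twist_from B \<gamma> (fst D) g = twist_to D \<gamma> (fst B) g"
    using g unfolding mor_EC_square by simp
  then show ?Q
    by (simp add: Cmp_assoc aM_Cmp)
qed

lemma structure_Cmp_EC_mor:
  assumes A: "A \<in> Obj EC" and B: "B \<in> Obj EC" and f: "f \<in> mor EC A B" and gm: "\<gamma> \<in> carrier G"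
    and K: "K \<in> Obj C" and b: "b \<in> mor C (fst B) K"
  defines "l \<equiv> twist_from B \<gamma> K b"
  shows "aM (inv \<gamma>) (aO \<gamma> (fst B)) K l \<in> mor C (fst B) (aO (inv \<gamma>) K)" (is ?P)
    and "Cmp C (fst A) (fst B) (aO (inv \<gamma>) K) (aM (inv \<gamma>) (aO \<gamma> (fst B)) K l) f =
      aM (inv \<gamma>) (aO \<gamma> (fst A)) K (twist_from A \<gamma> K (Cmp C (fst A) (fst B) K b f))" (is ?Q)
proof -
  note [simp] = gm K b EC_objD(1)[OF A] EC_objD(1)[OF B] EC_objD(3)[OF A gm] EC_objD(3)[OF B gm] EC_mor[OF f]
  have l: "l \<in> mor C (aO \<gamma> (fst B)) K" unfolding l_def by simp
  show ?P
    by (rule aM_mult_inv(1)[OF gm _ K l]) simp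
  have "twist_from A \<gamma> (fst B) f = twist_to B \<gamma> (fst A) f"
    using f unfolding mor_EC_square by simp
  then have "Cmp C (aO \<gamma> (fst A)) (aO \<gamma> (fst B)) K l (aM \<gamma> (fst A) (fst B) f) =
      twist_from A \<gamma> K (Cmp C (fst A) (fst B) K b f)"
    unfolding l_def by (simp flip: Cmp_assoc)
  then show ?Q
    using aM_Cmp[of "inv \<gamma>" "aO \<gamma> (fst A)" "aO \<gamma> (fst B)" K "aM \<gamma> (fst A) (fst B) f" l] l by simp
qed

end

section \<open>The exact structure on equivariant objects\<close>

context strict_action
begin

lemma EC_zero_object:
  assumes Z: "zero_object C Z"
  shows "\<exists>\<kappa>. zero_object EC (Z, \<kappa>)"
proof -
  let ?k = "\<lambda>\<gamma>. zero_mor C (aO \<gamma> Z) Z"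
  have ZO: "Z \<in> Obj C" using Z unfolding zero_object_def by simp
  have "(Z, restrict ?k (carrier G)) \<in> Obj EC"
    \<comment> \<open>Maps into a zero object are equal without any test.\<close>
    by (rule EC_obj_of_jointly_monic(1)[where M = "{}"])
       (use Z ZO in \<open>auto simp: zero_object_def\<close>)
  moreover have "Idt C Z = zero_mor C Z Z"
    using Z Idt_closed[OF ZO] unfolding zero_object_def by auto
  ultimately show ?thesis using EC.zero_objectI[of "(Z, restrict ?k (carrier G))"] by auto
qed

lemma biproduct_maps_cancel:
  assumes B: "biproduct C X Y S i j p q" and O: "X \<in> Obj C" "Y \<in> Obj C" "T \<in> Obj C"
    and k: "k \<in> mor C T S" "k' \<in> mor C T S"
    and eq: "Cmp C T S X p k = Cmp C T S X p k'" "Cmp C T S Y q k = Cmp C T S Y q k'"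
  shows "k = k'"
  using biproduct_decompose_left[OF B O k(1)] biproduct_decompose_left[OF B O k(2)] eq by simp

lemma EC_biproduct:
  assumes A: "A \<in> Obj EC" and B: "B \<in> Obj EC"
    and bp: "biproduct C (fst A) (fst B) S i j p q"
  shows "\<exists>\<sigma>. biproduct EC A B (S, \<sigma>) i j p q"
proof -
  note X = EC_objD(1)[OF A] and Y = EC_objD(1)[OF B] and x = EC_objD(3)[OF A] and y = EC_objD(3)[OF B]
  note D = biproductD[OF bp]
  \<comment> \<open>the only structure for which the projections are equivariant: \<open>i \<xi>\<^sub>\<gamma> \<gamma> p + j \<eta>\<^sub>\<gamma> \<gamma> q\<close>\<close>
  let ?s = "\<lambda>\<gamma>. Cmp C (aO \<gamma> S) (fst A) S i (twist_to A \<gamma> S p)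
      \<oplus>\<^bsub>Hom C (aO \<gamma> S) S\<^esub>
      Cmp C (aO \<gamma> S) (fst B) S j (twist_to B \<gamma> S q)"
  let ?M = "{(A, p), (B, q)}"
  have cancel: "k = k'" if "T \<in> Obj C" "k \<in> mor C T S" "k' \<in> mor C T S"
      "\<And>B f. (B, f) \<in> ?M \<Longrightarrow> Cmp C T S (fst B) f k = Cmp C T S (fst B) f k'" for T k k'
    using biproduct_maps_cancel[OF bp X Y that(1-3)] that(4) by blast
  have eq: "Cmp C (aO \<gamma> S) S (fst D) f (?s \<gamma>) = twist_to D \<gamma> S f"
    if "(D, f) \<in> ?M" and g: "\<gamma> \<in> carrier G" for D f \<gamma>
    using that(1) X Y D x[OF g] y[OF g] g
    by (elim insertE) (simp_all add: Cmp_add_right Cmp_assoc)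
  let ?S = "(S, restrict ?s (carrier G))"
  have M: "D \<in> Obj EC \<and> f \<in> mor C S (fst D)" if "(D, f) \<in> ?M" for D f
    using that A B D by auto
  have cl: "?s \<gamma> \<in> mor C (aO \<gamma> S) S" if "\<gamma> \<in> carrier G" for \<gamma>
    using that X Y D(1-5) x[OF that] y[OF that] by simp
  note J = EC_obj_of_jointly_monic[where M = ?M, OF D(1) cl M eq cancel]
  have S: "?S \<in> Obj EC" by (rule J(1))
  have p: "p \<in> mor EC ?S A" and q: "q \<in> mor EC ?S B" by (rule J(2); blast)+
  have i: "i \<in> mor EC A ?S"
    by (rule EC_mor_into[where M = ?M, OF A S])
      (use D A B S X Y EC.Idt_closed[OF A] EC.zero_mor_closed[OF A B] p q biproduct_maps_cancel[OF bp X Y X] in auto)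
  have j: "j \<in> mor EC B ?S"
    by (rule EC_mor_into[where M = ?M, OF B S])
      (use D A B S X Y EC.Idt_closed[OF B] EC.zero_mor_closed[OF B A] p q biproduct_maps_cancel[OF bp X Y Y] in auto)
  show ?thesis
    using S p q i j D unfolding biproduct_def by (intro exI[of _ "restrict ?s (carrier G)"]) simp
qed

end

locale exact_action = strict_action C G aO aM + exact_category C E
  for C :: "('o, 'm) precategory" and G :: "('g, 'e) monoid_scheme" (structure)
    and aO :: "'g \<Rightarrow> 'o \<Rightarrow> 'o" and aM :: "'g \<Rightarrow> 'o \<Rightarrow> 'o \<Rightarrow> 'm \<Rightarrow> 'm"
    and E :: "('o, 'm) sequence set"
begin

abbreviation EE where "EE \<equiv> equivariant_sequences G aO aM C E"

lemma EE_iff: "(A, f, B, g, D) \<in> EE \<longleftrightarrow> A \<in> Obj EC \<and> B \<in> Obj EC \<and> D \<in> Obj EC \<and>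
    f \<in> mor EC A B \<and> g \<in> mor EC B D \<and> (fst A, f, fst B, g, fst D) \<in> E"
  unfolding equivariant_sequences_def sequences_def by auto

lemma EC_kernel:
  assumes B: "B \<in> Obj EC" and D: "D \<in> Obj EC" and g: "g \<in> mor EC B D"
    and K: "kernel_cokernel_pair C (K, f, fst B, g, fst D)"
  shows "\<exists>\<kappa>. (K, \<kappa>) \<in> Obj EC \<and> f \<in> mor EC (K, \<kappa>) B"
proof -
  note KD = kernel_cokernel_pairD[OF K]
  have "\<exists>\<kappa>. (K, \<kappa>) \<in> Obj EC \<and> (\<forall>(B, f) \<in> {(B, f)}. f \<in> mor EC (K, \<kappa>) B)"
  proof (rule EC_structure_monic)
    fix \<gamma> assume gm: "\<gamma> \<in> carrier G"
    note S = EC_mor_Cmp_structure[OF B D g gm KD(1,4)]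
    show "\<exists>k \<in> mor C (aO \<gamma> K) K. \<forall>(B, f) \<in> {(B, f)}. Cmp C (aO \<gamma> K) K (fst B) f k =
        twist_to B \<gamma> K f"
      using KD(7)[OF aO_closed[OF gm KD(1)] S(1)] S(2) KD(1,3,6) EC_objD(3)[OF D gm] gm by simp
  qed (use KD B kernel_cancel[OF K] in auto)
  then show ?thesis by simp
qed

lemma EC_cokernel:
  assumes A: "A \<in> Obj EC" and B: "B \<in> Obj EC" and f: "f \<in> mor EC A B"
    and K: "kernel_cokernel_pair C (fst A, f, fst B, g, K)"
  shows "\<exists>\<kappa>. (K, \<kappa>) \<in> Obj EC \<and> g \<in> mor EC B (K, \<kappa>)"
proof -
  note KD = kernel_cokernel_pairD[OF K]
  have "\<exists>\<kappa>. (K, \<kappa>) \<in> Obj EC \<and> (\<forall>(B, g) \<in> {(B, g)}. g \<in> mor EC B (K, \<kappa>))"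
  proof (rule EC_structure_epic)
    fix \<gamma> assume gm: "\<gamma> \<in> carrier G"
    note S = structure_Cmp_EC_mor[OF A B f gm KD(3,5)]
    show "\<exists>v \<in> mor C K (aO (inv \<gamma>) K). \<forall>(B, g) \<in> {(B, g)}. Cmp C (fst B) K (aO (inv \<gamma>) K) v g =
        aM (inv \<gamma>) (aO \<gamma> (fst B)) K (twist_from B \<gamma> K g)"
      using KD(8)[OF _ S(1)] S(2) KD(1,3,6) EC_objD(3)[OF A gm] gm by simp
  qed (use KD B cokernel_cancel[OF K] in auto)
  then show ?thesis by simp
qed

text \<open>Cokernels and kernels of equivariant maps carry equivariant structures, so inflations and
  deflations are recognized in \<open>C\<close>. This reduces the axioms of an exact category to those of \<open>C\<close>.\<close>

lemma inflation_EE_iff: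
  "inflation EE A B f \<longleftrightarrow> A \<in> Obj EC \<and> B \<in> Obj EC \<and> f \<in> mor EC A B \<and> inflation E (fst A) (fst B) f"
proof
  assume "inflation EE A B f"
  then show "A \<in> Obj EC \<and> B \<in> Obj EC \<and> f \<in> mor EC A B \<and> inflation E (fst A) (fst B) f"
    unfolding inflation_def by (auto simp: EE_iff)
next
  assume *: "A \<in> Obj EC \<and> B \<in> Obj EC \<and> f \<in> mor EC A B \<and> inflation E (fst A) (fst B) f"
  then obtain g K where g: "(fst A, f, fst B, g, K) \<in> E" unfolding inflation_def by blast
  then obtain \<kappa> where "(K, \<kappa>) \<in> Obj EC" "g \<in> mor EC B (K, \<kappa>)"
    using EC_cokernel[of A B f g K] * kernel_cokernel by blast
  then have "(A, f, B, g, (K, \<kappa>)) \<in> EE" using * g by (simp add: EE_iff)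
  then show "inflation EE A B f" unfolding inflation_def by blast
qed

lemma deflation_EE_iff:
  "deflation EE B D g \<longleftrightarrow> B \<in> Obj EC \<and> D \<in> Obj EC \<and> g \<in> mor EC B D \<and> deflation E (fst B) (fst D) g"
proof
  assume "deflation EE B D g"
  then show "B \<in> Obj EC \<and> D \<in> Obj EC \<and> g \<in> mor EC B D \<and> deflation E (fst B) (fst D) g"
    unfolding deflation_def by (auto simp: EE_iff)
next
  assume *: "B \<in> Obj EC \<and> D \<in> Obj EC \<and> g \<in> mor EC B D \<and> deflation E (fst B) (fst D) g"
  then obtain f K where f: "(K, f, fst B, g, fst D) \<in> E" unfolding deflation_def by blast
  then obtain \<kappa> where "(K, \<kappa>) \<in> Obj EC" "f \<in> mor EC (K, \<kappa>) B"
    using EC_kernel[of B D g K f] * kernel_cokernel by blast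
  then have "((K, \<kappa>), f, B, g, D) \<in> EE" using * f by (simp add: EE_iff)
  then show "deflation EE B D g" unfolding deflation_def by blast
qed

lemma EE_kernel_cokernel:
  assumes "(A, f, B, g, D) \<in> EE"
  shows "kernel_cokernel_pair EC (A, f, B, g, D)"
proof -
  have *: "A \<in> Obj EC" "B \<in> Obj EC" "D \<in> Obj EC" "f \<in> mor EC A B" "g \<in> mor EC B D"
    and K: "kernel_cokernel_pair C (fst A, f, fst B, g, fst D)"
    using assms kernel_cokernel by (auto simp: EE_iff)
  note KD = kernel_cokernel_pairD[OF K]
  show ?thesis
  proof (rule EC.kernel_cokernel_pairI[OF *])
    show "Cmp EC A B D g f = zero_mor EC A D" using KD by simp
  next
    fix T h assume T: "T \<in> Obj EC" "h \<in> mor EC T B" "Cmp EC T B D g h = zero_mor EC T D"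
    have h: "h \<in> mor C (fst T) (fst B)" using T by (auto dest: EC_mor)
    obtain k where k: "k \<in> mor C (fst T) (fst A)" "Cmp C (fst T) (fst A) (fst B) f k = h"
      using KD(7)[OF EC_objD(1)[OF T(1)] h] T by auto
    have "k \<in> mor EC T A"
      by (rule EC_mor_into[where M = "{(B, f)}", OF T(1) *(1) k(1)])
        (use * k T kernel_cancel[OF K EC_objD(1)[OF T(1)]] in auto)
    then show "\<exists>k \<in> mor EC T A. Cmp EC T A B f k = h" using k by auto
  next
    fix T k k' assume T: "T \<in> Obj EC" "k \<in> mor EC T A" "k' \<in> mor EC T A" "Cmp EC T A B f k = Cmp EC T A B f k'"
    then show "k = k'"
      using kernel_cancel[OF K EC_objD(1)[OF T(1)]] by (auto dest: EC_mor)
  next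
    fix T h assume T: "T \<in> Obj EC" "h \<in> mor EC B T" "Cmp EC A B T h f = zero_mor EC A T"
    have h: "h \<in> mor C (fst B) (fst T)" using T by (auto dest: EC_mor)
    obtain k where k: "k \<in> mor C (fst D) (fst T)" "Cmp C (fst B) (fst D) (fst T) k g = h"
      using KD(8)[OF EC_objD(1)[OF T(1)] h] T by auto
    have "k \<in> mor EC D T"
      by (rule EC_mor_from[where M = "{(B, g)}", OF T(1) *(3) k(1)])
        (use * k T cokernel_cancel[OF K EC_objD(1)[OF T(1)]] in auto)
    then show "\<exists>k \<in> mor EC D T. Cmp EC B D T k g = h" using k by auto
  next
    fix T k k' assume T: "T \<in> Obj EC" "k \<in> mor EC D T" "k' \<in> mor EC D T" "Cmp EC B D T k g = Cmp EC B D T k' g"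
    then show "k = k'"
      using cokernel_cancel[OF K EC_objD(1)[OF T(1)]] by (auto dest: EC_mor)
  qed
qed

lemma iso_mor_EC: "iso_mor EC A B f \<Longrightarrow> iso_mor C (fst A) (fst B) f"
  unfolding iso_mor_def by (auto dest: EC_mor)

lemma EC_pushout:
  assumes f: "inflation EE A B f" and A': "A' \<in> Obj EC" and a: "a \<in> mor EC A A'"
  shows "\<exists>B' b f'. is_pushout EC A B A' B' f a b f' \<and> inflation EE A' B' f'"
proof -
  have A: "A \<in> Obj EC" and B: "B \<in> Obj EC" and fE: "f \<in> mor EC A B" and fi: "inflation E (fst A) (fst B) f"
    using f by (auto simp: inflation_EE_iff)
  obtain K b f' where po: "is_pushout C (fst A) (fst B) (fst A') K f a b f'"
    and f'i: "inflation E (fst A') K f'"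
    using pushout_inflation[OF fi EC_objD(1)[OF A'] EC_mor[OF a]] by blast
  have sq: "K \<in> Obj C" "b \<in> mor C (fst B) K" "f' \<in> mor C (fst A') K"
      "Cmp C (fst A) (fst B) K b f = Cmp C (fst A) (fst A') K f' a"
    using po unfolding is_pushout_def commutative_square_def by auto
  note obj = EC_objD(1)[OF A] EC_objD(1)[OF B] EC_objD(1)[OF A']
  let ?M = "{(B, b), (A', f')}"
  have cancel: "k = k'" if "T \<in> Obj C" "k \<in> mor C K T" "k' \<in> mor C K T"
      "\<And>B f. (B, f) \<in> ?M \<Longrightarrow> Cmp C (fst B) K T k f = Cmp C (fst B) K T k' f" for T k k'
    using is_pushout_cancel[OF po that(1-3)] that(4) by blast
  have "\<exists>\<kappa>. (K, \<kappa>) \<in> Obj EC \<and> (\<forall>(B, f) \<in> ?M. f \<in> mor EC B (K, \<kappa>))"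
  proof (rule EC_structure_epic[OF sq(1) _ cancel])
    fix \<gamma> assume gm: "\<gamma> \<in> carrier G"
    note S = structure_Cmp_EC_mor[OF A B fE gm sq(1,2)] structure_Cmp_EC_mor[OF A A' a gm sq(1,3)]
    have "commutative_square C (fst A) (fst B) (fst A') (aO (inv \<gamma>) K) f a
       (aM (inv \<gamma>) (aO \<gamma> (fst B)) K (twist_from B \<gamma> K b))
       (aM (inv \<gamma>) (aO \<gamma> (fst A')) K (twist_from A' \<gamma> K f'))"
      unfolding commutative_square_def using S sq obj EC_mor[OF a] EC_mor[OF fE] gm by simp
    from is_pushout_ex[OF po this]
    show "\<exists>v \<in> mor C K (aO (inv \<gamma>) K). \<forall>(B, f) \<in> ?M. Cmp C (fst B) K (aO (inv \<gamma>) K) v f =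
        aM (inv \<gamma>) (aO \<gamma> (fst B)) K (twist_from B \<gamma> K f)" by simp
  qed (use sq B A' in auto)
  then obtain \<kappa> where KO: "(K, \<kappa>) \<in> Obj EC" and bE: "b \<in> mor EC B (K, \<kappa>)"
    and f'E: "f' \<in> mor EC A' (K, \<kappa>)" by auto
  let ?K = "(K, \<kappa>)"
  have "is_pushout EC A B A' ?K f a b f'"
    unfolding is_pushout_def
  proof (intro conjI allI impI)
    show "commutative_square EC A B A' ?K f a b f'"
      unfolding commutative_square_def using A B A' KO fE a bE f'E sq by simp
    fix T h l assume T: "commutative_square EC A B A' T f a h l"
    then have TE: "T \<in> Obj EC" "h \<in> mor EC B T" "l \<in> mor EC A' T" unfolding commutative_square_def by auto
    have "commutative_square C (fst A) (fst B) (fst A') (fst T) f a h l"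
      using T EC_objD(1) EC_mor unfolding commutative_square_def by auto
    then obtain t where t: "t \<in> mor C K (fst T)" "Cmp C (fst B) K (fst T) t b = h" "Cmp C (fst A') K (fst T) t f' = l"
      using is_pushout_ex[OF po] by blast
    have tE: "t \<in> mor EC ?K T"
    proof (rule EC_mor_from[where M = ?M, OF TE(1) KO])
      show "k = k'" if "k \<in> mor C (fst ?K) (fst T)" "k' \<in> mor C (fst ?K) (fst T)"
       "\<And>B f. (B, f) \<in> ?M \<Longrightarrow> Cmp C (fst B) (fst ?K) (fst T) k f = Cmp C (fst B) (fst ?K) (fst T) k' f" for k k'
        using cancel[OF EC_objD(1)[OF TE(1)], of k k'] that by simp
    qed (use t B A' bE f'E TE in auto)
    show "\<exists>!t. t \<in> mor EC ?K T \<and> Cmp EC B ?K T t b = h \<and> Cmp EC A' ?K T t f' = l"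
    proof (intro ex1I conjI)
      fix s assume s: "s \<in> mor EC ?K T \<and> Cmp EC B ?K T s b = h \<and> Cmp EC A' ?K T s f' = l"
      then show "s = t"
        using is_pushout_cancel[OF po EC_objD(1)[OF TE(1)] _ t(1), of s] t(2,3) EC_mor[of s ?K T] by simp
    qed (use tE t in auto)
  qed
  moreover have "inflation EE A' ?K f'"
    using A' KO f'E f'i by (simp add: inflation_EE_iff)
  ultimately show ?thesis by blast
qed

lemma EC_pullback:
  assumes f': "deflation EE A' B' f'" and B: "B \<in> Obj EC" and b: "b \<in> mor EC B B'"
  shows "\<exists>A f a. is_pullback EC A B A' B' f a b f' \<and> deflation EE A B f"
proof -
  have A': "A' \<in> Obj EC" and B': "B' \<in> Obj EC" and f'E: "f' \<in> mor EC A' B'"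
    and f'd: "deflation E (fst A') (fst B') f'"
    using f' by (auto simp: deflation_EE_iff)
  obtain K f a where pb: "is_pullback C K (fst B) (fst A') (fst B') f a b f'"
    and fd: "deflation E K (fst B) f"
    using pullback_deflation[OF f'd EC_objD(1)[OF B] EC_mor[OF b]] by blast
  have sq: "K \<in> Obj C" "f \<in> mor C K (fst B)" "a \<in> mor C K (fst A')"
      "Cmp C K (fst B) (fst B') b f = Cmp C K (fst A') (fst B') f' a"
    using pb unfolding is_pullback_def commutative_square_def by auto
  note obj = EC_objD(1)[OF B] EC_objD(1)[OF A'] EC_objD(1)[OF B']
  let ?M = "{(B, f), (A', a)}"
  have cancel: "k = k'" if "T \<in> Obj C" "k \<in> mor C T K" "k' \<in> mor C T K"
      "\<And>B f. (B, f) \<in> ?M \<Longrightarrow> Cmp C T K (fst B) f k = Cmp C T K (fst B) f k'" for T k k'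
    using is_pullback_cancel[OF pb that(1-3)] that(4) by blast
  have "\<exists>\<kappa>. (K, \<kappa>) \<in> Obj EC \<and> (\<forall>(B, f) \<in> ?M. f \<in> mor EC (K, \<kappa>) B)"
  proof (rule EC_structure_monic[OF sq(1) _ cancel])
    fix \<gamma> assume gm: "\<gamma> \<in> carrier G"
    note S = EC_mor_Cmp_structure[OF B B' b gm sq(1,2)] EC_mor_Cmp_structure[OF A' B' f'E gm sq(1,3)]
    have "commutative_square C (aO \<gamma> K) (fst B) (fst A') (fst B')
       (twist_to B \<gamma> K f)
       (twist_to A' \<gamma> K a) b f'"
      unfolding commutative_square_def using S sq obj EC_mor[OF b] EC_mor[OF f'E] gm by simp
    from is_pullback_ex[OF pb this]
    show "\<exists>k \<in> mor C (aO \<gamma> K) K. \<forall>(B, f) \<in> ?M. Cmp C (aO \<gamma> K) K (fst B) f k =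
        twist_to B \<gamma> K f" by simp
  qed (use sq B A' in auto)
  then obtain \<kappa> where KO: "(K, \<kappa>) \<in> Obj EC" and fE: "f \<in> mor EC (K, \<kappa>) B"
    and aE: "a \<in> mor EC (K, \<kappa>) A'" by auto
  let ?K = "(K, \<kappa>)"
  have "is_pullback EC ?K B A' B' f a b f'"
    unfolding is_pullback_def
  proof (intro conjI allI impI)
    show "commutative_square EC ?K B A' B' f a b f'"
      unfolding commutative_square_def using A' B B' KO f'E aE b fE sq by simp
    fix T h l assume T: "commutative_square EC T B A' B' h l b f'"
    then have TE: "T \<in> Obj EC" "h \<in> mor EC T B" "l \<in> mor EC T A'" unfolding commutative_square_def by auto
    have "commutative_square C (fst T) (fst B) (fst A') (fst B') h l b f'"
      using T EC_objD(1) EC_mor unfolding commutative_square_def by auto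
    then obtain t where t: "t \<in> mor C (fst T) K" "Cmp C (fst T) K (fst B) f t = h" "Cmp C (fst T) K (fst A') a t = l"
      using is_pullback_ex[OF pb] by blast
    have tE: "t \<in> mor EC T ?K"
    proof (rule EC_mor_into[where M = ?M, OF TE(1) KO])
      show "k = k'" if "k \<in> mor C (fst T) (fst ?K)" "k' \<in> mor C (fst T) (fst ?K)"
       "\<And>B f. (B, f) \<in> ?M \<Longrightarrow> Cmp C (fst T) (fst ?K) (fst B) f k = Cmp C (fst T) (fst ?K) (fst B) f k'" for k k'
        using cancel[OF EC_objD(1)[OF TE(1)], of k k'] that by simp
    qed (use t B A' fE aE TE in auto)
    show "\<exists>!t. t \<in> mor EC T ?K \<and> Cmp EC T ?K B f t = h \<and> Cmp EC T ?K A' a t = l"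
    proof (intro ex1I conjI)
      fix s assume s: "s \<in> mor EC T ?K \<and> Cmp EC T ?K B f s = h \<and> Cmp EC T ?K A' a s = l"
      then show "s = t"
        using is_pullback_cancel[OF pb EC_objD(1)[OF TE(1)] _ t(1), of s] t(2,3) EC_mor[of s T ?K] by simp
    qed (use tE t in auto)
  qed
  moreover have "deflation EE ?K B f"
    using B KO fE fd by (simp add: deflation_EE_iff)
  ultimately show ?thesis by blast
qed

theorem EC_exact: "exact_category EC EE"
proof (intro exact_category.intro additive_category.intro EC_preadditive
    additive_category_axioms.intro exact_category_axioms.intro)
  show "\<exists>Z. zero_object EC Z" using has_zero_object EC_zero_object by blast
next
  fix A B assume "A \<in> Obj EC" "B \<in> Obj EC"
  then show "\<exists>S. is_direct_sum EC A B S"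
    using has_direct_sums[OF EC_objD(1) EC_objD(1)] EC_biproduct unfolding is_direct_sum_def by metis
next
  fix s assume "s \<in> EE"
  then show "kernel_cokernel_pair EC s" using EE_kernel_cokernel by (cases s) auto
next
  fix s s' assume *: "s \<in> EE" "s' \<in> sequences EC" "seq_isomorphic EC s s'"
  obtain A f B g D where s: "s = (A, f, B, g, D)" by (cases s)
  obtain A' f' B' g' D' where s': "s' = (A', f', B', g', D')" by (cases s')
  have S: "A' \<in> Obj EC" "B' \<in> Obj EC" "D' \<in> Obj EC" "f' \<in> mor EC A' B'" "g' \<in> mor EC B' D'"
    using *(2) unfolding s' sequences_def by auto
  have "seq_isomorphic C (fst A, f, fst B, g, fst D) (fst A', f', fst B', g', fst D')"
    using *(3) iso_mor_EC unfolding s s' seq_isomorphic_def by simp metis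
  moreover have "(fst A', f', fst B', g', fst D') \<in> sequences C"
    unfolding sequences_def using S EC_objD(1) EC_mor by auto
  ultimately have "(fst A', f', fst B', g', fst D') \<in> E"
    using iso_closed *(1) unfolding s EE_iff by blast
  then show "s' \<in> EE" unfolding s' EE_iff using S by simp
next
  fix A assume "A \<in> Obj EC"
  then show "inflation EE A A (Idt EC A)" "deflation EE A A (Idt EC A)"
    using EC.Idt_closed Idt_inflation Idt_deflation EC_objD(1)
    by (simp_all add: inflation_EE_iff deflation_EE_iff)
next
  fix A B D f g assume "inflation EE A B f" "inflation EE B D g"
  then show "inflation EE A D (Cmp EC A B D g f)"
    using EC.Cmp_closed[of A B D f g] Cmp_inflation by (simp add: inflation_EE_iff)
next
  fix A B D f g assume "deflation EE A B f" "deflation EE B D g"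
  then show "deflation EE A D (Cmp EC A B D g f)"
    using EC.Cmp_closed[of A B D f g] Cmp_deflation by (simp add: deflation_EE_iff)
qed (fact EC_pushout EC_pullback)+

end

section \<open>Traces and induced objects\<close>

locale frobenius_action = strict_action C G aO aM + frobenius_category C E
  for C :: "('o, 'm) precategory" and G :: "('g, 'e) monoid_scheme" (structure)
    and aO :: "'g \<Rightarrow> 'o \<Rightarrow> 'o" and aM :: "'g \<Rightarrow> 'o \<Rightarrow> 'o \<Rightarrow> 'm \<Rightarrow> 'm"
    and E :: "('o, 'm) sequence set" +
  assumes finite_group: "finite (carrier G)"
begin

sublocale exact_action C G aO aM E ..

definition tr :: "'o \<times> ('g \<Rightarrow> 'm) \<Rightarrow> 'o \<times> ('g \<Rightarrow> 'm) \<Rightarrow> 'm \<Rightarrow> 'm" where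
  "tr A B h = finsum (Hom C (fst A) (fst B)) (\<lambda>\<gamma>. conj_mor \<gamma> A B h) (carrier G)"

lemma tr_closed:
  assumes A: "A \<in> Obj EC" and B: "B \<in> Obj EC" and h: "h \<in> mor C (fst A) (fst B)"
  shows "tr A B h \<in> mor EC A B"
proof -
  note X = EC_objD(1)[OF A] and Y = EC_objD(1)[OF B]
  interpret H: abelian_group "Hom C (fst A) (fst B)" by (rule Hom_abelian_group[OF X Y])
  have cl: "(\<lambda>\<gamma>. conj_mor \<gamma> A B h) \<in> carrier G \<rightarrow> mor C (fst A) (fst B)"
    using A B h by auto
  have "conj_mor \<alpha> A B (tr A B h) = tr A B h" if a: "\<alpha> \<in> carrier G" for \<alpha>
  proof -
    have "conj_mor \<alpha> A B (tr A B h) =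
        finsum (Hom C (fst A) (fst B)) (\<lambda>\<gamma>. conj_mor \<alpha> A B (conj_mor \<gamma> A B h)) (carrier G)"
      unfolding tr_def using A B a cl
      by (intro additive_map_finsum H.abelian_group_axioms finite_group conj_add) auto
    also have "\<dots> = finsum (Hom C (fst A) (fst B)) (\<lambda>\<gamma>. conj_mor (\<alpha> \<otimes> \<gamma>) A B h) (carrier G)"
      using A B a h by (intro H.finsum_cong') (auto simp: conj_mult)
    also have "\<dots> = finsum (Hom C (fst A) (fst B)) (\<lambda>\<gamma>. conj_mor \<gamma> A B h) ((\<lambda>\<gamma>. \<alpha> \<otimes> \<gamma>) ` carrier G)"
      using a cl by (intro H.finsum_reindex[symmetric]) (auto simp: inj_on_def)
    also have "(\<lambda>\<gamma>. \<alpha> \<otimes> \<gamma>) ` carrier G = carrier G"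
      using a surj_const_mult by blast
    finally show ?thesis unfolding tr_def .
  qed
  moreover have "tr A B h \<in> mor C (fst A) (fst B)"
    unfolding tr_def using cl by (rule H.finsum_closed)
  ultimately show ?thesis by (simp add: mor_EC_iff[OF A B])
qed

lemma Cmp_tr:
  assumes A: "A \<in> Obj EC" and B: "B \<in> Obj EC" and D: "D \<in> Obj EC"
    and h: "h \<in> mor C (fst A) (fst B)" and k: "k \<in> mor EC B D"
  shows "Cmp C (fst A) (fst B) (fst D) k (tr A B h) = tr A D (Cmp C (fst A) (fst B) (fst D) k h)"
proof -
  note X = EC_objD(1)[OF A] and Y = EC_objD(1)[OF B] and Z = EC_objD(1)[OF D]
  interpret H: abelian_group "Hom C (fst A) (fst D)" by (rule Hom_abelian_group[OF X Z])
  have "Cmp C (fst A) (fst B) (fst D) k (tr A B h) =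
      finsum (Hom C (fst A) (fst D)) (\<lambda>\<gamma>. Cmp C (fst A) (fst B) (fst D) k (conj_mor \<gamma> A B h)) (carrier G)"
    unfolding tr_def using X Y Z EC_mor[OF k] A B h
    by (intro Cmp_finsum_right finite_group) auto
  also have "\<dots> = tr A D (Cmp C (fst A) (fst B) (fst D) k h)"
    unfolding tr_def using A B D h EC_mor[OF k] X Y Z
    by (intro H.finsum_cong') (auto simp: conj_Cmp conj_fixed[OF B D k])
  finally show ?thesis .
qed

lemma tr_Cmp:
  assumes A: "A \<in> Obj EC" and B: "B \<in> Obj EC" and D: "D \<in> Obj EC"
    and h: "h \<in> mor EC A B" and k: "k \<in> mor C (fst B) (fst D)"
  shows "Cmp C (fst A) (fst B) (fst D) (tr B D k) h = tr A D (Cmp C (fst A) (fst B) (fst D) k h)"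
proof -
  note X = EC_objD(1)[OF A] and Y = EC_objD(1)[OF B] and Z = EC_objD(1)[OF D]
  interpret H: abelian_group "Hom C (fst A) (fst D)" by (rule Hom_abelian_group[OF X Z])
  have "Cmp C (fst A) (fst B) (fst D) (tr B D k) h =
      finsum (Hom C (fst A) (fst D)) (\<lambda>\<gamma>. Cmp C (fst A) (fst B) (fst D) (conj_mor \<gamma> B D k) h) (carrier G)"
    unfolding tr_def using X Y Z EC_mor[OF h] B D k
    by (intro Cmp_finsum_left finite_group) auto
  also have "\<dots> = tr A D (Cmp C (fst A) (fst B) (fst D) k h)"
    unfolding tr_def using A B D k EC_mor[OF h] X Y Z
    by (intro H.finsum_cong') (auto simp: conj_Cmp conj_fixed[OF A B h])
  finally show ?thesis .
qed

text \<open>Higman's criterion: if the identity of \<open>S\<close> is the trace of a map \<open>i p\<close> that factors through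
  a projective object of \<open>C\<close>, then a lift \<open>k\<close> of \<open>h i\<close> along a deflation \<open>g\<close> gives the equivariant
  lift \<open>tr (k p)\<close> of \<open>h\<close>, because \<open>g \<circ> tr (k p) = tr (h i p) = h \<circ> tr (i p)\<close>.\<close>

lemma projective_if_trace:
  assumes S: "S \<in> Obj EC" and P: "projective_object C E P"
    and i: "i \<in> mor C P (fst S)" and p: "p \<in> mor C (fst S) P"
    and tr: "tr S S (Cmp C (fst S) P (fst S) i p) = Idt C (fst S)"
  shows "projective_object EC EE S"
  unfolding projective_object_def
proof (intro conjI allI impI ballI)
  fix Y Z g h assume g: "deflation EE Y Z g" and h: "h \<in> mor EC S Z"
  have Y: "Y \<in> Obj EC" and Z: "Z \<in> Obj EC" and gE: "g \<in> mor EC Y Z"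
    and gd: "deflation E (fst Y) (fst Z) g"
    using g by (auto simp: deflation_EE_iff)
  have PO: "P \<in> Obj C" using P unfolding projective_object_def by simp
  note O = EC_objD(1)[OF S] EC_objD(1)[OF Y] EC_objD(1)[OF Z] PO
  note M = EC_mor[OF gE] EC_mor[OF h]
  obtain k where k: "k \<in> mor C P (fst Y)"
    "Cmp C P (fst Y) (fst Z) g k = Cmp C P (fst S) (fst Z) h i"
    using projective_lift[OF P gd, of "Cmp C P (fst S) (fst Z) h i"] O M i by auto
  let ?t = "tr S Y (Cmp C (fst S) P (fst Y) k p)"
  have "Cmp C (fst S) (fst Y) (fst Z) g ?t =
      tr S Z (Cmp C (fst S) (fst Y) (fst Z) g (Cmp C (fst S) P (fst Y) k p))"
    using O k p by (intro Cmp_tr S Y Z gE) auto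
  also have "\<dots> = tr S Z (Cmp C (fst S) (fst S) (fst Z) h (Cmp C (fst S) P (fst S) i p))"
    using O M k i p by (simp add: Cmp_assoc)
  also have "\<dots> = Cmp C (fst S) (fst S) (fst Z) h (tr S S (Cmp C (fst S) P (fst S) i p))"
    using O i p by (intro Cmp_tr[symmetric] S Z h) auto
  also have "\<dots> = h" using tr O M by simp
  finally have "Cmp EC S Y Z g ?t = h" by simp
  moreover have "?t \<in> mor EC S Y" using O k p by (intro tr_closed S Y) auto
  ultimately show "\<exists>k \<in> mor EC S Y. Cmp EC S Y Z g k = h" by blast
qed fact

lemma injective_if_trace:
  assumes S: "S \<in> Obj EC" and P: "injective_object C E P"
    and i: "i \<in> mor C P (fst S)" and p: "p \<in> mor C (fst S) P"
    and tr: "tr S S (Cmp C (fst S) P (fst S) i p) = Idt C (fst S)"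
  shows "injective_object EC EE S"
  unfolding injective_object_def
proof (intro conjI allI impI ballI)
  fix X Y f h assume f: "inflation EE X Y f" and h: "h \<in> mor EC X S"
  have X: "X \<in> Obj EC" and Y: "Y \<in> Obj EC" and fE: "f \<in> mor EC X Y"
    and fi: "inflation E (fst X) (fst Y) f"
    using f by (auto simp: inflation_EE_iff)
  have PO: "P \<in> Obj C" using P unfolding injective_object_def by simp
  note O = EC_objD(1)[OF S] EC_objD(1)[OF X] EC_objD(1)[OF Y] PO
  note M = EC_mor[OF fE] EC_mor[OF h]
  obtain k where k: "k \<in> mor C (fst Y) P"
    "Cmp C (fst X) (fst Y) P k f = Cmp C (fst X) (fst S) P p h"
    using injective_extend[OF P fi, of "Cmp C (fst X) (fst S) P p h"] O M p by auto
  let ?t = "tr Y S (Cmp C (fst Y) P (fst S) i k)"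
  have "Cmp C (fst X) (fst Y) (fst S) ?t f =
      tr X S (Cmp C (fst X) (fst Y) (fst S) (Cmp C (fst Y) P (fst S) i k) f)"
    using O k i by (intro tr_Cmp S X Y fE) auto
  also have "\<dots> = tr X S (Cmp C (fst X) (fst S) (fst S) (Cmp C (fst S) P (fst S) i p) h)"
    using O M k i p by (simp flip: Cmp_assoc)
  also have "\<dots> = Cmp C (fst X) (fst S) (fst S) (tr S S (Cmp C (fst S) P (fst S) i p)) h"
    using O i p by (intro tr_Cmp[symmetric] S X h) auto
  also have "\<dots> = h" using tr O M by simp
  finally have "Cmp EC X Y S ?t f = h" by simp
  moreover have "?t \<in> mor EC Y S" using O k i by (intro tr_closed S Y) auto
  ultimately show "\<exists>k \<in> mor EC Y S. Cmp EC X Y S k f = h" by blast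
qed fact

text \<open>The properties of \<open>S P = \<Oplus>\<^sub>\<gamma> \<gamma> P\<close> that matter: \<open>i\<close> and \<open>p\<close> are the inclusion of and the
  projection onto the summand \<open>\<one> P\<close>, and \<open>Q\<close> is the sum of the others. That \<open>tr (i p)\<close> is the
  identity says that the translates of this summand decompose \<open>S P\<close>.\<close>

definition induced :: "'o \<Rightarrow> 'o \<times> ('g \<Rightarrow> 'm) \<Rightarrow> bool" where
  "induced P S \<longleftrightarrow> S \<in> Obj EC \<and> (\<exists>i j p q Q. projective_object C E Q \<and>
     biproduct C P Q (fst S) i j p q \<and>
     (\<forall>\<gamma> \<in> carrier G. \<gamma> \<noteq> \<one> \<longrightarrow> Cmp C (aO \<gamma> P) (fst S) P p
        (twist_to S \<gamma> P i) = zero_mor C (aO \<gamma> P) P) \<and>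
     tr S S (Cmp C (fst S) P (fst S) i p) = Idt C (fst S))"

lemma induced_projective_injective:
  assumes "induced P S" and P: "projective_object C E P"
  shows "projective_object EC EE S" "injective_object EC EE S"
proof -
  obtain i j p q Q where S: "S \<in> Obj EC" and B: "biproduct C P Q (fst S) i j p q"
    and tr: "tr S S (Cmp C (fst S) P (fst S) i p) = Idt C (fst S)"
    using assms(1) unfolding induced_def by blast
  note D = biproductD[OF B]
  show "projective_object EC EE S"
    using projective_if_trace[OF S P D(2,4) tr] .
  show "injective_object EC EE S"
    using injective_if_trace[OF S _ D(2,4) tr] P projective_iff_injective by blast
qed

text \<open>The equivariant map adjoint to \<open>g : P \<rightarrow> X\<close> is \<open>tr (g p)\<close>; its component on the summand
  \<open>\<one> P\<close> is \<open>g\<close> again, so it is a deflation if \<open>g\<close> is one. Dually for \<open>X \<rightarrow> P\<close>.\<close>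

lemma induced_deflation:
  assumes ind: "induced P S" and PO: "P \<in> Obj C" and X: "X \<in> Obj EC" and g: "deflation E P (fst X) g"
  shows "\<exists>k. deflation EE S X k"
proof -
  obtain i j p q Q where S: "S \<in> Obj EC" and Q: "projective_object C E Q"
    and B: "biproduct C P Q (fst S) i j p q"
    and off: "\<And>\<gamma>. \<lbrakk>\<gamma> \<in> carrier G; \<gamma> \<noteq> \<one>\<rbrakk> \<Longrightarrow> Cmp C (aO \<gamma> P) (fst S) P p
        (twist_to S \<gamma> P i) = zero_mor C (aO \<gamma> P) P"
    using ind unfolding induced_def by blast
  note D = biproductD[OF B]
  note [simp] = PO D(1-5) EC_objD(1)[OF X] deflationD(3)[OF g]
  let ?gp = "Cmp C (fst S) P (fst X) g p"
  let ?k = "tr S X ?gp"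
  interpret H: abelian_group "Hom C P (fst X)" by (rule Hom_abelian_group) simp_all
  \<comment> \<open>Only the conjugate for \<open>\<gamma> = \<one>\<close> contributes to the component at \<open>i\<close>.\<close>
  have comp: "Cmp C P (fst S) (fst X) (conj_mor \<gamma> S X ?gp) i =
      (if \<one> = \<gamma> then g else zero_mor C P (fst X))" if gm: "\<gamma> \<in> carrier G" for \<gamma>
  proof (cases "\<gamma> = \<one>")
    case True
    then show ?thesis using conj_one[OF S X, of ?gp] D(6) by (simp flip: Cmp_assoc)
  next
    case False
    then have iv: "inv \<gamma> \<in> carrier G" "inv \<gamma> \<noteq> \<one>" using gm by (simp_all add: inv_eq_1_iff)
    note [simp] = gm inv_str(1)[OF S gm] EC_objD(3)[OF X gm] EC_objD(3)[OF S iv(1)]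
    have i': "aM (inv \<gamma>) P (fst S) i \<in> mor C (aO (inv \<gamma>) P) (aO (inv \<gamma>) (fst S))" by simp
    have "aM \<gamma> (aO (inv \<gamma>) P) (aO (inv \<gamma>) (fst S)) (aM (inv \<gamma>) P (fst S) i) = i" by simp
    then have "Cmp C P (aO \<gamma> (fst S)) (aO \<gamma> P) (aM \<gamma> (fst S) P p) (Cmp C P (fst S) (aO \<gamma> (fst S)) (inv_str S \<gamma>) i)
       = aM \<gamma> (aO (inv \<gamma>) P) P (Cmp C (aO (inv \<gamma>) P) (fst S) P p
         (Cmp C (aO (inv \<gamma>) P) (aO (inv \<gamma>) (fst S)) (fst S) (snd S (inv \<gamma>)) (aM (inv \<gamma>) P (fst S) i)))"
      unfolding inv_str_def by (simp add: aM_Cmp)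
    also have "\<dots> = zero_mor C P (aO \<gamma> P)" unfolding off[OF iv] by simp
    finally have 0: "Cmp C P (aO \<gamma> (fst S)) (aO \<gamma> P) (aM \<gamma> (fst S) P p)
       (Cmp C P (fst S) (aO \<gamma> (fst S)) (inv_str S \<gamma>) i) = zero_mor C P (aO \<gamma> P)" .
    have "Cmp C P (fst S) (fst X) (conj_mor \<gamma> S X ?gp) i =
       Cmp C P (aO \<gamma> P) (fst X) (twist_to X \<gamma> P g)
        (Cmp C P (aO \<gamma> (fst S)) (aO \<gamma> P) (aM \<gamma> (fst S) P p) (Cmp C P (fst S) (aO \<gamma> (fst S)) (inv_str S \<gamma>) i))"
      unfolding conj_mor_def by (simp add: aM_Cmp Cmp_assoc)
    then show ?thesis unfolding 0 using False by simp
  qed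
  have "Cmp C P (fst S) (fst X) ?k i =
      finsum (Hom C P (fst X)) (\<lambda>\<gamma>. Cmp C P (fst S) (fst X) (conj_mor \<gamma> S X ?gp) i) (carrier G)"
    unfolding tr_def using S X by (intro Cmp_finsum_left finite_group) auto
  also have "\<dots> = finsum (Hom C P (fst X)) (\<lambda>\<gamma>. if \<one> = \<gamma> then g else zero_mor C P (fst X)) (carrier G)"
    by (intro H.finsum_cong') (simp_all add: comp)
  also have "\<dots> = g" using H.finsum_singleton[OF one_closed finite_group, of "\<lambda>_. g"] by simp
  finally have ki: "Cmp C P (fst S) (fst X) ?k i = g" .
  have kE: "?k \<in> mor EC S X" by (rule tr_closed) (use S X in simp_all)
  have "deflation E (fst S) (fst X) ?k"
    by (rule deflation_from_component[OF B PO Q _ EC_mor[OF kE]]) (simp_all add: ki g)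
  then show ?thesis using S X kE deflation_EE_iff by blast
qed

lemma induced_inflation:
  assumes ind: "induced P S" and PO: "P \<in> Obj C" and X: "X \<in> Obj EC" and f: "inflation E (fst X) P f"
  shows "\<exists>k. inflation EE X S k"
proof -
  obtain i j p q Q where S: "S \<in> Obj EC" and Q: "projective_object C E Q"
    and B: "biproduct C P Q (fst S) i j p q"
    and off: "\<And>\<gamma>. \<lbrakk>\<gamma> \<in> carrier G; \<gamma> \<noteq> \<one>\<rbrakk> \<Longrightarrow> Cmp C (aO \<gamma> P) (fst S) P p
        (twist_to S \<gamma> P i) = zero_mor C (aO \<gamma> P) P"
    using ind unfolding induced_def by blast
  note D = biproductD[OF B]
  note [simp] = PO D(1-5) EC_objD(1)[OF X] inflationD(3)[OF f]
  let ?if = "Cmp C (fst X) P (fst S) i f"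
  let ?k = "tr X S ?if"
  interpret H: abelian_group "Hom C (fst X) P" by (rule Hom_abelian_group) simp_all
  have comp: "Cmp C (fst X) (fst S) P p (conj_mor \<gamma> X S ?if) =
      (if \<one> = \<gamma> then f else zero_mor C (fst X) P)" if gm: "\<gamma> \<in> carrier G" for \<gamma>
  proof (cases "\<gamma> = \<one>")
    case True
    then show ?thesis using conj_one[OF X S, of ?if] D(6) by (simp add: Cmp_assoc)
  next
    case False
    note [simp] = gm inv_str(1)[OF X gm] EC_objD(3)[OF S gm]
    have "Cmp C (fst X) (fst S) P p (conj_mor \<gamma> X S ?if) =
       Cmp C (fst X) (aO \<gamma> P) P (Cmp C (aO \<gamma> P) (fst S) P p
        (twist_to S \<gamma> P i))
        (Cmp C (fst X) (aO \<gamma> (fst X)) (aO \<gamma> P) (aM \<gamma> (fst X) P f) (inv_str X \<gamma>))"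
      unfolding conj_mor_def by (simp add: aM_Cmp Cmp_assoc)
    then show ?thesis unfolding off[OF gm False] using False by simp
  qed
  have "Cmp C (fst X) (fst S) P p ?k =
      finsum (Hom C (fst X) P) (\<lambda>\<gamma>. Cmp C (fst X) (fst S) P p (conj_mor \<gamma> X S ?if)) (carrier G)"
    unfolding tr_def using S X by (intro Cmp_finsum_right finite_group) auto
  also have "\<dots> = finsum (Hom C (fst X) P) (\<lambda>\<gamma>. if \<one> = \<gamma> then f else zero_mor C (fst X) P) (carrier G)"
    by (intro H.finsum_cong') (simp_all add: comp)
  also have "\<dots> = f" using H.finsum_singleton[OF one_closed finite_group, of "\<lambda>_. f"] by simp
  finally have pk: "Cmp C (fst X) (fst S) P p ?k = f" .
  have kE: "?k \<in> mor EC X S" by (rule tr_closed) (use S X in simp_all)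
  have "injective_object C E Q" using Q projective_iff_injective by blast
  then have "inflation E (fst X) (fst S) ?k"
    by (rule inflation_from_component[OF B PO _ _ EC_mor[OF kE]]) (simp_all add: pk f)
  then show ?thesis using S X kE inflation_EE_iff by blast
qed

text \<open>A deflation from an induced object onto a projective object splits, and so does an inflation
  of an injective object into an induced one. Induced objects are projective and injective, and
  both properties pass to retracts; hence the two classes are the summands of induced objects.\<close>

theorem EC_frobenius:
  assumes ind: "\<And>P. projective_object C E P \<Longrightarrow> induced P (S P)"
  shows "frobenius_category EC EE"
    and "\<And>Q. Q \<in> Obj EC \<Longrightarrow> projective_injective EC EE Q \<longleftrightarrow>
      (\<exists>P. projective_object C E P \<and> direct_summand EC Q (S P))"
proof -
  interpret X: exact_category EC EE by (rule EC_exact)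
  have defl: "\<exists>P k. projective_object C E P \<and> deflation EE (S P) Q k" if Q: "Q \<in> Obj EC" for Q
  proof -
    obtain P g where P: "projective_object C E P" "deflation E P (fst Q) g"
      using enough_projectives[OF EC_objD(1)[OF Q]] by blast
    then show ?thesis using induced_deflation[OF ind[OF P(1)] deflationD(1)[OF P(2)] Q P(2)] by blast
  qed
  have infl: "\<exists>P k. projective_object C E P \<and> inflation EE Q (S P) k" if Q: "Q \<in> Obj EC" for Q
  proof -
    obtain P f where P: "injective_object C E P" "inflation E (fst Q) P f"
      using enough_injectives[OF EC_objD(1)[OF Q]] by blast
    have "projective_object C E P" using P projective_iff_injective by blast
    then show ?thesis using induced_inflation[OF ind _ Q P(2)] inflationD(2)[OF P(2)] by blast
  qed
  have pr: "\<exists>P. projective_object C E P \<and> direct_summand EC Q (S P)"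
    if Q: "projective_object EC EE Q" for Q
  proof -
    have QO: "Q \<in> Obj EC" using Q unfolding projective_object_def by simp
    obtain P k where P: "projective_object C E P" "deflation EE (S P) Q k"
      using defl[OF QO] by blast
    obtain s where "s \<in> mor EC Q (S P)" "Cmp EC Q (S P) Q k s = Idt EC Q"
      using X.projective_lift[OF Q P(2) EC.Idt_closed[OF QO]] by blast
    moreover obtain A f where "(A, f, S P, k, Q) \<in> EE" using P(2) unfolding deflation_def by blast
    ultimately show ?thesis using P(1) EC.direct_summand_of_section[OF EE_kernel_cokernel] by blast
  qed
  have inj: "projective_object EC EE Q" if Q: "injective_object EC EE Q" for Q
  proof -
    have QO: "Q \<in> Obj EC" using Q unfolding injective_object_def by simp
    obtain P k where P: "projective_object C E P" and k: "inflation EE Q (S P) k"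
      using infl[OF QO] by blast
    obtain r where "r \<in> mor EC (S P) Q" "Cmp EC Q (S P) Q r k = Idt EC Q"
      using X.injective_extend[OF Q k EC.Idt_closed[OF QO]] by blast
    then show ?thesis
      using X.projective_object_retract[OF induced_projective_injective(1)[OF ind[OF P] P] QO]
        X.inflationD(3)[OF k] by blast
  qed
  have conv: "projective_object EC EE Q" "injective_object EC EE Q"
    if P: "projective_object C E P" and Q: "direct_summand EC Q (S P)" for P Q
  proof -
    note SP = induced_projective_injective[OF ind[OF P] P]
    show "projective_object EC EE Q" "injective_object EC EE Q"
      using Q X.projective_object_retract[OF SP(1)] X.injective_object_retract[OF SP(2)]
      by (meson EC.direct_summandE)+
  qed
  show "frobenius_category EC EE"
  proof (intro frobenius_category.intro frobenius_category_axioms.intro EC_exact)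
    fix Q assume Q: "Q \<in> Obj EC"
    show "\<exists>P g. projective_object EC EE P \<and> deflation EE P Q g"
      using defl[OF Q] induced_projective_injective[OF ind] by blast
    show "\<exists>I f. injective_object EC EE I \<and> inflation EE Q I f"
      using infl[OF Q] induced_projective_injective[OF ind] by blast
  next
    fix Q show "projective_object EC EE Q \<longleftrightarrow> injective_object EC EE Q"
      using pr inj conv by blast
  qed
  show "projective_injective EC EE Q \<longleftrightarrow>
      (\<exists>P. projective_object C E P \<and> direct_summand EC Q (S P))" if "Q \<in> Obj EC" for Q
    using pr conv unfolding projective_injective_def by blast
qed

end

section \<open>Direct sums in a cyclic poset\<close>

text \<open>The structure maps of \<open>S P\<close>, and the inclusions and projections of blocks of positions, are
  given by partial maps of positions; \<open>index_mor\<close> is the matrix of the partial map \<open>\<pi>\<close> with domain \<open>A\<close>.\<close>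

definition index_mor :: "('r, 'e) ring_scheme \<Rightarrow> 'x list \<Rightarrow> 'x list \<Rightarrow> nat set \<Rightarrow> (nat \<Rightarrow> nat) \<Rightarrow> nat \<times> nat \<Rightarrow> 'r" where
  "index_mor R Xs Ys A \<pi> =
    (\<lambda>(r, s) \<in> matrix_indices Xs Ys. if s \<in> A \<and> r = \<pi> s then \<one>\<^bsub>R\<^esub> else \<zero>\<^bsub>R\<^esub>)"

lemma index_mor_cong:
  assumes "length Xs = length Xs'" "length Ys = length Ys'"
    and "\<And>s. s < length Xs \<Longrightarrow> s \<in> A \<longleftrightarrow> s \<in> B"
    and "\<And>s. \<lbrakk>s < length Xs; s \<in> A\<rbrakk> \<Longrightarrow> \<pi> s = \<rho> s"
  shows "index_mor R Xs Ys A \<pi> = index_mor R Xs' Ys' B \<rho>"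
  unfolding index_mor_def using assms by (auto simp: fun_eq_iff restrict_def)

locale hull_setting = cyclic_poset XX c + domain R
  for XX :: "'x set" and c :: "'x \<Rightarrow> 'x \<Rightarrow> 'x \<Rightarrow> nat" and R :: "'r ring" (structure) +
  fixes u :: 'r
  assumes u_closed [simp]: "u \<in> carrier R"
begin

abbreviation F where "F \<equiv> add_P R u XX c"

lemma Obj_F [simp]: "Obj F = lists XX"
  unfolding add_P_def additive_hull_def cyclic_poset_category_def by simp

lemma mor_F_iff: "M \<in> mor F Xs Ys \<longleftrightarrow> M \<in> extensional (matrix_indices Xs Ys) \<and>
    (\<forall>r < length Ys. \<forall>s < length Xs. M (r, s) \<in> carrier R)"
  unfolding add_P_def additive_hull_def cyclic_poset_category_def
  by (auto simp: PiE_def Pi_def)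

lemma zero_F: "zero_mor F Xs Ys = (\<lambda>(r, s) \<in> matrix_indices Xs Ys. \<zero>)"
  unfolding add_P_def additive_hull_def cyclic_poset_category_def by simp

lemma add_F: "M \<oplus>\<^bsub>Hom F Xs Ys\<^esub> N = (\<lambda>(r, s) \<in> matrix_indices Xs Ys. M (r, s) \<oplus> N (r, s))"
  unfolding add_P_def additive_hull_def cyclic_poset_category_def by simp

lemma Idt_F: "Idt F Xs = (\<lambda>(r, s) \<in> matrix_indices Xs Xs. if r = s then \<one> else \<zero>)"
  unfolding add_P_def additive_hull_def cyclic_poset_category_def by (auto simp: fun_eq_iff)

lemma Cmp_F: "Cmp F Xs Ys Zs N M = (\<lambda>(k, i) \<in> matrix_indices Xs Zs.
    \<Oplus>j\<in>{..<length Ys}. u [^] c (Xs ! i) (Ys ! j) (Zs ! k) \<otimes> (N (k, j) \<otimes> M (j, i)))"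
  unfolding add_P_def additive_hull_def cyclic_poset_category_def by simp

lemma mor_F_eqI:
  assumes "M \<in> mor F Xs Ys" "N \<in> mor F Xs Ys"
    and "\<And>r s. \<lbrakk>r < length Ys; s < length Xs\<rbrakk> \<Longrightarrow> M (r, s) = N (r, s)"
  shows "M = N"
  using assms unfolding mor_F_iff by (intro extensionalityI[of M _ N]) auto

lemma index_mor_closed [simp]: "index_mor R Xs Ys A \<pi> \<in> mor F Xs Ys"
  unfolding mor_F_iff index_mor_def by simp

lemma Idt_index_mor: "Idt F Xs = index_mor R Xs Xs UNIV (\<lambda>s. s)"
  unfolding Idt_F index_mor_def by simp

lemma zero_index_mor: "zero_mor F Xs Ys = index_mor R Xs Ys {} \<pi>"
  unfolding zero_F index_mor_def by simp

lemma add_index_mor: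
  assumes "A \<inter> B = {}"
  shows "index_mor R Xs Ys A \<pi> \<oplus>\<^bsub>Hom F Xs Ys\<^esub> index_mor R Xs Ys B \<pi> = index_mor R Xs Ys (A \<union> B) \<pi>"
  unfolding add_F index_mor_def using assms by (auto simp: fun_eq_iff restrict_def)

text \<open>As \<open>\<rho>\<close> relates equal entries of the lists, only factors \<open>u\<close> to the power \<open>c X X Z\<close> occur, and
  these are \<open>\<one>\<close> because the cocycle is reduced.\<close>

lemma Cmp_index_mor:
  assumes XO: "Xs \<in> lists XX" and ZO: "Zs \<in> lists XX"
    and rho: "\<And>s. \<lbrakk>s < length Xs; s \<in> B\<rbrakk> \<Longrightarrow> \<rho> s < length Ys \<and> Ys ! \<rho> s = Xs ! s"
  shows "Cmp F Xs Ys Zs (index_mor R Ys Zs A \<pi>) (index_mor R Xs Ys B \<rho>) =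
    index_mor R Xs Zs {s \<in> B. \<rho> s \<in> A} (\<lambda>s. \<pi> (\<rho> s))"
proof -
  have "(\<Oplus>j\<in>{..<length Ys}. u [^] c (Xs ! s) (Ys ! j) (Zs ! k) \<otimes>
      (index_mor R Ys Zs A \<pi> (k, j) \<otimes> index_mor R Xs Ys B \<rho> (j, s))) =
     (if s \<in> B \<and> \<rho> s \<in> A \<and> k = \<pi> (\<rho> s) then \<one> else \<zero>)"
    if k: "k < length Zs" and s: "s < length Xs" for k s
  proof -
    have O: "Xs ! s \<in> XX" "Zs ! k \<in> XX" using k s XO ZO by (simp_all add: in_lists_conv_set)
    show ?thesis
    proof (cases "s \<in> B")
      case False
      then have "(\<Oplus>j\<in>{..<length Ys}. u [^] c (Xs ! s) (Ys ! j) (Zs ! k) \<otimes>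
          (index_mor R Ys Zs A \<pi> (k, j) \<otimes> index_mor R Xs Ys B \<rho> (j, s))) = (\<Oplus>j\<in>{..<length Ys}. \<zero>)"
        using k s by (intro add.finprod_cong') (auto simp: index_mor_def)
      then show ?thesis using False by simp
    next
      case True
      note r = rho[OF s True]
      have "(\<Oplus>j\<in>{..<length Ys}. u [^] c (Xs ! s) (Ys ! j) (Zs ! k) \<otimes>
          (index_mor R Ys Zs A \<pi> (k, j) \<otimes> index_mor R Xs Ys B \<rho> (j, s))) =
        (\<Oplus>j\<in>{..<length Ys}. if \<rho> s = j then if \<rho> s \<in> A \<and> k = \<pi> (\<rho> s) then \<one> else \<zero> else \<zero>)"
        using k s True r reduced_left[OF O]
        by (intro add.finprod_cong') (auto simp: index_mor_def)
      also have "\<dots> = (if \<rho> s \<in> A \<and> k = \<pi> (\<rho> s) then \<one> else \<zero>)"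
        using r by (intro finsum_singleton) auto
      finally show ?thesis using True by simp
    qed
  qed
  then show ?thesis
    unfolding Cmp_F by (subst (3) index_mor_def) (auto simp: fun_eq_iff restrict_def)
qed

text \<open>To be applied to the head of a list, to an arbitrary entry, and to the summand of \<open>S P\<close> indexed
  by the neutral element; the first map and the projection are explicit for the sake of the last.\<close>

lemma block_biproduct:
  assumes S: "Ss \<in> lists XX" and lo: "lo + m \<le> length Ss"
    and P: "length Ps = m" "\<And>k. k < m \<Longrightarrow> Ps ! k = Ss ! (lo + k)"
  defines "Qs \<equiv> take lo Ss @ drop (lo + m) Ss"
  shows "\<exists>j q. biproduct F Ps Qs Ss (index_mor R Ps Ss UNIV (\<lambda>k. lo + k)) j
     (index_mor R Ss Ps {lo..<lo + m} (\<lambda>s. s - lo)) q"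
proof (intro exI)
  have PO: "Ps \<in> lists XX"
    using S lo P by (fastforce simp: in_lists_conv_set in_set_conv_nth[of _ Ps] dest: nth_mem)
  have QO: "Qs \<in> lists XX"
    using S unfolding Qs_def by (auto dest: in_set_takeD in_set_dropD)
  have Ql: "length Qs = length Ss - m" unfolding Qs_def using lo by simp
  let ?f = "\<lambda>k. if k < lo then k else k + m" and ?g = "\<lambda>s. if s < lo then s else s - m"
  have Qnth: "Qs ! k = Ss ! ?f k" if "k < length Ss - m" for k
    using that lo unfolding Qs_def by (auto simp: nth_append add.commute)
  let ?i = "index_mor R Ps Ss UNIV (\<lambda>k. lo + k)" and ?p = "index_mor R Ss Ps {lo..<lo + m} (\<lambda>s. s - lo)"
  let ?j = "index_mor R Qs Ss UNIV ?f" and ?q = "index_mor R Ss Qs (- {lo..<lo + m}) ?g"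
  have i: "lo + k < length Ss \<and> Ss ! (lo + k) = Ps ! k" if "k < length Ps" for k
    using that lo P by simp
  have j: "?f k < length Ss \<and> Ss ! ?f k = Qs ! k" if "k < length Qs" for k
    using that lo Ql Qnth[of k] by auto
  have p: "s - lo < length Ps \<and> Ps ! (s - lo) = Ss ! s" if "s \<in> {lo..<lo + m}" for s
    using that lo P by auto
  have q: "?g s < length Qs \<and> Qs ! ?g s = Ss ! s" if "s < length Ss" "s \<in> - {lo..<lo + m}" for s
    using that lo Ql Qnth[of "?g s"] by auto
  have "Cmp F Ps Ss Ps ?p ?i = Idt F Ps"
    unfolding Idt_index_mor by (subst Cmp_index_mor[OF PO PO])
      (use i P in \<open>auto intro!: index_mor_cong\<close>)
  moreover have "Cmp F Qs Ss Qs ?q ?j = Idt F Qs"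
    unfolding Idt_index_mor by (subst Cmp_index_mor[OF QO QO])
      (use j in \<open>auto intro!: index_mor_cong\<close>)
  moreover have "Cmp F Ps Ss Qs ?q ?i = zero_mor F Ps Qs"
    unfolding zero_index_mor[of _ _ "\<lambda>s. ?g (lo + s)"] by (subst Cmp_index_mor[OF PO QO])
      (use i P in \<open>auto intro!: index_mor_cong\<close>)
  moreover have "Cmp F Qs Ss Ps ?p ?j = zero_mor F Qs Ps"
    unfolding zero_index_mor[of _ _ "\<lambda>s. ?f s - lo"] by (subst Cmp_index_mor[OF QO PO])
      (use j in \<open>auto intro!: index_mor_cong\<close>)
  moreover have "Cmp F Ss Ps Ss ?i ?p \<oplus>\<^bsub>Hom F Ss Ss\<^esub> Cmp F Ss Qs Ss ?j ?q = Idt F Ss"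
  proof -
    have 1: "Cmp F Ss Ps Ss ?i ?p = index_mor R Ss Ss {lo..<lo + m} (\<lambda>s. s)"
      by (subst Cmp_index_mor[OF S S]) (use p in \<open>auto intro!: index_mor_cong\<close>)
    have 2: "Cmp F Ss Qs Ss ?j ?q = index_mor R Ss Ss (- {lo..<lo + m}) (\<lambda>s. s)"
      by (subst Cmp_index_mor[OF S S]) (use q in \<open>auto intro!: index_mor_cong\<close>)
    show ?thesis unfolding 1 2 Idt_index_mor by (subst add_index_mor) auto
  qed
  ultimately show "biproduct F Ps Qs Ss ?i ?j ?p ?q"
    unfolding biproduct_def using S by simp
qed

end

section \<open>Projective objects of a Frobenius cyclic poset\<close>

lemma uniformizer_not_unit:
  assumes "discrete_valuation_ring R" "uniformizer R u"
  shows "u \<notin> Units R"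
proof
  interpret discrete_valuation_ring R by fact
  assume u: "u \<in> Units R"
  interpret M: maximalideal "PIdl\<^bsub>R\<^esub> u" R using assms(2) unfolding uniformizer_def by simp
  obtain v where v: "v \<in> carrier R" "v \<otimes>\<^bsub>R\<^esub> u = \<one>\<^bsub>R\<^esub>" using u unfolding Units_def by blast
  then have "\<one>\<^bsub>R\<^esub> \<in> PIdl\<^bsub>R\<^esub> u" unfolding cgenideal_def by force
  then show False using M.one_imp_carrier M.I_notcarr by simp
qed

text \<open>A Frobenius cyclic poset together with the Frobenius structure \<open>E\<close> that it provides for one
  choice of \<open>(R, u)\<close>.\<close>

locale frobenius_hull = hull_setting XX c R u + frobenius_category "add_P R u XX c" E
  for XX :: "'x set" and c :: "'x \<Rightarrow> 'x \<Rightarrow> 'x \<Rightarrow> nat" and R :: "'r ring" (structure) and u :: 'r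
    and E :: "('x list, nat \<times> nat \<Rightarrow> 'r) sequence set" +
  fixes XX\<^sub>0 :: "'x set"
  assumes u_not_unit: "u \<notin> Units R"
    and XX0_subset: "XX\<^sub>0 \<subseteq> XX"
    and XX0_iso_closed: "\<lbrakk>X \<in> XX\<^sub>0; Y \<in> XX; c X Y X = 0\<rbrakk> \<Longrightarrow> Y \<in> XX\<^sub>0"
    and indecomposable_projective_injective_iff: "A \<in> lists XX \<Longrightarrow>
      indecomposable (add_P R u XX c) A \<and> projective_injective (add_P R u XX c) E A \<longleftrightarrow>
      (\<exists>X \<in> XX\<^sub>0. isomorphic (add_P R u XX c) A [X])"
begin

lemma Cmp_singletons:
  assumes "N \<in> mor F [Y] [Z]" "M \<in> mor F [X] [Y]"
  shows "Cmp F [X] [Y] [Z] N M (0, 0) = u [^] c X Y Z \<otimes> (N (0, 0) \<otimes> M (0, 0))"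
proof -
  have *: "N (0, 0) \<in> carrier R" "M (0, 0) \<in> carrier R" using assms by (simp_all add: mor_F_iff)
  have "{..<Suc 0} = {0}" by auto
  then show ?thesis using * by (simp add: Cmp_F)
qed

lemma isomorphic_singletons:
  assumes "isomorphic F [Y] [X]" shows "c X Y X = 0"
proof (rule ccontr)
  assume "c X Y X \<noteq> 0"
  then obtain n where n: "c X Y X = Suc n" by (cases "c X Y X") auto
  obtain f g where f: "f \<in> mor F [Y] [X]" and g: "g \<in> mor F [X] [Y]" and fg: "Cmp F [X] [Y] [X] f g = Idt F [X]"
    using assms unfolding isomorphic_def iso_mor_def by blast
  have cl: "f (0, 0) \<in> carrier R" "g (0, 0) \<in> carrier R" using f g by (simp_all add: mor_F_iff)
  have "u [^] Suc n \<otimes> (f (0, 0) \<otimes> g (0, 0)) = \<one>"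
    using Cmp_singletons[OF f g] fg n by (simp add: Idt_F)
  then have "u \<otimes> (u [^] n \<otimes> (f (0, 0) \<otimes> g (0, 0))) = \<one>"
    using cl by (simp add: m_ac)
  then have "u \<in> Units R"
    using cl m_comm[of u "u [^] n \<otimes> (f (0, 0) \<otimes> g (0, 0))"] unfolding Units_def by force
  then show False using u_not_unit by simp
qed

text \<open>The endomorphism ring of \<open>[X]\<close> is \<open>R\<close>, and a domain has only trivial idempotents.\<close>

lemma indecomposable_singleton:
  assumes X: "X \<in> XX"
  shows "indecomposable F [X]"
  unfolding indecomposable_def
proof (intro conjI ballI impI)
  have XO: "[X] \<in> Obj F" using X by simp
  then show "[X] \<in> Obj F" .
  have nz: "Idt F [X] \<noteq> zero_mor F [X] [X]"
  proof
    assume "Idt F [X] = zero_mor F [X] [X]"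
    from fun_cong[OF this, of "(0, 0)"] show False by (simp add: Idt_F zero_F)
  qed
  show "\<not> zero_object F [X]"
  proof
    assume "zero_object F [X]"
    then have "mor F [X] [X] = {zero_mor F [X] [X]}" using XO unfolding zero_object_def by blast
    then show False using Idt_closed[OF XO] nz by auto
  qed
  fix A B assume A: "A \<in> Obj F" and B: "B \<in> Obj F" and "is_direct_sum F A B [X]"
  then obtain i j p q where bp: "biproduct F A B [X] i j p q" unfolding is_direct_sum_def by blast
  note D = biproductD[OF bp]
  let ?e = "Cmp F [X] A [X] i p"
  have e: "?e \<in> mor F [X] [X]" using D A XO by simp
  define r where "r = ?e (0, 0)"
  have r: "r \<in> carrier R" using e unfolding r_def by (simp add: mor_F_iff)
  have pe: "Cmp F [X] [X] A p ?e = p" using D A XO by (simp add: Cmp_assoc)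
  then have "Cmp F [X] [X] [X] ?e ?e = ?e" using D A XO by (simp flip: Cmp_assoc)
  then have "r \<otimes> r = r"
    using Cmp_singletons[OF e e] reduced_left[OF X X] r unfolding r_def by simp
  then have "r \<otimes> (r \<ominus> \<one>) = \<zero>" using r by (simp add: a_minus_def r_distr r_minus r_neg)
  then have "r = \<zero> \<or> r \<ominus> \<one> = \<zero>" using integral[of r "r \<ominus> \<one>"] r by simp
  moreover have "r = (r \<ominus> \<one>) \<oplus> \<one>" using r by (simp add: a_minus_def a_assoc l_neg)
  ultimately consider "r = \<zero>" | "r = \<one>" by fastforce
  then show "zero_object F A \<or> zero_object F B"
  proof cases
    case 1
    have "?e = zero_mor F [X] [X]"
      by (rule mor_F_eqI[OF e zero_mor_closed[OF XO XO]]) (use 1 in \<open>simp add: zero_F r_def\<close>)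
    then have "p = zero_mor F [X] A" using pe D A XO by simp
    then have "Idt F A = zero_mor F A A" using D(1-6) A by simp
    then show ?thesis using zero_objectI[OF A] by blast
  next
    case 2
    have "?e = Idt F [X]"
      by (rule mor_F_eqI[OF e Idt_closed[OF XO]]) (use 2 in \<open>simp add: Idt_F r_def\<close>)
    then have "j = Cmp F B [X] [X] ?e j" using D B XO by simp
    also have "\<dots> = zero_mor F B [X]" using D(1-5,9) A B by (simp flip: Cmp_assoc)
    finally have "Idt F B = zero_mor F B B" using D(1-7) B by simp
    then show ?thesis using zero_objectI[OF B] by blast
  qed
qed

lemma projective_singleton_iff:
  assumes X: "X \<in> XX"
  shows "projective_object F E [X] \<longleftrightarrow> X \<in> XX\<^sub>0"
proof
  assume "projective_object F E [X]"
  then have "projective_injective F E [X]"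
    using projective_iff_injective unfolding projective_injective_def by blast
  then obtain Y where "Y \<in> XX\<^sub>0" "isomorphic F [X] [Y]"
    using indecomposable_projective_injective_iff[of "[X]"] indecomposable_singleton[OF X] X by auto
  then show "X \<in> XX\<^sub>0" using XX0_iso_closed X isomorphic_singletons by blast
next
  assume X0: "X \<in> XX\<^sub>0"
  have "isomorphic F [X] [X]"
    unfolding isomorphic_def using iso_mor_Idt[of "[X]"] X by auto
  then show "projective_object F E [X]"
    using indecomposable_projective_injective_iff[of "[X]"] X X0 unfolding projective_injective_def by auto
qed

text \<open>The entries of a projective list are direct summands of it, hence projective, and they are
  indecomposable; so they lie in \<open>XX\<^sub>0\<close>.\<close>

theorem projective_object_iff: "projective_object F E Ps \<longleftrightarrow> Ps \<in> lists XX\<^sub>0"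
proof
  assume P: "projective_object F E Ps"
  then have PO: "Ps \<in> lists XX" unfolding projective_object_def by simp
  have "Ps ! k \<in> XX\<^sub>0" if k: "k < length Ps" for k
  proof -
    have X: "Ps ! k \<in> XX" using PO k by (simp add: in_lists_conv_set)
    obtain j q where "biproduct F [Ps ! k] (take k Ps @ drop (k + 1) Ps) Ps
        (index_mor R [Ps ! k] Ps UNIV (\<lambda>l. k + l)) j (index_mor R Ps [Ps ! k] {k..<k + 1} (\<lambda>s. s - k)) q"
      using block_biproduct[OF PO, of k 1 "[Ps ! k]"] k by auto
    moreover have "take k Ps @ drop (k + 1) Ps \<in> Obj F"
      using PO by (auto dest: in_set_takeD in_set_dropD)
    moreover have "[Ps ! k] \<in> Obj F" using X by simp
    ultimately have "direct_summand F [Ps ! k] Ps"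
      unfolding direct_summand_def is_direct_sum_def by blast
    then show ?thesis
      using projective_object_retract[OF P] projective_singleton_iff[OF X]
      by (meson direct_summandE)
  qed
  then show "Ps \<in> lists XX\<^sub>0" by (auto simp: in_lists_conv_set in_set_conv_nth)
next
  assume "Ps \<in> lists XX\<^sub>0"
  then show "projective_object F E Ps"
  proof (induction Ps)
    case Nil
    have N: "[] \<in> Obj F" by simp
    have "zero_object F []"
      by (rule zero_objectI[OF N]) (simp add: Idt_F zero_F restrict_def)
    then have "mor F [] Z = {zero_mor F [] Z}" if "Z \<in> Obj F" for Z
      using that unfolding zero_object_def by blast
    then show ?case unfolding projective_object_def
      using N deflationD Cmp_zero_right[OF N] zero_mor_closed[OF N] by (metis singletonD)
  next
    case (Cons X Ps)
    have XP: "X \<in> XX" "Ps \<in> lists XX" "X # Ps \<in> lists XX"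
      using Cons.hyps XX0_subset by (auto dest: subsetD)
    obtain i j p q where "biproduct F [X] Ps (X # Ps) i j p q"
      using block_biproduct[OF XP(3), of 0 1 "[X]"] by auto
    moreover have "projective_object F E [X]" using projective_singleton_iff XP Cons.hyps by blast
    ultimately show ?case using projective_object_biproduct Cons.IH by blast
  qed
qed

lemma frobenius_sequences_eq: "frobenius_sequences R u XX c XX\<^sub>0 = E"
proof (rule Set.set_eqI)
  fix s :: "('x list, nat \<times> nat \<Rightarrow> 'r) sequence"
  obtain X f Y g Z where s: "s = (X, f, Y, g, Z)" by (cases s)
  show "s \<in> frobenius_sequences R u XX c XX\<^sub>0 \<longleftrightarrow> s \<in> E"
    unfolding s in_E_iff_short_exact frobenius_sequences_def Let_def projective_object_iff
    by (simp add: Ball_def)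
qed

end

section \<open>Group actions on a Frobenius cyclic poset\<close>

locale hull_action = frobenius_hull XX c R u E XX\<^sub>0 + G: group G
  for XX :: "'x set" and c :: "'x \<Rightarrow> 'x \<Rightarrow> 'x \<Rightarrow> nat" and R :: "'r ring" (structure) and u :: 'r
    and E :: "('x list, nat \<times> nat \<Rightarrow> 'r) sequence set" and XX\<^sub>0 :: "'x set"
    and G :: "('g, 'e) monoid_scheme" +
  fixes \<phi> :: "'g \<Rightarrow> 'x \<Rightarrow> 'x" and gs :: "'g list"
  assumes action: "acts_on_frobenius_cyclic_poset G XX c XX\<^sub>0 \<phi>"
    and gs: "distinct gs" "set gs = carrier G"
begin

lemma phi_closed [simp]: "\<lbrakk>\<gamma> \<in> carrier G; X \<in> XX\<rbrakk> \<Longrightarrow> \<phi> \<gamma> X \<in> XX"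
  using action group_action.element_image unfolding acts_on_frobenius_cyclic_poset_def by fast

lemma phi_mult: "\<lbrakk>\<alpha> \<in> carrier G; \<beta> \<in> carrier G; X \<in> XX\<rbrakk> \<Longrightarrow> \<phi> \<alpha> (\<phi> \<beta> X) = \<phi> (\<alpha> \<otimes>\<^bsub>G\<^esub> \<beta>) X"
  using action group_action.composition_rule unfolding acts_on_frobenius_cyclic_poset_def by metis

lemma phi_one: "X \<in> XX \<Longrightarrow> \<phi> \<one>\<^bsub>G\<^esub> X = X"
  using action group_action.id_eq_one unfolding acts_on_frobenius_cyclic_poset_def by (metis restrict_apply')

lemma phi_c: "\<lbrakk>\<gamma> \<in> carrier G; X \<in> XX; Y \<in> XX; Z \<in> XX\<rbrakk> \<Longrightarrow> c (\<phi> \<gamma> X) (\<phi> \<gamma> Y) (\<phi> \<gamma> Z) = c X Y Z"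
  using action unfolding acts_on_frobenius_cyclic_poset_def by blast

lemma phi_XX0: "\<lbrakk>\<gamma> \<in> carrier G; X \<in> XX\<^sub>0\<rbrakk> \<Longrightarrow> \<phi> \<gamma> X \<in> XX\<^sub>0"
  using action unfolding acts_on_frobenius_cyclic_poset_def by blast

lemma strict_action_hull: "strict_action F G (hull_action_obj \<phi>) hull_action_mor"
proof (intro strict_action.intro strict_action_axioms.intro)
  show "preadditive_category F" by (rule preadditive_category_axioms)
  show "group G" by (rule G.group_axioms)
next
  fix \<gamma> Xs assume "\<gamma> \<in> carrier G" "Xs \<in> Obj F"
  then show "hull_action_obj \<phi> \<gamma> Xs \<in> Obj F" by (auto simp: hull_action_obj_def)
next
  fix \<alpha> \<beta> Xs assume "\<alpha> \<in> carrier G" "\<beta> \<in> carrier G" "Xs \<in> Obj F"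
  then show "hull_action_obj \<phi> \<alpha> (hull_action_obj \<phi> \<beta> Xs) = hull_action_obj \<phi> (\<alpha> \<otimes>\<^bsub>G\<^esub> \<beta>) Xs"
    by (auto simp: hull_action_obj_def phi_mult)
next
  fix Xs assume "Xs \<in> Obj F"
  then show "hull_action_obj \<phi> \<one>\<^bsub>G\<^esub> Xs = Xs"
    by (auto simp: hull_action_obj_def phi_one intro: map_idI)
next
  fix \<gamma> Xs Ys Zs f g
  assume *: "\<gamma> \<in> carrier G" "Xs \<in> Obj F" "Ys \<in> Obj F" "Zs \<in> Obj F" "f \<in> mor F Xs Ys" "g \<in> mor F Ys Zs"
  have "(\<Oplus>j\<in>{..<length Ys}. u [^] c (Xs ! i) (Ys ! j) (Zs ! k) \<otimes> (g (k, j) \<otimes> f (j, i))) =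
      (\<Oplus>j\<in>{..<length Ys}. u [^] c (\<phi> \<gamma> (Xs ! i)) (map (\<phi> \<gamma>) Ys ! j) (\<phi> \<gamma> (Zs ! k)) \<otimes> (g (k, j) \<otimes> f (j, i)))"
    if "i < length Xs" "k < length Zs" for i k
    using that * by (intro add.finprod_cong') (auto simp: mor_F_iff phi_c in_lists_conv_set)
  then show "hull_action_mor \<gamma> Xs Zs (Cmp F Xs Ys Zs g f) =
    Cmp F (hull_action_obj \<phi> \<gamma> Xs) (hull_action_obj \<phi> \<gamma> Ys) (hull_action_obj \<phi> \<gamma> Zs)
      (hull_action_mor \<gamma> Ys Zs g) (hull_action_mor \<gamma> Xs Ys f)"
    by (auto simp: hull_action_mor_def hull_action_obj_def Cmp_F fun_eq_iff restrict_def)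
qed (auto simp: hull_action_mor_def hull_action_obj_def mor_F_iff Idt_F add_F)

lemma finite_G: "finite (carrier G)"
  unfolding gs(2)[symmetric] by simp

sublocale act: frobenius_action "add_P R u XX c" G "hull_action_obj \<phi>" hull_action_mor E
  by (intro frobenius_action.intro strict_action_hull frobenius_category_axioms
      frobenius_action_axioms.intro finite_G)

text \<open>In \<open>S P\<close> with \<open>m = length P\<close>, position \<open>s\<close> belongs to the summand indexed by \<open>gs ! (s div m)\<close>, and the
  structure map of \<open>\<beta>\<close> permutes the positions by \<open>shift m \<beta>\<close>.\<close>

definition idx :: "'g \<Rightarrow> nat" where "idx \<gamma> = (THE a. a < length gs \<and> gs ! a = \<gamma>)"

definition shift :: "nat \<Rightarrow> 'g \<Rightarrow> nat \<Rightarrow> nat" where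
  "shift m \<beta> s = idx (\<beta> \<otimes>\<^bsub>G\<^esub> gs ! (s div m)) * m + s mod m"

lemma idx: "\<gamma> \<in> carrier G \<Longrightarrow> idx \<gamma> < length gs \<and> gs ! idx \<gamma> = \<gamma>"
proof -
  assume "\<gamma> \<in> carrier G"
  then obtain a where "a < length gs" "gs ! a = \<gamma>" using gs by (metis in_set_conv_nth)
  then have "\<exists>!a. a < length gs \<and> gs ! a = \<gamma>"
    using gs(1) by (auto simp: nth_eq_iff_index_eq)
  then show ?thesis unfolding idx_def by (rule theI')
qed

lemma idx_nth: "a < length gs \<Longrightarrow> idx (gs ! a) = a"
  using idx[of "gs ! a"] gs by (metis nth_eq_iff_index_eq nth_mem)

lemma gs_closed: "a < length gs \<Longrightarrow> gs ! a \<in> carrier G"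
  using gs(2) by (metis nth_mem)

lemma block_less:
  assumes "a < n" "k < m" shows "a * m + k < n * (m :: nat)"
proof -
  have "a * m + k < Suc a * m" using assms by simp
  also have "\<dots> \<le> n * m" using assms by (intro mult_le_mono1) simp
  finally show ?thesis .
qed

lemma block_div: "k < m \<Longrightarrow> (a * m + k) div m = (a :: nat)"
  by (cases "m = 0") simp_all

lemma shift:
  assumes s: "s < length gs * m" and b: "\<beta> \<in> carrier G"
  shows "shift m \<beta> s < length gs * m" "shift m \<beta> s mod m = s mod m"
    "shift m \<beta> s div m = idx (\<beta> \<otimes>\<^bsub>G\<^esub> gs ! (s div m))"
    "gs ! (shift m \<beta> s div m) = \<beta> \<otimes>\<^bsub>G\<^esub> gs ! (s div m)"
proof -
  have m: "m > 0" using s by (cases m) auto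
  have a: "s div m < length gs" using s m by (simp add: div_less_iff_less_mult)
  have c: "\<beta> \<otimes>\<^bsub>G\<^esub> gs ! (s div m) \<in> carrier G" using b gs_closed[OF a] by simp
  show "shift m \<beta> s < length gs * m"
    unfolding shift_def using idx[OF c] m by (intro block_less) auto
  show "shift m \<beta> s mod m = s mod m" unfolding shift_def by simp
  show d: "shift m \<beta> s div m = idx (\<beta> \<otimes>\<^bsub>G\<^esub> gs ! (s div m))" unfolding shift_def using m by simp
  show "gs ! (shift m \<beta> s div m) = \<beta> \<otimes>\<^bsub>G\<^esub> gs ! (s div m)" unfolding d using idx[OF c] by simp
qed

lemma shift_mult:
  assumes s: "s < length gs * m" and g: "\<alpha> \<in> carrier G" "\<beta> \<in> carrier G"
  shows "shift m \<alpha> (shift m \<beta> s) = shift m (\<alpha> \<otimes>\<^bsub>G\<^esub> \<beta>) s"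
proof -
  have m: "m > 0" using s by (cases m) auto
  have a: "s div m < length gs" using s m by (simp add: div_less_iff_less_mult)
  show ?thesis using shift[OF s g(2)] g gs_closed[OF a]
    unfolding shift_def[of m \<alpha>] shift_def[of m "\<alpha> \<otimes>\<^bsub>G\<^esub> \<beta>"] by (simp add: G.m_assoc)
qed

lemma shift_one:
  assumes s: "s < length gs * m" shows "shift m \<one>\<^bsub>G\<^esub> s = s"
proof -
  have m: "m > 0" using s by (cases m) auto
  have a: "s div m < length gs" using s m by (simp add: div_less_iff_less_mult)
  show ?thesis unfolding shift_def using gs_closed[OF a] idx_nth[OF a] by simp
qed

abbreviation SX :: "'x list \<Rightarrow> 'x list" where
  "SX Xs \<equiv> concat (map (\<lambda>\<gamma>. hull_action_obj \<phi> \<gamma> Xs) gs)"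

lemma length_hull_action: "length (hull_action_obj \<phi> \<gamma> Xs) = length Xs"
  by (simp add: hull_action_obj_def)

lemma nth_hull_action: "k < length Xs \<Longrightarrow> hull_action_obj \<phi> \<gamma> Xs ! k = \<phi> \<gamma> (Xs ! k)"
  by (simp add: hull_action_obj_def)

lemma length_SX: "length (SX Xs) = length gs * length Xs"
  by (simp add: length_concat comp_def hull_action_obj_def sum_list_triv)

lemma nth_concat_map:
  assumes "r < length hs * length Xs"
  shows "concat (map (\<lambda>\<gamma>. hull_action_obj \<phi> \<gamma> Xs) hs) ! r = \<phi> (hs ! (r div length Xs)) (Xs ! (r mod length Xs))"
  using assms
proof (induction hs arbitrary: r)
  case (Cons h hs)
  have m: "length Xs > 0" using Cons.prems by (cases Xs) auto
  show ?case
  proof (cases "r < length Xs")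
    case True
    then show ?thesis by (simp add: nth_append hull_action_obj_def)
  next
    case False
    then have "r div length Xs = Suc ((r - length Xs) div length Xs)"
      "r mod length Xs = (r - length Xs) mod length Xs"
      using m by (simp_all add: le_div_geq le_mod_geq)
    moreover have "r - length Xs < length hs * length Xs" using Cons.prems False by simp
    ultimately show ?thesis
      using Cons.IH[of "r - length Xs"] False by (simp add: nth_append hull_action_obj_def)
  qed
qed simp

lemmas nth_SX = nth_concat_map[of _ gs]

lemma SX_closed: "Xs \<in> lists XX \<Longrightarrow> SX Xs \<in> lists XX"
  using gs(2) by (auto simp: hull_action_obj_def)

lemma SX_closed0: "Xs \<in> lists XX\<^sub>0 \<Longrightarrow> SX Xs \<in> lists XX\<^sub>0"
  using gs(2) by (auto simp: hull_action_obj_def phi_XX0)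

lemma fst_S_obj: "fst (S_obj G gs \<phi> R Xs) = SX Xs"
  unfolding S_obj_def by (simp add: Let_def)

lemma snd_S_obj:
  "snd (S_obj G gs \<phi> R Xs) =
    (\<lambda>\<beta> \<in> carrier G. index_mor R (hull_action_obj \<phi> \<beta> (SX Xs)) (SX Xs) UNIV (shift (length Xs) \<beta>))"
proof -
  let ?m = "length Xs"
  have "(r mod ?m = s mod ?m \<and> gs ! (r div ?m) = \<beta> \<otimes>\<^bsub>G\<^esub> gs ! (s div ?m)) \<longleftrightarrow> r = shift ?m \<beta> s"
    if b: "\<beta> \<in> carrier G" and r: "r < length (SX Xs)" and s: "s < length (SX Xs)" for \<beta> r s
  proof
    have r': "r < length gs * ?m" and s': "s < length gs * ?m" using r s unfolding length_SX .
    have m: "?m > 0" using s' by (cases Xs) auto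
    have a: "r div ?m < length gs" using r' m by (simp add: div_less_iff_less_mult)
    { assume *: "r mod ?m = s mod ?m \<and> gs ! (r div ?m) = \<beta> \<otimes>\<^bsub>G\<^esub> gs ! (s div ?m)"
      then have "shift ?m \<beta> s = r div ?m * ?m + r mod ?m"
        unfolding shift_def using idx_nth[OF a] by simp
      then show "r = shift ?m \<beta> s" by simp }
    { assume "r = shift ?m \<beta> s"
      then show "r mod ?m = s mod ?m \<and> gs ! (r div ?m) = \<beta> \<otimes>\<^bsub>G\<^esub> gs ! (s div ?m)"
        using shift[OF s' b] by simp }
  qed
  then show ?thesis
    unfolding S_obj_def Let_def index_mor_def
    by (auto simp: fun_eq_iff restrict_def hull_action_obj_def)
qed

lemma shift_SX:
  assumes Xs: "Xs \<in> lists XX" and s: "s < length (SX Xs)" and b: "\<beta> \<in> carrier G"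
  shows "shift (length Xs) \<beta> s < length (SX Xs) \<and> SX Xs ! shift (length Xs) \<beta> s = \<phi> \<beta> (SX Xs ! s)"
proof -
  let ?m = "length Xs"
  have s': "s < length gs * ?m" using s unfolding length_SX .
  have m: "?m > 0" using s' by (cases Xs) auto
  have a: "s div ?m < length gs" using s' m by (simp add: div_less_iff_less_mult)
  have X: "Xs ! (s mod ?m) \<in> XX" using Xs m by (simp add: in_lists_conv_set)
  show ?thesis
    using shift[OF s' b] nth_SX[OF s'] nth_SX[OF shift(1)[OF s' b]] b gs_closed[OF a] X
    by (simp add: length_SX phi_mult)
qed

lemma index_mor_action:
  "index_mor R (hull_action_obj \<phi> \<alpha> Xs) (hull_action_obj \<phi> \<beta> Ys) A \<pi> = index_mor R Xs Ys A \<pi>"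
  "index_mor R (hull_action_obj \<phi> \<alpha> Xs) Ys A \<pi> = index_mor R Xs Ys A \<pi>"
  "index_mor R Xs (hull_action_obj \<phi> \<alpha> Ys) A \<pi> = index_mor R Xs Ys A \<pi>"
  by (simp_all add: index_mor_def hull_action_obj_def)

lemma S_obj_in_EC:
  assumes Xs: "Xs \<in> lists XX"
  shows "S_obj G gs \<phi> R Xs \<in> Obj act.EC"
proof -
  let ?SP = "S_obj G gs \<phi> R Xs" and ?h = "hull_action_obj \<phi>"
  let ?m = "length Xs" and ?S = "SX Xs"
  note SO = SX_closed[OF Xs]
  have "(fst ?SP, snd ?SP) \<in> Obj act.EC"
  proof (rule act.EC_objI)
    show "snd ?SP \<one>\<^bsub>G\<^esub> = Idt F (fst ?SP)"
      unfolding snd_S_obj fst_S_obj Idt_index_mor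
      by (auto intro!: index_mor_cong simp: shift_one length_SX length_hull_action)
  next
    fix \<alpha> \<beta> assume g: "\<alpha> \<in> carrier G" "\<beta> \<in> carrier G"
    have abS: "?h (\<alpha> \<otimes>\<^bsub>G\<^esub> \<beta>) ?S \<in> lists XX"
      using g SO act.aO_closed[of "\<alpha> \<otimes>\<^bsub>G\<^esub> \<beta>" ?S] by simp
    have "Cmp F (?h (\<alpha> \<otimes>\<^bsub>G\<^esub> \<beta>) ?S) (?h \<alpha> ?S) ?S
        (index_mor R (?h \<alpha> ?S) ?S UNIV (shift ?m \<alpha>))
        (index_mor R (?h (\<alpha> \<otimes>\<^bsub>G\<^esub> \<beta>) ?S) (?h \<alpha> ?S) UNIV (shift ?m \<beta>)) =
      index_mor R (?h (\<alpha> \<otimes>\<^bsub>G\<^esub> \<beta>) ?S) ?S {s \<in> UNIV. shift ?m \<beta> s \<in> UNIV} (\<lambda>s. shift ?m \<alpha> (shift ?m \<beta> s))"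
    proof (rule Cmp_index_mor[OF abS SO])
      fix s assume s: "s < length (?h (\<alpha> \<otimes>\<^bsub>G\<^esub> \<beta>) ?S)"
      then have s': "s < length ?S" by (simp add: length_hull_action nth_hull_action)
      then have "?S ! s \<in> XX" using SO by (metis in_lists_conv_set nth_mem)
      then show "shift ?m \<beta> s < length (?h \<alpha> ?S) \<and> ?h \<alpha> ?S ! shift ?m \<beta> s = ?h (\<alpha> \<otimes>\<^bsub>G\<^esub> \<beta>) ?S ! s"
        using shift_SX[OF Xs s' g(2)] s' g by (simp add: length_hull_action nth_hull_action phi_mult)
    qed
    also have "\<dots> = index_mor R (?h (\<alpha> \<otimes>\<^bsub>G\<^esub> \<beta>) ?S) ?S UNIV (shift ?m (\<alpha> \<otimes>\<^bsub>G\<^esub> \<beta>))"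
      using g by (intro index_mor_cong) (auto simp: shift_mult length_SX length_hull_action nth_hull_action)
    finally show "snd ?SP (\<alpha> \<otimes>\<^bsub>G\<^esub> \<beta>) =
      Cmp F (?h (\<alpha> \<otimes>\<^bsub>G\<^esub> \<beta>) (fst ?SP)) (?h \<alpha> (fst ?SP))
        (fst ?SP) (snd ?SP \<alpha>)
        (hull_action_mor \<alpha> (?h \<beta> (fst ?SP)) (fst ?SP)
          (snd ?SP \<beta>))"
      unfolding snd_S_obj fst_S_obj hull_action_mor_def using g by (simp add: index_mor_action)
  qed (use SO in \<open>simp_all add: fst_S_obj snd_S_obj\<close>)
  then show ?thesis by simp
qed

lemma finsum_entry:
  assumes "Xs \<in> lists XX" "Ys \<in> lists XX" "finite I" "f \<in> I \<rightarrow> mor F Xs Ys"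
    and rs: "r < length Ys" "s < length Xs"
  shows "finsum (Hom F Xs Ys) f I (r, s) = (\<Oplus>i\<in>I. f i (r, s))"
  using assms
  by (intro additive_map_finsum[where h = "\<lambda>M. M (r, s)"] Hom_abelian_group abelian_group_axioms)
    (auto simp: mor_F_iff add_F)

text \<open>With \<open>i\<close>, \<open>p\<close> the inclusion and projection of the block of positions indexed by \<open>\<one>\<close>, the
  composite \<open>i p\<close> is the diagonal idempotent of that block. Its conjugate under \<open>\<gamma>\<close> is the diagonal
  idempotent of the block indexed by \<open>\<gamma>\<close>, and these idempotents add up to the identity.\<close>

lemma S_obj_induced:
  assumes P: "Ps \<in> lists XX\<^sub>0"
  shows "act.induced Ps (S_obj G gs \<phi> R Ps)"
proof -
  let ?m = "length Ps" and ?S = "SX Ps" and ?a = "idx \<one>\<^bsub>G\<^esub>" and ?h = "hull_action_obj \<phi>"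
  let ?SP = "S_obj G gs \<phi> R Ps"
  have PO: "Ps \<in> lists XX" using P XX0_subset by (auto dest: subsetD)
  note SO = SX_closed[OF PO]
  have a: "?a < length gs" "gs ! ?a = \<one>\<^bsub>G\<^esub>" using idx[of "\<one>\<^bsub>G\<^esub>"] by auto
  have pos: "?a * ?m + k < length ?S \<and> ?S ! (?a * ?m + k) = Ps ! k" if k: "k < ?m" for k
  proof -
    have "?a * ?m + k < length gs * ?m" using block_less[OF a(1) k] .
    moreover have "Ps ! k \<in> XX" using PO k by (simp add: in_lists_conv_set)
    ultimately show ?thesis using nth_SX[of "?a * ?m + k" Ps] a k block_div[OF k] by (simp add: length_SX phi_one)
  qed
  have in_block: "s \<in> {?a * ?m..<?a * ?m + ?m} \<longleftrightarrow> s div ?m = ?a" if "s < length ?S" for s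
  proof -
    have m: "?m > 0" using that unfolding length_SX by (cases Ps) auto
    have "s div ?m = ?a \<longleftrightarrow> ?a \<le> s div ?m \<and> s div ?m < Suc ?a" by auto
    then show ?thesis using m by (simp add: less_eq_div_iff_mult_less_eq div_less_iff_less_mult add.commute)
  qed
  have le: "?a * ?m + ?m \<le> length ?S"
  proof -
    have "Suc ?a * ?m \<le> length gs * ?m" using a by (intro mult_le_mono1) simp
    then show ?thesis by (simp add: length_SX)
  qed
  define Qs where "Qs = take (?a * ?m) ?S @ drop (?a * ?m + ?m) ?S"
  let ?i = "index_mor R Ps ?S UNIV (\<lambda>k. ?a * ?m + k)"
  let ?p = "index_mor R ?S Ps {?a * ?m..<?a * ?m + ?m} (\<lambda>s. s - ?a * ?m)"
  obtain j q where bp: "biproduct F Ps Qs ?S ?i j ?p q"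
    using block_biproduct[OF SO le, of Ps] pos unfolding Qs_def by auto
  have "Qs \<in> lists XX\<^sub>0"
    using SX_closed0[OF P] unfolding Qs_def by (auto dest: in_set_takeD in_set_dropD)
  then have Q: "projective_object F E Qs" by (simp add: projective_object_iff)
  have struct: "snd ?SP \<beta> = index_mor R (?h \<beta> ?S) ?S UNIV (shift ?m \<beta>)" if "\<beta> \<in> carrier G" for \<beta>
    using that by (simp add: snd_S_obj)
  \<comment> \<open>\<open>\<gamma>\<close> moves the block of \<open>\<one>\<close> to the block of \<open>\<gamma>\<close>.\<close>
  have off: "Cmp F (?h \<gamma> Ps) ?S Ps ?p
      (Cmp F (?h \<gamma> Ps) (?h \<gamma> ?S) ?S (snd ?SP \<gamma>) (hull_action_mor \<gamma> Ps ?S ?i)) = zero_mor F (?h \<gamma> Ps) Ps"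
    if g: "\<gamma> \<in> carrier G" "\<gamma> \<noteq> \<one>\<^bsub>G\<^esub>" for \<gamma>
  proof -
    have gP: "?h \<gamma> Ps \<in> lists XX" using act.aO_closed[of \<gamma> Ps] g PO by simp
    have 1: "Cmp F (?h \<gamma> Ps) (?h \<gamma> ?S) ?S (snd ?SP \<gamma>) (hull_action_mor \<gamma> Ps ?S ?i) =
        index_mor R (?h \<gamma> Ps) ?S UNIV (\<lambda>k. shift ?m \<gamma> (?a * ?m + k))"
    proof -
      have "hull_action_mor \<gamma> Ps ?S ?i = index_mor R (?h \<gamma> Ps) (?h \<gamma> ?S) UNIV (\<lambda>k. ?a * ?m + k)"
        by (simp add: hull_action_mor_def index_mor_action)
      then show ?thesis unfolding struct[OF g(1)]
        by (simp only:, subst Cmp_index_mor[OF gP SO])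
          (use pos in \<open>auto simp: length_hull_action nth_hull_action\<close>)
    qed
    have sh: "shift ?m \<gamma> (?a * ?m + k) div ?m = idx \<gamma>" "shift ?m \<gamma> (?a * ?m + k) < length ?S"
      "?S ! shift ?m \<gamma> (?a * ?m + k) = \<phi> \<gamma> (Ps ! k)" if k: "k < ?m" for k
      using shift(3)[OF _ g(1), of "?a * ?m + k" ?m] shift_SX[OF PO _ g(1), of "?a * ?m + k"] pos[OF k] a g k block_div[OF k]
      by (auto simp: length_SX)
    have "idx \<gamma> \<noteq> ?a" using idx[OF g(1)] a g by auto
    then have "index_mor R (?h \<gamma> Ps) Ps {k \<in> UNIV. shift ?m \<gamma> (?a * ?m + k) \<in> {?a * ?m..<?a * ?m + ?m}}
        (\<lambda>k. shift ?m \<gamma> (?a * ?m + k) - ?a * ?m) = zero_mor F (?h \<gamma> Ps) Ps"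
      unfolding zero_index_mor[of _ _ "\<lambda>k. shift ?m \<gamma> (?a * ?m + k) - ?a * ?m"]
      using in_block sh by (intro index_mor_cong) (auto simp: length_hull_action nth_hull_action)
    then show ?thesis unfolding 1
      using sh by (subst Cmp_index_mor[OF gP PO]) (auto simp: length_hull_action nth_hull_action)
  qed
  let ?e = "Cmp F ?S Ps ?S ?i ?p"
  have e: "?e = index_mor R ?S ?S {s. s div ?m = ?a} (\<lambda>s. s)"
  proof -
    have "?e = index_mor R ?S ?S {s \<in> {?a * ?m..<?a * ?m + ?m}. s - ?a * ?m \<in> UNIV} (\<lambda>s. ?a * ?m + (s - ?a * ?m))"
    proof (rule Cmp_index_mor[OF SO SO])
      fix s assume "s \<in> {?a * ?m..<?a * ?m + ?m}"
      then show "s - ?a * ?m < length Ps \<and> Ps ! (s - ?a * ?m) = ?S ! s"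
        using pos[of "s - ?a * ?m"] by auto
    qed
    also have "\<dots> = index_mor R ?S ?S {s. s div ?m = ?a} (\<lambda>s. s)"
    proof (rule index_mor_cong)
      fix s assume "s < length ?S"
      from in_block[OF this]
      show "s \<in> {s \<in> {?a * ?m..<?a * ?m + ?m}. s - ?a * ?m \<in> UNIV} \<longleftrightarrow> s \<in> {s. s div ?m = ?a}" by simp
    qed auto
    finally show ?thesis .
  qed
  have conj_e: "act.conj_mor \<gamma> ?SP ?SP ?e = index_mor R ?S ?S {s. gs ! (s div ?m) = \<gamma>} (\<lambda>s. s)"
    if g: "\<gamma> \<in> carrier G" for \<gamma>
  proof -
    have gS: "?h \<gamma> ?S \<in> lists XX" using act.aO_closed[of \<gamma> ?S] g SO by simp
    have 1: "act.inv_str ?SP \<gamma> = index_mor R ?S (?h \<gamma> ?S) UNIV (shift ?m (inv\<^bsub>G\<^esub> \<gamma>))"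
      unfolding act.inv_str_def hull_action_mor_def fst_S_obj using g
      by (simp add: struct index_mor_action)
    have "Cmp F (?h \<gamma> ?S) (?h \<gamma> ?S) ?S (snd ?SP \<gamma>) (hull_action_mor \<gamma> ?S ?S ?e) =
        Cmp F (?h \<gamma> ?S) (?h \<gamma> ?S) ?S (index_mor R (?h \<gamma> ?S) ?S UNIV (shift ?m \<gamma>))
          (index_mor R (?h \<gamma> ?S) (?h \<gamma> ?S) {s. s div ?m = ?a} (\<lambda>s. s))"
      unfolding struct[OF g] e by (simp add: hull_action_mor_def index_mor_action)
    also have "\<dots> = index_mor R (?h \<gamma> ?S) ?S {s. s div ?m = ?a} (shift ?m \<gamma>)"
      by (subst Cmp_index_mor[OF gS SO]) auto
    finally have 2: "Cmp F (?h \<gamma> ?S) (?h \<gamma> ?S) ?S (snd ?SP \<gamma>) (hull_action_mor \<gamma> ?S ?S ?e) =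
        index_mor R (?h \<gamma> ?S) ?S {s. s div ?m = ?a} (shift ?m \<gamma>)" .
    have "act.conj_mor \<gamma> ?SP ?SP ?e =
        Cmp F ?S (?h \<gamma> ?S) ?S (index_mor R (?h \<gamma> ?S) ?S {s. s div ?m = ?a} (shift ?m \<gamma>))
          (index_mor R ?S (?h \<gamma> ?S) UNIV (shift ?m (inv\<^bsub>G\<^esub> \<gamma>)))"
      unfolding act.conj_mor_def fst_S_obj 1 2 ..
    also have "\<dots> = index_mor R ?S ?S {s \<in> UNIV. shift ?m (inv\<^bsub>G\<^esub> \<gamma>) s \<in> {s. s div ?m = ?a}}
        (\<lambda>s. shift ?m \<gamma> (shift ?m (inv\<^bsub>G\<^esub> \<gamma>) s))"
    proof (rule Cmp_index_mor[OF SO SO])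
      fix s assume s: "s < length ?S"
      then have "?S ! s \<in> XX" using SO by (metis in_lists_conv_set nth_mem)
      then show "shift ?m (inv\<^bsub>G\<^esub> \<gamma>) s < length (?h \<gamma> ?S) \<and> ?h \<gamma> ?S ! shift ?m (inv\<^bsub>G\<^esub> \<gamma>) s = ?S ! s"
        using shift_SX[OF PO s, of "inv\<^bsub>G\<^esub> \<gamma>"] g by (simp add: length_hull_action nth_hull_action phi_mult phi_one)
    qed
    also have "\<dots> = index_mor R ?S ?S {s. gs ! (s div ?m) = \<gamma>} (\<lambda>s. s)"
    proof (rule index_mor_cong)
      fix s assume s: "s < length ?S"
      then have s': "s < length gs * ?m" unfolding length_SX .
      have m: "?m > 0" using s' by (cases Ps) auto
      have b: "s div ?m < length gs" using s' m by (simp add: div_less_iff_less_mult)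
      show "shift ?m \<gamma> (shift ?m (inv\<^bsub>G\<^esub> \<gamma>) s) = s"
        using g s' by (simp add: shift_mult shift_one)
      have "shift ?m (inv\<^bsub>G\<^esub> \<gamma>) s div ?m = ?a \<longleftrightarrow> inv\<^bsub>G\<^esub> \<gamma> \<otimes>\<^bsub>G\<^esub> gs ! (s div ?m) = \<one>\<^bsub>G\<^esub>"
      proof -
        have c: "inv\<^bsub>G\<^esub> \<gamma> \<otimes>\<^bsub>G\<^esub> gs ! (s div ?m) \<in> carrier G" using g gs_closed[OF b] by simp
        have "shift ?m (inv\<^bsub>G\<^esub> \<gamma>) s div ?m = idx (inv\<^bsub>G\<^esub> \<gamma> \<otimes>\<^bsub>G\<^esub> gs ! (s div ?m))"
          using shift(3)[OF s'] g by simp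
        then show ?thesis using idx[OF c] a(2) by metis
      qed
      also have "\<dots> \<longleftrightarrow> gs ! (s div ?m) = \<gamma>"
        using g gs_closed[OF b] G.inv_solve_left'[of "\<one>\<^bsub>G\<^esub>" \<gamma> "gs ! (s div ?m)"] by auto
      finally show "s \<in> {s \<in> UNIV. shift ?m (inv\<^bsub>G\<^esub> \<gamma>) s \<in> {s. s div ?m = ?a}} \<longleftrightarrow> s \<in> {s. gs ! (s div ?m) = \<gamma>}"
        by simp
    qed simp_all
    finally show ?thesis .
  qed
  have "act.tr ?SP ?SP ?e = Idt F ?S"
  proof (rule mor_F_eqI)
    have S: "?SP \<in> Obj act.EC" by (rule S_obj_in_EC[OF PO])
    have eM: "?e \<in> mor F ?S ?S" unfolding e by simp
    show "act.tr ?SP ?SP ?e \<in> mor F ?S ?S"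
      using act.EC_mor[OF act.tr_closed[OF S S]] eM by (simp add: fst_S_obj)
    show "Idt F ?S \<in> mor F ?S ?S" unfolding Idt_index_mor by simp
    fix r s assume rs: "r < length ?S" "s < length ?S"
    have m: "?m > 0" using rs unfolding length_SX by (cases Ps) auto
    have b: "s div ?m < length gs" using rs m unfolding length_SX by (simp add: div_less_iff_less_mult)
    have "act.tr ?SP ?SP ?e (r, s) = (\<Oplus>\<gamma>\<in>carrier G. act.conj_mor \<gamma> ?SP ?SP ?e (r, s))"
      unfolding act.tr_def fst_S_obj
      by (rule finsum_entry[OF SO SO finite_G _ rs]) (simp add: conj_e)
    also have "\<dots> = (\<Oplus>\<gamma>\<in>carrier G. if gs ! (s div ?m) = \<gamma> then if r = s then \<one> else \<zero> else \<zero>)"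
    proof (intro add.finprod_cong')
      fix \<gamma> assume g: "\<gamma> \<in> carrier G"
      show "act.conj_mor \<gamma> ?SP ?SP ?e (r, s) =
          (if gs ! (s div ?m) = \<gamma> then if r = s then \<one> else \<zero> else \<zero>)"
        using rs by (subst conj_e[OF g]) (simp add: index_mor_def)
    qed auto
    also have "\<dots> = (if r = s then \<one> else \<zero>)"
      using gs_closed[OF b] finite_G by (intro finsum_singleton) auto
    finally show "act.tr ?SP ?SP ?e (r, s) = Idt F ?S (r, s)"
      using rs by (simp add: Idt_F)
  qed
  then show ?thesis
    unfolding act.induced_def fst_S_obj using S_obj_in_EC[OF PO] Q bp off by blast
qed

theorem F_G_frobenius:
  "frobenius_category (F_G G \<phi> R u XX c) (F_G_sequences G \<phi> R u XX c XX\<^sub>0)"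
  "Q \<in> Obj (F_G G \<phi> R u XX c) \<Longrightarrow>
     projective_injective (F_G G \<phi> R u XX c) (F_G_sequences G \<phi> R u XX c XX\<^sub>0) Q \<longleftrightarrow>
     (\<exists>P \<in> lists XX\<^sub>0. direct_summand (F_G G \<phi> R u XX c) Q (S_obj G gs \<phi> R P))"
  using act.EC_frobenius[of "S_obj G gs \<phi> R"] S_obj_induced
  unfolding F_G_def F_G_sequences_def frobenius_sequences_eq projective_object_iff by blast+

end

theorem theorem1p4p6:
  fixes XX XX\<^sub>0 :: "'x set" and c :: "'x \<Rightarrow> 'x \<Rightarrow> 'x \<Rightarrow> nat"
    and G :: "'g monoid" and \<phi> :: "'g \<Rightarrow> 'x \<Rightarrow> 'x" and gs :: "'g list"
    and R :: "'r ring" and u :: 'r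
  assumes "frobenius_cyclic_poset TYPE('r) XX c XX\<^sub>0"
    and "group G" and "finite (carrier G)"
    and "acts_on_frobenius_cyclic_poset G XX c XX\<^sub>0 \<phi>"
    and "discrete_valuation_ring R" and "uniformizer R u"
    and "\<not> ring_characteristic (R Quot (PIdl\<^bsub>R\<^esub> u)) dvd order G"
    and "contains_all_roots_of_unity R (order G)"
    and "distinct gs" and "set gs = carrier G"
  shows "frobenius_category (F_G G \<phi> R u XX c) (F_G_sequences G \<phi> R u XX c XX\<^sub>0) \<and>
    (\<forall>Q \<in> Obj (F_G G \<phi> R u XX c).
       projective_injective (F_G G \<phi> R u XX c) (F_G_sequences G \<phi> R u XX c XX\<^sub>0) Q \<longleftrightarrow>
       (\<exists>P \<in> lists XX\<^sub>0. direct_summand (F_G G \<phi> R u XX c) Q (S_obj G gs \<phi> R P)))"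
proof -
  interpret R: discrete_valuation_ring R by fact
  interpret cyclic_poset XX c using assms(1) unfolding frobenius_cyclic_poset_def by simp
  have u: "u \<in> carrier R" using assms(6) unfolding uniformizer_def by simp
  interpret hull_setting XX c R u by unfold_locales fact
  obtain E where E: "frobenius_category F E"
    "\<And>A. A \<in> lists XX \<Longrightarrow> indecomposable F A \<and> projective_injective F E A \<longleftrightarrow>
       (\<exists>X \<in> XX\<^sub>0. isomorphic F A [X])"
    using assms(1,5,6) unfolding frobenius_cyclic_poset_def Obj_F[symmetric] by blast
  interpret E: frobenius_category F E by fact
  interpret G: group G by fact
  have "hull_action XX c R u E XX\<^sub>0 G \<phi> gs"
    using assms E(2) uniformizer_not_unit[OF assms(5,6)]
    by unfold_locales (auto simp: frobenius_cyclic_poset_def)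
  from hull_action.F_G_frobenius[OF this] show ?thesis by blast
qed

end
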